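(* Let $\mathfrak k$ be a nonzero commutative ring, $n\ge2$, and let $R$ be any one of the following $\mathfrak k$-algebras: the free associative algebra $A=\mathfrak k\langle x_1,\dots,x_n\rangle$; the group algebra $\Lambda=\mathfrak kF$ of the free group $F$ on $t_1,\dots,t_n$, with $x_i:=t_i-1$; the formal power series algebra $\Gamma=\mathfrak k\langle\langle x_1,\dots,x_n\rangle\rangle$ in non-commuting variables. Let $L(R)$ be the Leavitt localization of $R$ inverting universally the row $(x_1,\dots,x_n)$. Then the module type of $L(R)$ is $(1,n)$.
   Context: $L(R)$ is the $\mathfrak k$-algebra generated over $R$ by elements $x_1^*,\dots,x_n^*$ subject to the relations $x_i^*x_j=\delta_{ij}$ and $\sum_{i=1}^nx_ix_i^*=1$. For a ring $T$ without invariant basis number, the module type of $T$ is the unique pair $(p,q)$ of smallest possible positive integers $p\le q-1$ such that the free $T$-modules of ranks $p$ and $q$ are isomorphic. In particular, module type $(1,n)$ means that $T\cong T^n$ as modules and $T\not\cong T^q$ for $1<q<n$. *)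

theory Defs
  imports "HOL-Algebra.QuotRing" "HOL-Algebra.Module"
begin

section \<open>Free monoids and free groups\<close>

definition free_monoid :: "'a set \<Rightarrow> 'a list monoid" where
  "free_monoid S = \<lparr>carrier = lists S, mult = (@), one = []\<rparr>"

text \<open>The letter \<open>(a, True)\<close> stands for the generator \<open>a\<close> and \<open>(a, False)\<close> for its inverse.
  Elements of the free group are the reduced words.\<close>

fun cancel_cons :: "'a \<times> bool \<Rightarrow> ('a \<times> bool) list \<Rightarrow> ('a \<times> bool) list" where
  "cancel_cons a [] = [a]"
| "cancel_cons a (b # w) = (if fst a = fst b \<and> snd a \<noteq> snd b then w else a # b # w)"

fun reduced :: "('a \<times> bool) list \<Rightarrow> bool" where
  "reduced (a # b # w) \<longleftrightarrow> \<not> (fst a = fst b \<and> snd a \<noteq> snd b) \<and> reduced (b # w)"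
| "reduced _ \<longleftrightarrow> True"

definition free_group :: "'a set \<Rightarrow> ('a \<times> bool) list monoid" where
  "free_group S =
    \<lparr>carrier = {w \<in> lists (S \<times> UNIV). reduced w},
     mult = (\<lambda>u v. foldr cancel_cons u v), one = []\<rparr>"

section \<open>Monoid algebras and formal power series\<close>

text \<open>Both kinds of algebra consist of functions from a monoid \<open>M\<close> to \<open>K\<close> (set to zero outside
  \<open>carrier M\<close>) with convolution as product. The sum defining a coefficient of a product runs only
  over pairs on which both factors are nonzero. It is finite for finitely supported functions, and
  also for arbitrary functions on a free monoid, since a word has finitely many factorizations.\<close>

definition convolution_algebra ::
  "('k, 'b) ring_scheme \<Rightarrow> ('m, 'c) monoid_scheme \<Rightarrow> ('m \<Rightarrow> 'k) set \<Rightarrow> ('k, 'm \<Rightarrow> 'k) module" where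
  "convolution_algebra K M C =
    \<lparr>carrier = C,
     mult = (\<lambda>f g w. finsum K (\<lambda>(u, v). f u \<otimes>\<^bsub>K\<^esub> g v)
       {(u, v). u \<in> carrier M \<and> v \<in> carrier M \<and> u \<otimes>\<^bsub>M\<^esub> v = w
          \<and> f u \<noteq> \<zero>\<^bsub>K\<^esub> \<and> g v \<noteq> \<zero>\<^bsub>K\<^esub>}),
     one = (\<lambda>w. if w = \<one>\<^bsub>M\<^esub> then \<one>\<^bsub>K\<^esub> else \<zero>\<^bsub>K\<^esub>),
     zero = (\<lambda>w. \<zero>\<^bsub>K\<^esub>),
     add = (\<lambda>f g w. f w \<oplus>\<^bsub>K\<^esub> g w),
     smult = (\<lambda>c f w. c \<otimes>\<^bsub>K\<^esub> f w)\<rparr>"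

definition coeff_functions ::
  "('k, 'b) ring_scheme \<Rightarrow> ('m, 'c) monoid_scheme \<Rightarrow> ('m \<Rightarrow> 'k) set" where
  "coeff_functions K M = {f. f \<in> carrier M \<rightarrow> carrier K \<and> (\<forall>w. w \<notin> carrier M \<longrightarrow> f w = \<zero>\<^bsub>K\<^esub>)}"

definition monoid_algebra ::
  "('k, 'b) ring_scheme \<Rightarrow> ('m, 'c) monoid_scheme \<Rightarrow> ('k, 'm \<Rightarrow> 'k) module" where
  "monoid_algebra K M =
    convolution_algebra K M {f \<in> coeff_functions K M. finite {w. f w \<noteq> \<zero>\<^bsub>K\<^esub>}}"

definition free_algebra :: "('k, 'b) ring_scheme \<Rightarrow> 'a set \<Rightarrow> ('k, 'a list \<Rightarrow> 'k) module" where
  "free_algebra K S = monoid_algebra K (free_monoid S)"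

definition free_group_algebra ::
  "('k, 'b) ring_scheme \<Rightarrow> 'a set \<Rightarrow> ('k, ('a \<times> bool) list \<Rightarrow> 'k) module" where
  "free_group_algebra K S = monoid_algebra K (free_group S)"

definition power_series_algebra ::
  "('k, 'b) ring_scheme \<Rightarrow> 'a set \<Rightarrow> ('k, 'a list \<Rightarrow> 'k) module" where
  "power_series_algebra K S =
    convolution_algebra K (free_monoid S) (coeff_functions K (free_monoid S))"

definition basis_elt :: "('k, 'b) ring_scheme \<Rightarrow> 'm \<Rightarrow> 'm \<Rightarrow> 'k" where
  "basis_elt K u = (\<lambda>w. if w = u then \<one>\<^bsub>K\<^esub> else \<zero>\<^bsub>K\<^esub>)"

section \<open>The Leavitt localization\<close>

text \<open>The \<open>K\<close>-algebra generated over \<open>R\<close> by \<open>x\<^sub>i\<^sup>*\<close> is presented as a quotient of the free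
  \<open>K\<close>-algebra on the disjoint union of \<open>carrier R\<close> and the index set. The first four families of
  relators make \<open>r \<mapsto> over r\<close> a homomorphism of unital \<open>K\<close>-algebras from \<open>R\<close>.\<close>

definition leavitt_generators :: "('r, 'b) ring_scheme \<Rightarrow> nat \<Rightarrow> ('r + nat) set" where
  "leavitt_generators R n = carrier R <+> {..<n}"

definition leavitt_relators ::
  "('k, 'b) ring_scheme \<Rightarrow> ('k, 'r, 'c) module_scheme \<Rightarrow> nat \<Rightarrow> (nat \<Rightarrow> 'r)
    \<Rightarrow> (('r + nat) list \<Rightarrow> 'k) set" where
  "leavitt_relators K R n x =
    (let F = free_algebra K (leavitt_generators R n);
         over = (\<lambda>r. basis_elt K [Inl r]);
         star = (\<lambda>i. basis_elt K [Inr i])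
     in {over (r \<oplus>\<^bsub>R\<^esub> s) \<ominus>\<^bsub>F\<^esub> (over r \<oplus>\<^bsub>F\<^esub> over s) | r s. r \<in> carrier R \<and> s \<in> carrier R}
      \<union> {over (r \<otimes>\<^bsub>R\<^esub> s) \<ominus>\<^bsub>F\<^esub> over r \<otimes>\<^bsub>F\<^esub> over s | r s. r \<in> carrier R \<and> s \<in> carrier R}
      \<union> {over (c \<odot>\<^bsub>R\<^esub> r) \<ominus>\<^bsub>F\<^esub> c \<odot>\<^bsub>F\<^esub> over r | c r. c \<in> carrier K \<and> r \<in> carrier R}
      \<union> {over \<one>\<^bsub>R\<^esub> \<ominus>\<^bsub>F\<^esub> \<one>\<^bsub>F\<^esub>}
      \<union> {star i \<otimes>\<^bsub>F\<^esub> over (x j) \<ominus>\<^bsub>F\<^esub> (if i = j then \<one>\<^bsub>F\<^esub> else \<zero>\<^bsub>F\<^esub>) | i j. i < n \<and> j < n}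
      \<union> {(\<Oplus>\<^bsub>F\<^esub>i\<in>{..<n}. over (x i) \<otimes>\<^bsub>F\<^esub> star i) \<ominus>\<^bsub>F\<^esub> \<one>\<^bsub>F\<^esub>})"

definition leavitt_localization ::
  "('k, 'b) ring_scheme \<Rightarrow> ('k, 'r, 'c) module_scheme \<Rightarrow> nat \<Rightarrow> (nat \<Rightarrow> 'r)
    \<Rightarrow> (('r + nat) list \<Rightarrow> 'k) set ring" where
  "leavitt_localization K R n x =
    (let F = free_algebra K (leavitt_generators R n)
     in F Quot (Idl\<^bsub>F\<^esub> (leavitt_relators K R n x)))"

section \<open>Module type\<close>

text \<open>The free left module of rank \<open>p\<close>. Its \<open>mult\<close> and \<open>one\<close> fields are irrelevant. The library's
  locale \<open>module\<close> requires commutative scalars, so module isomorphism is defined here as well.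
  The choice of left modules is immaterial: transposing matrices over \<open>T\<close> interchanges the two
  sides of an isomorphism between free modules of finite rank.\<close>

definition free_module :: "('a, 'b) ring_scheme \<Rightarrow> nat \<Rightarrow> ('a, nat \<Rightarrow> 'a) module" where
  "free_module T p =
    \<lparr>carrier = {..<p} \<rightarrow>\<^sub>E carrier T,
     mult = undefined,
     one = undefined,
     zero = (\<lambda>i\<in>{..<p}. \<zero>\<^bsub>T\<^esub>),
     add = (\<lambda>f g. \<lambda>i\<in>{..<p}. f i \<oplus>\<^bsub>T\<^esub> g i),
     smult = (\<lambda>a f. \<lambda>i\<in>{..<p}. a \<otimes>\<^bsub>T\<^esub> f i)\<rparr>"

definition module_iso ::
  "('a, 'b) ring_scheme \<Rightarrow> ('a, 'c, 'd) module_scheme \<Rightarrow> ('a, 'e, 'f) module_scheme \<Rightarrow> ('c \<Rightarrow> 'e) set"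
where
  "module_iso T M N =
    {h. bij_betw h (carrier M) (carrier N)
      \<and> (\<forall>u\<in>carrier M. \<forall>v\<in>carrier M. h (u \<oplus>\<^bsub>M\<^esub> v) = h u \<oplus>\<^bsub>N\<^esub> h v)
      \<and> (\<forall>a\<in>carrier T. \<forall>u\<in>carrier M. h (a \<odot>\<^bsub>M\<^esub> u) = a \<odot>\<^bsub>N\<^esub> h u)}"

definition free_modules_iso :: "('a, 'b) ring_scheme \<Rightarrow> nat \<Rightarrow> nat \<Rightarrow> bool" where
  "free_modules_iso T p q \<longleftrightarrow> module_iso T (free_module T p) (free_module T q) \<noteq> {}"

text \<open>Minimality is read as: \<open>p\<close> is least possible, and then \<open>q\<close> is least possible for this \<open>p\<close>.\<close>

definition has_module_type :: "('a, 'b) ring_scheme \<Rightarrow> nat \<Rightarrow> nat \<Rightarrow> bool" where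
  "has_module_type T p q \<longleftrightarrow>
    1 \<le> p \<and> p < q \<and> free_modules_iso T p q
    \<and> (\<forall>p' q'. 1 \<le> p' \<and> p' < q' \<and> free_modules_iso T p' q' \<longrightarrow> p < p' \<or> p = p' \<and> q \<le> q')"

lemma has_module_type_unique:
  assumes "has_module_type T p q" and "has_module_type T p' q'"
  shows "p = p' \<and> q = q'"
proof -
  have "p < p' \<or> p = p' \<and> q \<le> q'" and "p' < p \<or> p' = p \<and> q' \<le> q"
    using assms unfolding has_module_type_def by blast+
  then show ?thesis by auto
qed

lemma has_module_type_1_iff:
  "has_module_type T 1 n \<longleftrightarrow>
    1 < n \<and> free_modules_iso T 1 n \<and> (\<forall>q. 1 < q \<and> q < n \<longrightarrow> \<not> free_modules_iso T 1 q)"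
  unfolding has_module_type_def
  by (metis le_neq_implies_less less_irrefl not_less order_refl)

end

(* Let k be the quotient of K by a maximal ideal and V the space of power series over k in the
   noncommuting variables x_0, ..., x_{n-1}. In all three cases R acts on V by left multiplication
   by power series, and x_i^* acts by stripping a leading x_i. The relations of L(R) then hold up
   to operators vanishing on series of large order (only sum_i x_i x_i^* = 1 fails, on constants),
   and every element of L(R) commutes with right multiplication by the x_j on series of large
   order. An isomorphism of L(R) with L(R)^q thus yields an injective right linear map from a direct
   sum of q copies of a right ideal of finite codimension to V, again with image N of finite
   codimension. With m the augmentation ideal, Schreier's formula gives dim N/Nm = 1 mod n - 1 for
   every such N, hence q = 1 mod n - 1. Conversely, the row (x_i) and the column of stars define
   mutually inverse maps between L(R) and L(R)^n. *)

theory Submission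
  imports Defs "HOL-Algebra.Ring_Divisibility"
begin

section \<open>Rings and modules\<close>

text \<open>Power series are used rather than polynomials because \<open>1 + x_i\<close> must be
  invertible for the group algebra; so one space \<open>V\<close> serves all three cases. On
  constants the stars do not commute with right multiplication: stripping \<open>x_i\<close> from
  \<open>1 x_i\<close> gives 1, while stripping it from 1 gives 0. Hence \<open>V\<close> is not a
  module over L(R). Instead, the elements of the presenting free algebra that kill all series of
  large order form a two-sided ideal \<open>J\<close> containing the relators, and each equation in
  L(R) becomes an equation of operators beyond some order. An isomorphism involves finitely many
  equations, so one bound suffices for all of them. Two filtrations of \<open>V\<close> are used:
  \<open>low\<close>, by order, for which the operators are continuous, and \<open>cut\<close>, by
  word number, whose steps have dimension one, so that dimensions become numbers of leading words.
  The congruence comes from counting dim N/Nm twice: from the codimension c of N as 1 + (n-1)c, and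
  from q copies of \<open>cut p\<close> as q(1 + (n-1)p). No q strictly between 1 and n is congruent
  to 1 mod n-1, so nothing stronger is required.\<close>

lemma (in ring) exists_maximalideal:
  assumes "\<one> \<noteq> \<zero>"
  obtains M where "maximalideal M R"
proof -
  let ?S = "{I. ideal I R \<and> \<one> \<notin> I}"
  have "\<exists>M\<in>?S. \<forall>X\<in>?S. M \<subseteq> X \<longrightarrow> X = M"
  proof (rule subset_Zorn_nonempty)
    show "?S \<noteq> {}" using zeroideal assms by blast
    fix C assume C: "C \<noteq> {}" "subset.chain ?S C"
    have "subset.chain {I. ideal I R} C"
      using C(2) unfolding subset.chain_def pred_on.chain_def by blast
    from chain_Union_is_ideal[OF this] C show "\<Union>C \<in> ?S"
      unfolding pred_on.chain_def by auto
  qed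
  then obtain M where M: "ideal M R" "\<one> \<notin> M" "\<And>X. ideal X R \<Longrightarrow> \<one> \<notin> X \<Longrightarrow> M \<subseteq> X \<Longrightarrow> X = M" by blast
  have "maximalideal M R"
  proof (rule maximalidealI[OF M(1)])
    show "carrier R \<noteq> M" using M(2) by auto
    fix J assume "ideal J R" "M \<subseteq> J" "J \<subseteq> carrier R"
    then show "J = M \<or> J = carrier R" using M(3)[of J] ideal.one_imp_carrier[of J R] by blast
  qed
  then show ?thesis by (rule that)
qed

lemma (in abelian_monoid) finsum_swap:
  assumes "finite A" "finite B" "\<And>a b. a \<in> A \<Longrightarrow> b \<in> B \<Longrightarrow> f a b \<in> carrier G"
  shows "(\<Oplus>a\<in>A. \<Oplus>b\<in>B. f a b) = (\<Oplus>b\<in>B. \<Oplus>a\<in>A. f a b)"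
  using assms(1,3)
proof (induction A)
  case (insert a A)
  have "(\<Oplus>b\<in>B. \<Oplus>a\<in>insert a A. f a b) = (\<Oplus>b\<in>B. f a b \<oplus> (\<Oplus>a\<in>A. f a b))"
    using insert by (intro finsum_cong' finsum_insert) auto
  also have "\<dots> = (\<Oplus>b\<in>B. f a b) \<oplus> (\<Oplus>b\<in>B. \<Oplus>a\<in>A. f a b)"
    using insert by (intro finsum_addf) auto
  finally show ?case using insert by (subst finsum_insert) auto
qed (use assms(2) in simp)

lemma (in abelian_monoid) finsum_cartesian_product:
  assumes "finite A" "finite B" "\<And>a b. a \<in> A \<Longrightarrow> b \<in> B \<Longrightarrow> f a b \<in> carrier G"
  shows "(\<Oplus>a\<in>A. \<Oplus>b\<in>B. f a b) = finsum G (\<lambda>(a, b). f a b) (A \<times> B)"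
  using assms(1,3)
proof (induction A)
  case (insert a A)
  have "(\<Oplus>b\<in>B. f a b) = finsum G (\<lambda>(a, b). f a b) (Pair a ` B)"
    using insert by (subst add.finprod_reindex) (auto simp: inj_on_def)
  moreover have "insert a A \<times> B = Pair a ` B \<union> A \<times> B" by auto
  moreover have "finsum G (\<lambda>(a, b). f a b) (Pair a ` B \<union> A \<times> B)
      = finsum G (\<lambda>(a, b). f a b) (Pair a ` B) \<oplus> finsum G (\<lambda>(a, b). f a b) (A \<times> B)"
    using insert assms(2) by (intro add.finprod_Un_disjoint) auto
  moreover have "(\<Oplus>a\<in>insert a A. \<Oplus>b\<in>B. f a b) = (\<Oplus>b\<in>B. f a b) \<oplus> (\<Oplus>a\<in>A. \<Oplus>b\<in>B. f a b)"
    using insert by (intro finsum_insert) auto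
  ultimately show ?case using insert by simp
qed simp

text \<open>Gaussian elimination, by induction on the equations: if the current equation is not
  identically zero, a pivot \<open>j0\<close> eliminates one unknown from the others, and the
  remaining unknowns still outnumber the remaining equations.\<close>

lemma (in field) homogeneous_system:
  assumes "finite I" "finite J" "card I < card J"
    and "\<And>i j. i \<in> I \<Longrightarrow> j \<in> J \<Longrightarrow> A i j \<in> carrier R"
  shows "\<exists>d. (\<forall>j\<in>J. d j \<in> carrier R) \<and> (\<exists>j\<in>J. d j \<noteq> \<zero>)
    \<and> (\<forall>i\<in>I. (\<Oplus>j\<in>J. A i j \<otimes> d j) = \<zero>)"
  using assms
proof (induction I arbitrary: J A)
  case empty
  then obtain j where "j \<in> J" by fastforce
  then show ?case by (intro exI[of _ "\<lambda>_. \<one>"]) auto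
next
  case (insert i I)
  show ?case
  proof (cases "\<forall>j\<in>J. A i j = \<zero>")
    case True
    obtain d where d: "\<forall>j\<in>J. d j \<in> carrier R" "\<exists>j\<in>J. d j \<noteq> \<zero>"
      "\<forall>i\<in>I. (\<Oplus>j\<in>J. A i j \<otimes> d j) = \<zero>"
      using insert.IH[of J A] insert.prems insert.hyps by auto
    have "(\<Oplus>j\<in>J. A i j \<otimes> d j) = (\<Oplus>j\<in>J. \<zero>)"
      by (rule finsum_cong') (use True d in auto)
    with d show ?thesis by (intro exI[of _ d]) auto
  next
    case False
    then obtain j0 where j0: "j0 \<in> J" "A i j0 \<noteq> \<zero>" by blast
    define p where "p = inv (A i j0)"
    have A: "\<And>i' j. i' \<in> insert i I \<Longrightarrow> j \<in> J \<Longrightarrow> A i' j \<in> carrier R" using insert.prems by blast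
    have p: "p \<in> carrier R" "A i j0 \<otimes> p = \<one>"
      using j0 A[of i j0] field_Units unfolding p_def by auto
    let ?J = "J - {j0}"
    \<comment> \<open>The coefficients left after solving equation \<open>i\<close> for the unknown
      \<open>j0\<close> and substituting into equation \<open>i'\<close>.\<close>
    let ?B = "\<lambda>i' j. A i' j \<ominus> A i' j0 \<otimes> p \<otimes> A i j"
    have fin: "finite ?J" using insert.prems by auto
    have "card I < card ?J" using insert.prems insert.hyps j0 by auto
    moreover have "?B i' j \<in> carrier R" if "i' \<in> I" "j \<in> ?J" for i' j using that A p j0 by auto
    ultimately have "\<exists>d. (\<forall>j\<in>?J. d j \<in> carrier R) \<and> (\<exists>j\<in>?J. d j \<noteq> \<zero>)
        \<and> (\<forall>i'\<in>I. (\<Oplus>j\<in>?J. ?B i' j \<otimes> d j) = \<zero>)"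
      by (rule insert.IH[OF fin])
    then obtain d where d: "\<forall>j\<in>?J. d j \<in> carrier R" "\<exists>j\<in>?J. d j \<noteq> \<zero>"
      and dB: "\<forall>i'\<in>I. (\<Oplus>j\<in>?J. ?B i' j \<otimes> d j) = \<zero>"
      by blast
    define S where "S i' = (\<Oplus>j\<in>?J. A i' j \<otimes> d j)" for i'
    have S: "S i' \<in> carrier R" if "i' \<in> insert i I" for i'
      unfolding S_def using A d that by (intro finsum_closed) auto
    \<comment> \<open>The value of the unknown \<open>j0\<close> is forced by equation
      \<open>i\<close>.\<close>
    define d' where "d' = d(j0 := \<ominus> (p \<otimes> S i))"
    have split: "(\<Oplus>j\<in>J. A i' j \<otimes> d' j) = \<ominus> (A i' j0 \<otimes> p \<otimes> S i) \<oplus> S i'"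
      if i': "i' \<in> insert i I" for i'
    proof -
      have "(\<Oplus>j\<in>J. A i' j \<otimes> d' j) = (\<Oplus>j\<in>insert j0 ?J. A i' j \<otimes> d' j)"
        using j0 by (simp add: insert_absorb)
      also have "\<dots> = A i' j0 \<otimes> d' j0 \<oplus> (\<Oplus>j\<in>?J. A i' j \<otimes> d' j)"
        using fin i' A j0 d p S by (intro finsum_insert) (auto simp: d'_def)
      also have "(\<Oplus>j\<in>?J. A i' j \<otimes> d' j) = S i'" unfolding S_def
        by (rule finsum_cong') (use A d i' in \<open>auto simp: d'_def\<close>)
      finally show ?thesis using A[OF i' j0(1)] p S by (simp add: d'_def r_minus m_assoc)
    qed
    have "(\<Oplus>j\<in>J. A i' j \<otimes> d' j) = \<zero>" if i': "i' \<in> insert i I" for i'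
    proof (cases "i' = i")
      case True
      then show ?thesis using split[OF i'] p S by (simp add: l_neg)
    next
      case False
      with i' have i'': "i' \<in> I" by auto
      let ?c = "\<ominus> (A i' j0 \<otimes> p)"
      have c: "?c \<in> carrier R" using A[OF i' j0(1)] p by auto
      have "\<zero> = (\<Oplus>j\<in>?J. ?B i' j \<otimes> d j)" using dB i'' by auto
      also have "\<dots> = (\<Oplus>j\<in>?J. ?c \<otimes> (A i j \<otimes> d j) \<oplus> A i' j \<otimes> d j)"
        by (rule finsum_cong')
          (use A d i' j0 p in \<open>auto simp: minus_eq l_distr l_minus m_assoc a_comm\<close>)
      also have "\<dots> = (\<Oplus>j\<in>?J. ?c \<otimes> (A i j \<otimes> d j)) \<oplus> S i'"
        unfolding S_def using A d i' c by (intro finsum_addf) auto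
      also have "(\<Oplus>j\<in>?J. ?c \<otimes> (A i j \<otimes> d j)) = ?c \<otimes> S i"
        unfolding S_def using A d c by (intro finsum_rdistr[symmetric] fin) auto
      finally show ?thesis using split[OF i'] c A[OF i' j0(1)] p S by (simp add: l_minus)
    qed
    moreover have "\<forall>j\<in>J. d' j \<in> carrier R" using d p S by (auto simp: d'_def)
    moreover have "\<exists>j\<in>J. d' j \<noteq> \<zero>" using d by (auto simp: d'_def)
    ultimately show ?thesis by blast
  qed
qed

lemma (in Module.module) finsum_smult_rdistr:
  assumes "finite A" "f \<in> A \<rightarrow> carrier R" "v \<in> carrier M"
  shows "(\<Oplus>i\<in>A. f i) \<odot>\<^bsub>M\<^esub> v = (\<Oplus>\<^bsub>M\<^esub>i\<in>A. f i \<odot>\<^bsub>M\<^esub> v)"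
  using assms(1,2)
proof (induction A)
  case (insert a A)
  have "(\<Oplus>i\<in>insert a A. f i) = f a \<oplus> (\<Oplus>i\<in>A. f i)" using insert by (intro R.finsum_insert) auto
  moreover have "(\<Oplus>\<^bsub>M\<^esub>i\<in>insert a A. f i \<odot>\<^bsub>M\<^esub> v) = f a \<odot>\<^bsub>M\<^esub> v \<oplus>\<^bsub>M\<^esub> (\<Oplus>\<^bsub>M\<^esub>i\<in>A. f i \<odot>\<^bsub>M\<^esub> v)"
    using insert assms(3) by (intro M.finsum_insert) auto
  moreover have "(\<Oplus>i\<in>A. f i) \<in> carrier R" using insert by (intro R.finsum_closed) auto
  ultimately show ?case using insert assms(3) by (simp add: smult_l_distr)
qed (use assms(3) in simp)

lemma (in Module.module) submodule_zero: "submodule N R M \<Longrightarrow> \<zero>\<^bsub>M\<^esub> \<in> N"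
  using subgroup.one_closed[OF submodule.axioms(1)] by fastforce

lemma (in Module.module) submodule_finsum:
  assumes N: "submodule N R M" and "finite I" "\<And>i. i \<in> I \<Longrightarrow> g i \<in> N"
  shows "(\<Oplus>\<^bsub>M\<^esub>i\<in>I. g i) \<in> N"
  using assms(2,3)
proof (induction I)
  case empty
  then show ?case using submodule_zero[OF N] by simp
next
  case (insert a A)
  have "N \<subseteq> carrier M" using N submoduleE(1) by blast
  with insert have "(\<Oplus>\<^bsub>M\<^esub>j\<in>insert a A. g j) = g a \<oplus>\<^bsub>M\<^esub> (\<Oplus>\<^bsub>M\<^esub>j\<in>A. g j)"
    by (intro M.finsum_insert) (auto simp: subset_iff)
  with insert show ?case by (simp add: submoduleE(5)[OF N])
qed

text \<open>The Steinitz exchange bound in the quotient M/N, without forming it. With more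
  \<open>e\<close> than \<open>b\<close>, some nontrivial combination of the \<open>e\<close> has
  all its \<open>b\<close>-coefficients zero, hence lies in \<open>N\<close>, against
  independence.\<close>

lemma (in Module.module) card_le_of_spanning:
  assumes "field R" and N: "submodule N R M" and fin: "finite I" "finite J"
    and e: "e \<in> J \<rightarrow> carrier M" and b: "b \<in> I \<rightarrow> carrier M"
    and span: "\<And>j. j \<in> J \<Longrightarrow> \<exists>c\<in>I \<rightarrow> carrier R. e j \<ominus>\<^bsub>M\<^esub> (\<Oplus>\<^bsub>M\<^esub>i\<in>I. c i \<odot>\<^bsub>M\<^esub> b i) \<in> N"
    and indep: "\<And>d j. d \<in> J \<rightarrow> carrier R \<Longrightarrow> (\<Oplus>\<^bsub>M\<^esub>j\<in>J. d j \<odot>\<^bsub>M\<^esub> e j) \<in> N \<Longrightarrow> j \<in> J \<Longrightarrow> d j = \<zero>"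
  shows "card J \<le> card I"
proof (rule ccontr)
  interpret field R by fact
  assume "\<not> card J \<le> card I"
  obtain c where c: "\<And>j. j \<in> J \<Longrightarrow> c j \<in> I \<rightarrow> carrier R"
    "\<And>j. j \<in> J \<Longrightarrow> e j \<ominus>\<^bsub>M\<^esub> (\<Oplus>\<^bsub>M\<^esub>i\<in>I. c j i \<odot>\<^bsub>M\<^esub> b i) \<in> N"
    using span by metis
  have c': "c j i \<in> carrier R" if "j \<in> J" "i \<in> I" for i j using c(1) that by blast
  obtain d where d: "\<forall>j\<in>J. d j \<in> carrier R" "\<exists>j\<in>J. d j \<noteq> \<zero>"
    "\<forall>i\<in>I. (\<Oplus>j\<in>J. c j i \<otimes> d j) = \<zero>"
    using homogeneous_system[OF fin, of "\<lambda>i j. c j i"] \<open>\<not> card J \<le> card I\<close> c' by auto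
  have e': "e j \<in> carrier M" if "j \<in> J" for j using e that by auto
  have b': "b i \<in> carrier M" if "i \<in> I" for i using b that by auto
  let ?s = "\<lambda>j. \<Oplus>\<^bsub>M\<^esub>i\<in>I. c j i \<odot>\<^bsub>M\<^esub> b i"
  have s: "?s j \<in> carrier M" if "j \<in> J" for j using c' b' that by (intro M.finsum_closed) auto
  \<comment> \<open>After exchanging the sums, the coefficient of \<open>b i\<close> is the left
    side of equation \<open>i\<close> of the homogeneous system.\<close>
  have 0: "(\<Oplus>\<^bsub>M\<^esub>j\<in>J. d j \<odot>\<^bsub>M\<^esub> ?s j) = \<zero>\<^bsub>M\<^esub>"
  proof -
    have "(\<Oplus>\<^bsub>M\<^esub>j\<in>J. d j \<odot>\<^bsub>M\<^esub> ?s j) = (\<Oplus>\<^bsub>M\<^esub>j\<in>J. \<Oplus>\<^bsub>M\<^esub>i\<in>I. (c j i \<otimes> d j) \<odot>\<^bsub>M\<^esub> b i)"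
      using d b' c' fin
      by (intro M.finsum_cong')
        (auto simp: finsum_smult_ldistr smult_assoc1[symmetric] m_comm intro!: M.finsum_cong' M.finsum_closed)
    also have "\<dots> = (\<Oplus>\<^bsub>M\<^esub>i\<in>I. \<Oplus>\<^bsub>M\<^esub>j\<in>J. (c j i \<otimes> d j) \<odot>\<^bsub>M\<^esub> b i)"
      using fin d b' c' by (intro M.finsum_swap) auto
    also have "\<dots> = (\<Oplus>\<^bsub>M\<^esub>i\<in>I. \<zero>\<^bsub>M\<^esub>)"
    proof (rule M.finsum_cong')
      fix i assume i: "i \<in> I"
      have "(\<Oplus>j\<in>J. c j i \<otimes> d j) \<odot>\<^bsub>M\<^esub> b i = (\<Oplus>\<^bsub>M\<^esub>j\<in>J. (c j i \<otimes> d j) \<odot>\<^bsub>M\<^esub> b i)"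
        using c' d i b' fin by (intro finsum_smult_rdistr) auto
      then show "(\<Oplus>\<^bsub>M\<^esub>j\<in>J. (c j i \<otimes> d j) \<odot>\<^bsub>M\<^esub> b i) = \<zero>\<^bsub>M\<^esub>" using d i b' by simp
    qed auto
    finally show ?thesis by simp
  qed
  have "(\<Oplus>\<^bsub>M\<^esub>j\<in>J. d j \<odot>\<^bsub>M\<^esub> e j) = (\<Oplus>\<^bsub>M\<^esub>j\<in>J. d j \<odot>\<^bsub>M\<^esub> ?s j \<oplus>\<^bsub>M\<^esub> d j \<odot>\<^bsub>M\<^esub> (e j \<ominus>\<^bsub>M\<^esub> ?s j))"
  proof (rule M.finsum_cong')
    fix j assume j: "j \<in> J"
    have "e j = ?s j \<oplus>\<^bsub>M\<^esub> (e j \<ominus>\<^bsub>M\<^esub> ?s j)"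
      using e'[OF j] s[OF j] by (simp add: M.minus_eq M.a_lcomm M.r_neg)
    then show "d j \<odot>\<^bsub>M\<^esub> e j = d j \<odot>\<^bsub>M\<^esub> ?s j \<oplus>\<^bsub>M\<^esub> d j \<odot>\<^bsub>M\<^esub> (e j \<ominus>\<^bsub>M\<^esub> ?s j)"
      using smult_r_distr[of "d j" "?s j" "e j \<ominus>\<^bsub>M\<^esub> ?s j"] d j e'[OF j] s[OF j] by simp
  qed (use d e' s in auto)
  also have "\<dots> = (\<Oplus>\<^bsub>M\<^esub>j\<in>J. d j \<odot>\<^bsub>M\<^esub> ?s j) \<oplus>\<^bsub>M\<^esub> (\<Oplus>\<^bsub>M\<^esub>j\<in>J. d j \<odot>\<^bsub>M\<^esub> (e j \<ominus>\<^bsub>M\<^esub> ?s j))"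
    using d e' s by (intro M.finsum_addf) auto
  also have "\<dots> = (\<Oplus>\<^bsub>M\<^esub>j\<in>J. d j \<odot>\<^bsub>M\<^esub> (e j \<ominus>\<^bsub>M\<^esub> ?s j))"
    unfolding 0 using d e' s by (intro M.l_zero M.finsum_closed) auto
  also have "\<dots> \<in> N" using c d by (intro submodule_finsum[OF N] fin submoduleE(4)[OF N]) auto
  finally show False using indep[of d] d by blast
qed

section \<open>Convolution algebras\<close>

lemma convolution_algebra_simps [simp]:
  "carrier (convolution_algebra K M C) = C"
  "\<one>\<^bsub>convolution_algebra K M C\<^esub> = (\<lambda>w. if w = \<one>\<^bsub>M\<^esub> then \<one>\<^bsub>K\<^esub> else \<zero>\<^bsub>K\<^esub>)"
  "\<zero>\<^bsub>convolution_algebra K M C\<^esub> = (\<lambda>w. \<zero>\<^bsub>K\<^esub>)"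
  "f \<oplus>\<^bsub>convolution_algebra K M C\<^esub> g = (\<lambda>w. f w \<oplus>\<^bsub>K\<^esub> g w)"
  "c \<odot>\<^bsub>convolution_algebra K M C\<^esub> f = (\<lambda>w. c \<otimes>\<^bsub>K\<^esub> f w)"
  by (simp_all add: convolution_algebra_def)

lemma mult_convolution_algebra:
  "(f \<otimes>\<^bsub>convolution_algebra K M C\<^esub> g) w = finsum K (\<lambda>(u, v). f u \<otimes>\<^bsub>K\<^esub> g v)
    {(u, v). u \<in> carrier M \<and> v \<in> carrier M \<and> u \<otimes>\<^bsub>M\<^esub> v = w \<and> f u \<noteq> \<zero>\<^bsub>K\<^esub> \<and> g v \<noteq> \<zero>\<^bsub>K\<^esub>}"
  by (simp add: convolution_algebra_def)

lemma (in cring) coeff_functions_closed: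
  "f \<in> coeff_functions R M \<Longrightarrow> f w \<in> carrier R"
  by (cases "w \<in> carrier M") (auto simp: coeff_functions_def)

lemma (in cring) convolution_algebra_module:
  assumes C: "C \<subseteq> coeff_functions R M"
    and "(\<lambda>w. \<zero>) \<in> C" "\<And>f g. f \<in> C \<Longrightarrow> g \<in> C \<Longrightarrow> (\<lambda>w. f w \<oplus> g w) \<in> C"
    and smult: "\<And>c f. c \<in> carrier R \<Longrightarrow> f \<in> C \<Longrightarrow> (\<lambda>w. c \<otimes> f w) \<in> C"
  shows "Module.module R (convolution_algebra R M C)"
proof -
  have c: "f w \<in> carrier R" if "f \<in> C" for f w
    using coeff_functions_closed[of f M w] that C by auto
  let ?A = "convolution_algebra R M C"
  show ?thesis
  proof (rule Module.moduleI)
    show "abelian_group ?A"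
    proof (rule abelian_groupI)
      fix f assume "f \<in> carrier ?A"
      then have f: "f \<in> C" by simp
      have "(\<lambda>w. \<ominus> \<one> \<otimes> f w) \<in> C" by (rule smult) (simp_all add: f)
      then show "\<exists>g\<in>carrier ?A. g \<oplus>\<^bsub>?A\<^esub> f = \<zero>\<^bsub>?A\<^esub>"
        using c[OF f] by (intro bexI[of _ "\<lambda>w. \<ominus> \<one> \<otimes> f w"]) (auto simp: l_minus l_neg)
      show "\<zero>\<^bsub>?A\<^esub> \<oplus>\<^bsub>?A\<^esub> f = f" using c[OF f] by simp
      fix g assume "g \<in> carrier ?A"
      then have g: "g \<in> C" by simp
      show "f \<oplus>\<^bsub>?A\<^esub> g \<in> carrier ?A" using assms(3)[OF f g] by simp
      show "f \<oplus>\<^bsub>?A\<^esub> g = g \<oplus>\<^bsub>?A\<^esub> f" using c[OF f] c[OF g] by (simp add: a_comm)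
      fix h assume "h \<in> carrier ?A"
      then have h: "h \<in> C" by simp
      show "f \<oplus>\<^bsub>?A\<^esub> g \<oplus>\<^bsub>?A\<^esub> h = f \<oplus>\<^bsub>?A\<^esub> (g \<oplus>\<^bsub>?A\<^esub> h)"
        using c[OF f] c[OF g] c[OF h] by (simp add: a_assoc)
    qed (use assms(2) in simp)
  next
    fix a f assume a: "a \<in> carrier R" and "f \<in> carrier ?A"
    then have f: "f \<in> C" by simp
    show "a \<odot>\<^bsub>?A\<^esub> f \<in> carrier ?A" using smult[OF a f] by simp
    fix b assume "b \<in> carrier R"
    with a show "(a \<oplus> b) \<odot>\<^bsub>?A\<^esub> f = a \<odot>\<^bsub>?A\<^esub> f \<oplus>\<^bsub>?A\<^esub> b \<odot>\<^bsub>?A\<^esub> f"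
      "(a \<otimes> b) \<odot>\<^bsub>?A\<^esub> f = a \<odot>\<^bsub>?A\<^esub> (b \<odot>\<^bsub>?A\<^esub> f)"
      using c[OF f] by (simp_all add: l_distr m_assoc)
  next
    fix a f g assume "a \<in> carrier R" "f \<in> carrier ?A" "g \<in> carrier ?A"
    then show "a \<odot>\<^bsub>?A\<^esub> (f \<oplus>\<^bsub>?A\<^esub> g) = a \<odot>\<^bsub>?A\<^esub> f \<oplus>\<^bsub>?A\<^esub> a \<odot>\<^bsub>?A\<^esub> g"
      using c[of f] c[of g] by (simp add: r_distr)
  next
    fix f assume "f \<in> carrier ?A"
    then show "\<one> \<odot>\<^bsub>?A\<^esub> f = f" using c[of f] by simp
  qed (rule is_cring)
qed

lemma (in cring) coeff_functions_module:
  "Module.module R (convolution_algebra R M (coeff_functions R M))"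
  by (rule convolution_algebra_module) (auto simp: coeff_functions_def)

lemma (in cring) monoid_algebra_module: "Module.module R (monoid_algebra R M)"
  unfolding monoid_algebra_def
proof (rule convolution_algebra_module)
  fix f g assume f: "f \<in> {f \<in> coeff_functions R M. finite {w. f w \<noteq> \<zero>}}"
    and g: "g \<in> {f \<in> coeff_functions R M. finite {w. f w \<noteq> \<zero>}}"
  have "finite {w. f w \<oplus> g w \<noteq> \<zero>}"
    by (rule finite_subset[of _ "{w. f w \<noteq> \<zero>} \<union> {w. g w \<noteq> \<zero>}"]) (use f g in auto)
  then show "(\<lambda>w. f w \<oplus> g w) \<in> {f \<in> coeff_functions R M. finite {w. f w \<noteq> \<zero>}}"
    using f g by (auto simp: coeff_functions_def)
next
  fix c f assume f: "f \<in> {f \<in> coeff_functions R M. finite {w. f w \<noteq> \<zero>}}" and c: "c \<in> carrier R"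
  have "finite {w. c \<otimes> f w \<noteq> \<zero>}"
    by (rule finite_subset[of _ "{w. f w \<noteq> \<zero>}"]) (use f c in auto)
  then show "(\<lambda>w. c \<otimes> f w) \<in> {f \<in> coeff_functions R M. finite {w. f w \<noteq> \<zero>}}"
    using f c by (auto simp: coeff_functions_def)
qed (auto simp: coeff_functions_def)

lemma carrier_monoid_algebra:
  "carrier (monoid_algebra K M) = {f \<in> coeff_functions K M. finite {w. f w \<noteq> \<zero>\<^bsub>K\<^esub>}}"
  by (simp add: monoid_algebra_def)

lemma (in cring) monoid_algebra_mult_closed:
  assumes M: "\<And>u v. u \<in> carrier M \<Longrightarrow> v \<in> carrier M \<Longrightarrow> u \<otimes>\<^bsub>M\<^esub> v \<in> carrier M"
    and f: "f \<in> carrier (monoid_algebra R M)" and g: "g \<in> carrier (monoid_algebra R M)"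
  shows "f \<otimes>\<^bsub>monoid_algebra R M\<^esub> g \<in> carrier (monoid_algebra R M)"
proof -
  let ?h = "f \<otimes>\<^bsub>monoid_algebra R M\<^esub> g"
  have c: "f w \<in> carrier R" "g w \<in> carrier R" for w
    using coeff_functions_closed[of f M] coeff_functions_closed[of g M] f g
    by (auto simp: carrier_monoid_algebra)
  have h: "?h w \<in> carrier R" for w
    unfolding monoid_algebra_def mult_convolution_algebra using c by (intro finsum_closed) auto
  have 0: "w \<in> (\<lambda>(u, v). u \<otimes>\<^bsub>M\<^esub> v) ` ({u \<in> carrier M. f u \<noteq> \<zero>} \<times> {v \<in> carrier M. g v \<noteq> \<zero>})"
    if "?h w \<noteq> \<zero>" for w
  proof (rule ccontr)
    assume "\<not> ?thesis"
    then have "{(u, v). u \<in> carrier M \<and> v \<in> carrier M \<and> u \<otimes>\<^bsub>M\<^esub> v = w \<and> f u \<noteq> \<zero> \<and> g v \<noteq> \<zero>} = {}"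
      by force
    with that show False unfolding monoid_algebra_def mult_convolution_algebra by (simp del: Collect_empty_eq)
  qed
  have "?h w = \<zero>" if "w \<notin> carrier M" for w using 0[of w] M that by fastforce
  moreover have "finite {w. ?h w \<noteq> \<zero>}"
  proof (rule finite_subset)
    show "{w. ?h w \<noteq> \<zero>} \<subseteq> (\<lambda>(u, v). u \<otimes>\<^bsub>M\<^esub> v) ` ({u \<in> carrier M. f u \<noteq> \<zero>} \<times> {v \<in> carrier M. g v \<noteq> \<zero>})"
      using 0 by blast
  qed (use f g in \<open>auto simp: carrier_monoid_algebra\<close>)
  ultimately show ?thesis using h by (auto simp: carrier_monoid_algebra coeff_functions_def)
qed

lemma (in cring) basis_elt_closed: "u \<in> carrier M \<Longrightarrow> basis_elt R u \<in> carrier (monoid_algebra R M)"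
  by (auto simp: carrier_monoid_algebra coeff_functions_def basis_elt_def)

lemma finite_splits: "finite {(u, v). u @ v = w}"
proof -
  have "(u, v) \<in> (\<lambda>i. (take i w, drop i w)) ` {..length w}" if "u @ v = w" for u v
    using that by (intro image_eqI[of _ _ "length u"]) auto
  then have "{(u, v). u @ v = w} \<subseteq> (\<lambda>i. (take i w, drop i w)) ` {..length w}" by auto
  then show ?thesis by (rule finite_subset) simp
qed

text \<open>The Cauchy product of series on words, by recursion on the word: either the left factor
  is empty, or it starts with \<open>a\<close>, and the rest is a coefficient of the left derivative
  of \<open>f\<close> times \<open>g\<close>. The algebraic laws then follow by induction on words,
  without sums over factorizations.\<close>

primrec conv :: "('k, 'b) ring_scheme \<Rightarrow> ('a list \<Rightarrow> 'k) \<Rightarrow> ('a list \<Rightarrow> 'k) \<Rightarrow> 'a list \<Rightarrow> 'k" where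
  "conv K f g [] = f [] \<otimes>\<^bsub>K\<^esub> g []"
| "conv K f g (a # w) = f [] \<otimes>\<^bsub>K\<^esub> g (a # w) \<oplus>\<^bsub>K\<^esub> conv K (\<lambda>u. f (a # u)) g w"

context cring
begin

lemma conv_closed:
  assumes "\<And>w. f w \<in> carrier R" "\<And>w. g w \<in> carrier R"
  shows "conv R f g w \<in> carrier R"
  using assms by (induction w arbitrary: f) auto

lemma conv_finsum:
  assumes "\<And>w. f w \<in> carrier R" "\<And>w. g w \<in> carrier R"
  shows "finsum R (\<lambda>(u, v). f u \<otimes> g v) {(u, v). u @ v = w} = conv R f g w"
  using assms
proof (induction w arbitrary: f)
  case Nil
  have "{(u, v). u @ v = []} = {([], [])}" by auto
  with Nil show ?case by simp
next
  case (Cons a w)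
  let ?S = "{(u, v). u @ v = w}" and ?p = "\<lambda>(u, v). (a # u, v)"
  note fin = finite_splits[of w]
  have "{(u, v). u @ v = a # w} = insert ([], a # w) (?p ` ?S)"
    by (auto simp: Cons_eq_append_conv append_eq_Cons_conv)
  also have "finsum R (\<lambda>(u, v). f u \<otimes> g v) \<dots>
      = f [] \<otimes> g (a # w) \<oplus> finsum R (\<lambda>(u, v). f u \<otimes> g v) (?p ` ?S)"
    using fin Cons.prems by (subst finsum_insert) auto
  also have "finsum R (\<lambda>(u, v). f u \<otimes> g v) (?p ` ?S) = finsum R (\<lambda>(u, v). f (a # u) \<otimes> g v) ?S"
    using Cons.prems by (subst add.finprod_reindex) (auto simp: inj_on_def case_prod_unfold)
  also have "\<dots> = conv R (\<lambda>u. f (a # u)) g w" using Cons.prems by (intro Cons.IH) auto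
  finally show ?case by simp
qed

text \<open>Enlarging the index set to all factorizations of \<open>w\<close> adds only zero terms,
  since one factor vanishes outside the supports or on words with a letter outside
  \<open>S\<close>.\<close>

lemma mult_free_monoid:
  assumes f: "f \<in> coeff_functions R (free_monoid S)" and g: "g \<in> coeff_functions R (free_monoid S)"
  shows "f \<otimes>\<^bsub>convolution_algebra R (free_monoid S) C\<^esub> g = conv R f g"
proof
  fix w
  have c: "f w \<in> carrier R" "g w \<in> carrier R" for w
    using coeff_functions_closed[OF f] coeff_functions_closed[OF g] by auto
  note fin = finite_splits[of w]
  have "(f \<otimes>\<^bsub>convolution_algebra R (free_monoid S) C\<^esub> g) w
      = finsum R (\<lambda>(u, v). f u \<otimes> g v) {(u, v). u @ v = w}"
    unfolding mult_convolution_algebra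
    by (rule add.finprod_mono_neutral_cong_left)
      (use c fin f g in \<open>auto simp: free_monoid_def coeff_functions_def\<close>)
  also have "\<dots> = conv R f g w" using c by (rule conv_finsum)
  finally show "(f \<otimes>\<^bsub>convolution_algebra R (free_monoid S) C\<^esub> g) w = conv R f g w" .
qed

lemma conv_in_coeff_functions:
  assumes f: "f \<in> coeff_functions R (free_monoid S)" and g: "g \<in> coeff_functions R (free_monoid S)"
  shows "conv R f g \<in> coeff_functions R (free_monoid S)"
proof -
  have "conv R f g w = \<zero>" if "\<And>w. f w \<in> carrier R" "\<And>w. g w \<in> carrier R" "w \<notin> lists S"
    "\<And>w. w \<notin> lists S \<Longrightarrow> f w = \<zero>" "\<And>w. w \<notin> lists S \<Longrightarrow> g w = \<zero>" for w f
    using that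
  proof (induction w arbitrary: f)
    case (Cons a w)
    have [simp]: "f [] \<otimes> g (a # w) = \<zero>" using Cons.prems by auto
    show ?case
    proof (cases "a \<in> S")
      case True
      with Cons show ?thesis by simp
    next
      case False
      have "conv R (\<lambda>u. f (a # u)) g w = conv R (\<lambda>u. \<zero>) g w"
        using Cons.prems(4) False by (intro arg_cong2[of _ _ _ _ "\<lambda>x. conv R x g"]) auto
      also have "\<dots> = \<zero>" using Cons.prems(2) by (induction w) auto
      finally show ?thesis by simp
    qed
  qed auto
  with assms coeff_functions_closed[OF f] coeff_functions_closed[OF g] show ?thesis
    by (auto simp: coeff_functions_def free_monoid_def intro!: conv_closed)
qed

lemma conv_add_left:
  assumes "\<And>w. f w \<in> carrier R" "\<And>w. f' w \<in> carrier R" "\<And>w. g w \<in> carrier R"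
  shows "conv R (\<lambda>w. f w \<oplus> f' w) g w = conv R f g w \<oplus> conv R f' g w"
  using assms by (induction w arbitrary: f f') (auto simp: l_distr a_ac conv_closed)

lemma conv_smult_left:
  assumes "c \<in> carrier R" "\<And>w. f w \<in> carrier R" "\<And>w. g w \<in> carrier R"
  shows "conv R (\<lambda>w. c \<otimes> f w) g w = c \<otimes> conv R f g w"
  using assms by (induction w arbitrary: f) (auto simp: r_distr m_assoc conv_closed)

lemma conv_add_right:
  assumes "\<And>w. f w \<in> carrier R" "\<And>w. g w \<in> carrier R" "\<And>w. g' w \<in> carrier R"
  shows "conv R f (\<lambda>w. g w \<oplus> g' w) w = conv R f g w \<oplus> conv R f g' w"
  using assms by (induction w arbitrary: f) (auto simp: r_distr a_ac conv_closed)

lemma conv_smult_right: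
  assumes "c \<in> carrier R" "\<And>w. f w \<in> carrier R" "\<And>w. g w \<in> carrier R"
  shows "conv R f (\<lambda>w. c \<otimes> g w) w = c \<otimes> conv R f g w"
  using assms by (induction w arbitrary: f) (auto simp: r_distr m_lcomm conv_closed)

lemma conv_zero_left:
  assumes "\<And>w. g w \<in> carrier R"
  shows "conv R (\<lambda>w. \<zero>) g w = \<zero>"
  using assms by (induction w) auto

lemma conv_assoc:
  assumes "\<And>w. f w \<in> carrier R" "\<And>w. g w \<in> carrier R" "\<And>w. h w \<in> carrier R"
  shows "conv R (conv R f g) h w = conv R f (conv R g h) w"
  using assms
proof (induction w arbitrary: f)
  case Nil
  then show ?case by (simp add: m_assoc)
next
  case (Cons a w)
  \<comment> \<open>A Leibniz-like rule: the left derivative of \<open>conv R f g\<close> by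
    \<open>a\<close> is \<open>f []\<close> times that of \<open>g\<close>, plus the product of that
    of \<open>f\<close> with \<open>g\<close>. Induction applies to the second term.\<close>
  have "conv R (\<lambda>u. conv R f g (a # u)) h w
      = f [] \<otimes> conv R (\<lambda>u. g (a # u)) h w \<oplus> conv R (\<lambda>u. f (a # u)) (conv R g h) w"
    using Cons by (simp add: conv_add_left conv_smult_left conv_closed)
  with Cons.prems show ?case by (simp add: r_distr m_assoc a_assoc conv_closed)
qed

lemma conv_one_left:
  assumes "\<And>w. g w \<in> carrier R"
  shows "conv R (\<lambda>w. if w = [] then \<one> else \<zero>) g w = g w"
  using assms by (cases w) (auto simp: conv_zero_left)

lemma conv_one_right:
  assumes "\<And>w. f w \<in> carrier R"
  shows "conv R f (\<lambda>w. if w = [] then \<one> else \<zero>) w = f w"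
  using assms by (induction w arbitrary: f) auto

lemma conv_letter_left:
  assumes "\<And>w. g w \<in> carrier R"
  shows "conv R (basis_elt R [b]) g (a # w) = (if a = b then g w else \<zero>)"
    "conv R (basis_elt R [b]) g [] = \<zero>"
  using assms conv_one_left[of g w] by (auto simp: basis_elt_def conv_zero_left)

lemma conv_letter_right:
  assumes "\<And>w. f w \<in> carrier R"
  shows "conv R f (basis_elt R [b]) (w @ [a]) = (if a = b then f w else \<zero>)"
    "conv R f (basis_elt R [b]) [] = \<zero>"
proof -
  show "conv R f (basis_elt R [b]) (w @ [a]) = (if a = b then f w else \<zero>)"
    using assms by (induction w arbitrary: f) (auto simp: basis_elt_def)
qed (use assms in \<open>simp add: basis_elt_def\<close>)

lemma free_algebra_ring: "ring (free_algebra R S)"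
proof -
  let ?A = "monoid_algebra R (free_monoid S)"
  interpret A: Module.module R ?A by (rule monoid_algebra_module)
  have mult: "f \<otimes>\<^bsub>?A\<^esub> g = conv R f g" if "f \<in> carrier ?A" "g \<in> carrier ?A" for f g
    using that mult_free_monoid unfolding carrier_monoid_algebra
    unfolding monoid_algebra_def by blast
  have closed: "conv R f g \<in> carrier ?A" if "f \<in> carrier ?A" "g \<in> carrier ?A" for f g
    using monoid_algebra_mult_closed[of "free_monoid S" f g] that mult
    by (auto simp: free_monoid_def)
  have c: "f w \<in> carrier R" if "f \<in> carrier ?A" for f w
    using that coeff_functions_closed[of f "free_monoid S"] by (auto simp: carrier_monoid_algebra)
  have add: "f \<oplus>\<^bsub>?A\<^esub> g = (\<lambda>w. f w \<oplus> g w)" for f g by (simp add: monoid_algebra_def)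
  have one: "\<one>\<^bsub>?A\<^esub> = (\<lambda>w. if w = [] then \<one> else \<zero>)" by (simp add: monoid_algebra_def free_monoid_def)
  have one': "\<one>\<^bsub>?A\<^esub> \<in> carrier ?A"
    using basis_elt_closed[of "[]" "free_monoid S"] unfolding one basis_elt_def by (simp add: free_monoid_def)
  show ?thesis unfolding free_algebra_def
  proof (rule ringI)
    show "monoid ?A"
    proof (rule monoidI)
      fix f assume f: "f \<in> carrier ?A"
      show "\<one>\<^bsub>?A\<^esub> \<otimes>\<^bsub>?A\<^esub> f = f" "f \<otimes>\<^bsub>?A\<^esub> \<one>\<^bsub>?A\<^esub> = f"
        using f one' c[OF f] by (simp_all add: mult fun_eq_iff) (simp_all add: one conv_one_left conv_one_right)
    next
      fix f g h assume A: "f \<in> carrier ?A" "g \<in> carrier ?A" "h \<in> carrier ?A"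
      then show "f \<otimes>\<^bsub>?A\<^esub> g \<otimes>\<^bsub>?A\<^esub> h = f \<otimes>\<^bsub>?A\<^esub> (g \<otimes>\<^bsub>?A\<^esub> h)"
        by (simp add: mult closed fun_eq_iff conv_assoc c[OF A(1)] c[OF A(2)] c[OF A(3)])
    qed (simp_all add: mult closed one')
  next
    fix f g h assume A: "f \<in> carrier ?A" "g \<in> carrier ?A" "h \<in> carrier ?A"
    then have fg: "f \<oplus>\<^bsub>?A\<^esub> g \<in> carrier ?A" by blast
    show "(f \<oplus>\<^bsub>?A\<^esub> g) \<otimes>\<^bsub>?A\<^esub> h = f \<otimes>\<^bsub>?A\<^esub> h \<oplus>\<^bsub>?A\<^esub> g \<otimes>\<^bsub>?A\<^esub> h"
      "h \<otimes>\<^bsub>?A\<^esub> (f \<oplus>\<^bsub>?A\<^esub> g) = h \<otimes>\<^bsub>?A\<^esub> f \<oplus>\<^bsub>?A\<^esub> h \<otimes>\<^bsub>?A\<^esub> g"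
      unfolding mult[OF fg A(3)] mult[OF A(3) fg] mult[OF A(1,3)] mult[OF A(2,3)] mult[OF A(3,1)] mult[OF A(3,2)]
      using c[OF A(1)] c[OF A(2)] c[OF A(3)] by (simp_all add: add fun_eq_iff conv_add_left conv_add_right)
  qed (rule A.M.abelian_group_axioms)
qed

lemma mult_free_algebra:
  assumes "f \<in> carrier (free_algebra R S)" "g \<in> carrier (free_algebra R S)"
  shows "f \<otimes>\<^bsub>free_algebra R S\<^esub> g = conv R f g"
  using assms mult_free_monoid unfolding free_algebra_def carrier_monoid_algebra
  unfolding monoid_algebra_def by blast

end

section \<open>Linear combinations and dimension modulo a submodule\<close>

context Module.module
begin

text \<open>The preimage in \<open>M\<close> of the subspace of M/N spanned by the classes of the
  \<open>b i\<close>; working upstairs avoids quotient modules.\<close>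

definition span_mod :: "('i \<Rightarrow> 'c) \<Rightarrow> 'i set \<Rightarrow> 'c set \<Rightarrow> 'c set" where
  "span_mod b I N = {(\<Oplus>\<^bsub>M\<^esub>i\<in>I. c i \<odot>\<^bsub>M\<^esub> b i) \<oplus>\<^bsub>M\<^esub> z | c z. c \<in> I \<rightarrow> carrier R \<and> z \<in> N}"

definition linear_endo :: "('c \<Rightarrow> 'c) \<Rightarrow> bool" where
  "linear_endo \<phi> \<longleftrightarrow> \<phi> \<in> carrier M \<rightarrow> carrier M
    \<and> (\<forall>u\<in>carrier M. \<forall>v\<in>carrier M. \<phi> (u \<oplus>\<^bsub>M\<^esub> v) = \<phi> u \<oplus>\<^bsub>M\<^esub> \<phi> v)
    \<and> (\<forall>c\<in>carrier R. \<forall>v\<in>carrier M. \<phi> (c \<odot>\<^bsub>M\<^esub> v) = c \<odot>\<^bsub>M\<^esub> \<phi> v)"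

lemma linear_endoI:
  assumes "\<And>v. v \<in> carrier M \<Longrightarrow> \<phi> v \<in> carrier M"
    "\<And>u v. u \<in> carrier M \<Longrightarrow> v \<in> carrier M \<Longrightarrow> \<phi> (u \<oplus>\<^bsub>M\<^esub> v) = \<phi> u \<oplus>\<^bsub>M\<^esub> \<phi> v"
    "\<And>c v. c \<in> carrier R \<Longrightarrow> v \<in> carrier M \<Longrightarrow> \<phi> (c \<odot>\<^bsub>M\<^esub> v) = c \<odot>\<^bsub>M\<^esub> \<phi> v"
  shows "linear_endo \<phi>"
  unfolding linear_endo_def using assms by simp

lemma linear_endoD:
  assumes "linear_endo \<phi>"
  shows "v \<in> carrier M \<Longrightarrow> \<phi> v \<in> carrier M"
    "u \<in> carrier M \<Longrightarrow> v \<in> carrier M \<Longrightarrow> \<phi> (u \<oplus>\<^bsub>M\<^esub> v) = \<phi> u \<oplus>\<^bsub>M\<^esub> \<phi> v"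
    "c \<in> carrier R \<Longrightarrow> v \<in> carrier M \<Longrightarrow> \<phi> (c \<odot>\<^bsub>M\<^esub> v) = c \<odot>\<^bsub>M\<^esub> \<phi> v"
  using assms by (auto simp: linear_endo_def)

lemma linear_endo_zero: "linear_endo \<phi> \<Longrightarrow> \<phi> \<zero>\<^bsub>M\<^esub> = \<zero>\<^bsub>M\<^esub>"
  using linear_endoD(3)[of \<phi> \<zero> "\<zero>\<^bsub>M\<^esub>"] linear_endoD(1)[of \<phi> "\<zero>\<^bsub>M\<^esub>"] by simp

lemma linear_endo_finsum:
  assumes \<phi>: "linear_endo \<phi>" and "finite I" "\<And>i. i \<in> I \<Longrightarrow> g i \<in> carrier M"
  shows "\<phi> (\<Oplus>\<^bsub>M\<^esub>i\<in>I. g i) = (\<Oplus>\<^bsub>M\<^esub>i\<in>I. \<phi> (g i))"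
  using assms(2,3)
proof (induction I)
  case empty
  then show ?case by (simp add: linear_endo_zero[OF \<phi>])
next
  case (insert i I)
  have "(\<Oplus>\<^bsub>M\<^esub>i\<in>insert i I. \<phi> (g i)) = \<phi> (g i) \<oplus>\<^bsub>M\<^esub> (\<Oplus>\<^bsub>M\<^esub>i\<in>I. \<phi> (g i))"
    using insert linear_endoD(1)[OF \<phi>] by (intro M.finsum_insert) auto
  moreover have "(\<Oplus>\<^bsub>M\<^esub>i\<in>I. g i) \<in> carrier M" using insert by (intro M.finsum_closed) auto
  moreover have "(\<Oplus>\<^bsub>M\<^esub>i\<in>insert i I. g i) = g i \<oplus>\<^bsub>M\<^esub> (\<Oplus>\<^bsub>M\<^esub>i\<in>I. g i)"
    using insert by (intro M.finsum_insert) auto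
  ultimately show ?case using insert linear_endoD(2)[OF \<phi>] by simp
qed

context
  fixes N and b :: "'i \<Rightarrow> 'c" and I :: "'i set"
  assumes N: "submodule N R M" and fin: "finite I" and b: "b \<in> I \<rightarrow> carrier M"
begin

lemma lincomb_closed:
  assumes "c \<in> I \<rightarrow> carrier R"
  shows "(\<Oplus>\<^bsub>M\<^esub>i\<in>I. c i \<odot>\<^bsub>M\<^esub> b i) \<in> carrier M"
  using assms b by (intro M.finsum_closed) auto

lemma span_mod_add:
  assumes "u \<in> span_mod b I N" "v \<in> span_mod b I N"
  shows "u \<oplus>\<^bsub>M\<^esub> v \<in> span_mod b I N"
proof -
  obtain c z where c: "u = (\<Oplus>\<^bsub>M\<^esub>i\<in>I. c i \<odot>\<^bsub>M\<^esub> b i) \<oplus>\<^bsub>M\<^esub> z" "c \<in> I \<rightarrow> carrier R" "z \<in> N"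
    using assms(1) unfolding span_mod_def by blast
  obtain d y where d: "v = (\<Oplus>\<^bsub>M\<^esub>i\<in>I. d i \<odot>\<^bsub>M\<^esub> b i) \<oplus>\<^bsub>M\<^esub> y" "d \<in> I \<rightarrow> carrier R" "y \<in> N"
    using assms(2) unfolding span_mod_def by blast
  have bi: "b i \<in> carrier M" if "i \<in> I" for i using b that by auto
  have ci: "c i \<in> carrier R" "d i \<in> carrier R" if "i \<in> I" for i using c d that by auto
  have "(\<Oplus>\<^bsub>M\<^esub>i\<in>I. (c i \<oplus> d i) \<odot>\<^bsub>M\<^esub> b i) = (\<Oplus>\<^bsub>M\<^esub>i\<in>I. c i \<odot>\<^bsub>M\<^esub> b i \<oplus>\<^bsub>M\<^esub> d i \<odot>\<^bsub>M\<^esub> b i)"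
    using bi ci by (intro M.finsum_cong') (auto simp: smult_l_distr)
  also have "\<dots> = (\<Oplus>\<^bsub>M\<^esub>i\<in>I. c i \<odot>\<^bsub>M\<^esub> b i) \<oplus>\<^bsub>M\<^esub> (\<Oplus>\<^bsub>M\<^esub>i\<in>I. d i \<odot>\<^bsub>M\<^esub> b i)"
    using bi ci by (intro M.finsum_addf) auto
  finally have "u \<oplus>\<^bsub>M\<^esub> v = (\<Oplus>\<^bsub>M\<^esub>i\<in>I. (c i \<oplus> d i) \<odot>\<^bsub>M\<^esub> b i) \<oplus>\<^bsub>M\<^esub> (z \<oplus>\<^bsub>M\<^esub> y)"
    using c d lincomb_closed[of c] lincomb_closed[of d] submoduleE(1)[OF N]
    by (simp add: subset_iff M.a_ac)
  then show ?thesis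
    unfolding span_mod_def using ci c(3) d(3) submoduleE(5)[OF N]
    by (intro CollectI exI[of _ "\<lambda>i. c i \<oplus> d i"] exI[of _ "z \<oplus>\<^bsub>M\<^esub> y"]) auto
qed

lemma lincomb_delta:
  assumes "j \<in> I" "a \<in> carrier R"
  shows "(\<Oplus>\<^bsub>M\<^esub>i\<in>I. (if j = i then a else \<zero>) \<odot>\<^bsub>M\<^esub> b i) = a \<odot>\<^bsub>M\<^esub> b j"
proof -
  have "(\<Oplus>\<^bsub>M\<^esub>i\<in>I. (if j = i then a else \<zero>) \<odot>\<^bsub>M\<^esub> b i)
      = (\<Oplus>\<^bsub>M\<^esub>i\<in>I. if j = i then a \<odot>\<^bsub>M\<^esub> b i else \<zero>\<^bsub>M\<^esub>)"
    using b Pi_mem[OF b] assms by (intro M.finsum_cong') auto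
  also have "\<dots> = a \<odot>\<^bsub>M\<^esub> b j"
    using b Pi_mem[OF b] assms fin by (intro M.add.finprod_singleton) auto
  finally show ?thesis .
qed

lemma span_mod_base:
  assumes "j \<in> I" "a \<in> carrier R"
  shows "a \<odot>\<^bsub>M\<^esub> b j \<in> span_mod b I N"
  unfolding span_mod_def using assms b Pi_mem[OF b] submodule_zero[OF N]
  by (intro CollectI exI[of _ "\<lambda>i. if j = i then a else \<zero>"] exI[of _ "\<zero>\<^bsub>M\<^esub>"])
    (auto simp: lincomb_delta)

lemma span_mod_incl:
  assumes "z \<in> N"
  shows "z \<in> span_mod b I N"
proof -
  have "(\<Oplus>\<^bsub>M\<^esub>i\<in>I. \<zero> \<odot>\<^bsub>M\<^esub> b i) = (\<Oplus>\<^bsub>M\<^esub>i\<in>I. \<zero>\<^bsub>M\<^esub>)" using Pi_mem[OF b] by (intro M.finsum_cong') auto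
  then have "z = (\<Oplus>\<^bsub>M\<^esub>i\<in>I. \<zero> \<odot>\<^bsub>M\<^esub> b i) \<oplus>\<^bsub>M\<^esub> z"
    using submoduleE(1)[OF N] assms by auto
  with assms show ?thesis unfolding span_mod_def
    by (intro CollectI exI[of _ "\<lambda>_. \<zero>"] exI[of _ z]) simp
qed

lemma span_mod_finsum:
  assumes "finite J" "\<And>j. j \<in> J \<Longrightarrow> g j \<in> span_mod b I N" "\<And>j. j \<in> J \<Longrightarrow> g j \<in> carrier M"
  shows "(\<Oplus>\<^bsub>M\<^esub>j\<in>J. g j) \<in> span_mod b I N"
  using assms
proof (induction J)
  case empty
  then show ?case using span_mod_incl[OF submodule_zero[OF N]] by simp
next
  case (insert a A)
  then have "(\<Oplus>\<^bsub>M\<^esub>j\<in>insert a A. g j) = g a \<oplus>\<^bsub>M\<^esub> (\<Oplus>\<^bsub>M\<^esub>j\<in>A. g j)"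
    by (intro M.finsum_insert) auto
  with insert show ?case by (simp add: span_mod_add)
qed

lemma card_le_of_span_mod:
  assumes "field R" "finite J" "e \<in> J \<rightarrow> carrier M"
    and span: "\<And>j. j \<in> J \<Longrightarrow> e j \<in> span_mod b I N"
    and indep: "\<And>d j. d \<in> J \<rightarrow> carrier R \<Longrightarrow> (\<Oplus>\<^bsub>M\<^esub>j\<in>J. d j \<odot>\<^bsub>M\<^esub> e j) \<in> N \<Longrightarrow> j \<in> J \<Longrightarrow> d j = \<zero>"
  shows "card J \<le> card I"
proof (rule card_le_of_spanning[OF assms(1) N fin assms(2,3) b])
  fix j assume "j \<in> J"
  then obtain c z where c: "e j = (\<Oplus>\<^bsub>M\<^esub>i\<in>I. c i \<odot>\<^bsub>M\<^esub> b i) \<oplus>\<^bsub>M\<^esub> z" "c \<in> I \<rightarrow> carrier R" "z \<in> N"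
    using span[of j] unfolding span_mod_def by blast
  have "z \<in> carrier M" using c(3) submoduleE(1)[OF N] by blast
  with c(1) lincomb_closed[OF c(2)] have "e j \<ominus>\<^bsub>M\<^esub> (\<Oplus>\<^bsub>M\<^esub>i\<in>I. c i \<odot>\<^bsub>M\<^esub> b i) = z"
    by (simp add: M.minus_eq M.a_ac M.r_neg1 M.r_neg)
  with c(2,3) show "\<exists>c\<in>I \<rightarrow> carrier R. e j \<ominus>\<^bsub>M\<^esub> (\<Oplus>\<^bsub>M\<^esub>i\<in>I. c i \<odot>\<^bsub>M\<^esub> b i) \<in> N"
    by (intro bexI[of _ c]) simp_all
qed (rule indep)

end

end

section \<open>Counting leading words\<close>

text \<open>Bijective base-\<open>n\<close> numeration: words are listed by length and then lexicographically, and
  appending the letter \<open>i\<close> to word number \<open>u\<close> gives word number \<open>n * u + i + 1\<close>.\<close>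

function word_of :: "nat \<Rightarrow> nat \<Rightarrow> nat list" where
  "word_of n m = (if m = 0 then [] else word_of n ((m - 1) div n) @ [(m - 1) mod n])"
  by auto
termination
proof (relation "measure snd")
  fix n m :: nat assume "m \<noteq> 0"
  then show "((n, (m - 1) div n), n, m) \<in> measure snd"
    using div_le_dividend[of "m - 1" n] by (simp del: div_le_dividend)
qed simp

declare word_of.simps [simp del]

lemma word_of_0 [simp]: "word_of n 0 = []"
  by (simp add: word_of.simps)

lemma word_of_snoc: "i < n \<Longrightarrow> word_of n (Suc (n * u + i)) = word_of n u @ [i]"
  by (subst word_of.simps) auto

lemma pos_cases:
  fixes m n :: nat
  assumes "0 < n" and "m \<noteq> 0"
  obtains u i where "m = Suc (n * u + i)" "i < n" "u < m"
proof
  show "m = Suc (n * ((m - 1) div n) + (m - 1) mod n)" using assms by simp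
  show "(m - 1) mod n < n" using assms by simp
  show "(m - 1) div n < m" using assms div_le_dividend[of "m - 1" n] by linarith
qed

lemma word_of_in_lists: "0 < n \<Longrightarrow> word_of n m \<in> lists {..<n}"
proof (induction m rule: less_induct)
  case (less m)
  show ?case
  proof (cases "m = 0")
    case False
    from pos_cases[OF less.prems this] obtain u i where "m = Suc (n * u + i)" "i < n" "u < m" .
    with less show ?thesis by (simp add: word_of_snoc)
  qed simp
qed

lemma word_of_surj:
  assumes "w \<in> lists {..<n}"
  obtains m where "w = word_of n m"
proof -
  from assms have "\<exists>m. w = word_of n m"
  proof (induction w rule: rev_induct)
    case Nil
    then show ?case by (metis word_of_0)
  next
    case (snoc i w)
    then obtain u where "w = word_of n u" by auto
    with snoc.prems show ?case by (intro exI[of _ "Suc (n * u + i)"]) (auto simp: word_of_snoc)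
  qed
  then show ?thesis using that by blast
qed

lemma word_of_inj: "0 < n \<Longrightarrow> word_of n m = word_of n m' \<longleftrightarrow> m = m'"
proof (induction m arbitrary: m' rule: less_induct)
  case (less m)
  have nz: "word_of n a \<noteq> []" if "a > 0" for a using that by (subst word_of.simps) simp
  show ?case
  proof (cases "m = 0 \<or> m' = 0")
    case True
    then show ?thesis using nz[of m] nz[of m'] by (cases "m = m'") auto
  next
    case False
    then obtain u i where m: "m = Suc (n * u + i)" "i < n" "u < m" using pos_cases[OF less.prems] by metis
    from False obtain u' i' where m': "m' = Suc (n * u' + i')" "i' < n" using pos_cases[OF less.prems] by metis
    have digits: "n * u + i = n * u' + i' \<longleftrightarrow> u = u' \<and> i = i'"
    proof
      assume "n * u + i = n * u' + i'"
      then have "(n * u + i) div n = (n * u' + i') div n" "(n * u + i) mod n = (n * u' + i') mod n" by simp_all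
      with m(2) m'(2) less.prems show "u = u' \<and> i = i'" by simp
    qed simp
    show ?thesis unfolding m(1) m'(1) word_of_snoc[OF m(2)] word_of_snoc[OF m'(2)]
      using less.IH[OF m(3) less.prems, of u'] digits by auto
  qed
qed

lemma length_word_of: "length (word_of n m) \<le> m"
proof (induction m rule: less_induct)
  case (less m)
  show ?case
  proof (cases "m = 0")
    case False
    have "(m - 1) div n < m" using False div_le_dividend[of "m - 1" n] by linarith
    from less[OF this] False this show ?thesis by (subst word_of.simps) simp
  qed simp
qed

text \<open>Only finitely many words are shorter than \<open>r\<close>, and the numbering is
  injective, so these words have bounded numbers.\<close>

lemma length_word_of_unbounded:
  assumes "0 < n"
  obtains p where "\<And>m. p \<le> m \<Longrightarrow> r \<le> length (word_of n m)"
proof -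
  let ?S = "{m. length (word_of n m) < r}"
  have "finite (word_of n ` ?S)"
  proof (rule finite_subset)
    show "word_of n ` ?S \<subseteq> {w. set w \<subseteq> {..<n} \<and> length w \<le> r}"
      using word_of_in_lists[OF assms] by (auto simp: in_lists_conv_set)
    show "finite {w. set w \<subseteq> {..<n} \<and> length w \<le> r}" by (rule finite_lists_length_le) simp
  qed
  then have "finite ?S" by (rule finite_imageD) (auto simp: inj_on_def word_of_inj[OF assms])
  then obtain p where "\<forall>m\<in>?S. m < p" using finite_nat_set_iff_bounded by auto
  then have "r \<le> length (word_of n m)" if "p \<le> m" for m
    using that by (metis (mono_tags) mem_Collect_eq not_less)
  then show ?thesis by (rule that)
qed

section \<open>The space of power series and its filtration by word number\<close>

locale word_series = field R for R (structure) +
  fixes n :: nat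
  assumes n_ge_2: "2 \<le> n"
begin

text \<open>In this locale \<open>R\<close> is the coefficient field, not the algebra called R in
  the theorem; the latter enters later as an algebra acting on \<open>V\<close>.\<close>

definition V :: "('a, nat list \<Rightarrow> 'a) module" where
  "V = power_series_algebra R {..<n}"

lemma V_module: "Module.module R V"
  unfolding V_def power_series_algebra_def by (rule coeff_functions_module)

sublocale V: Module.module R V by (rule V_module)

lemma carrier_V: "carrier V = coeff_functions R (free_monoid {..<n})"
  by (simp add: V_def power_series_algebra_def)

lemma V_simps [simp]:
  "\<zero>\<^bsub>V\<^esub> = (\<lambda>w. \<zero>)" "u \<oplus>\<^bsub>V\<^esub> v = (\<lambda>w. u w \<oplus> v w)" "c \<odot>\<^bsub>V\<^esub> v = (\<lambda>w. c \<otimes> v w)"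
  by (simp_all add: V_def power_series_algebra_def)

lemma V_coeff [simp]: "v \<in> carrier V \<Longrightarrow> v w \<in> carrier R"
  unfolding carrier_V by (rule coeff_functions_closed)

lemma V_outside: "v \<in> carrier V \<Longrightarrow> w \<notin> lists {..<n} \<Longrightarrow> v w = \<zero>"
  unfolding carrier_V by (simp add: coeff_functions_def free_monoid_def)

lemma V_memI: "(\<And>w. v w \<in> carrier R) \<Longrightarrow> (\<And>w. w \<notin> lists {..<n} \<Longrightarrow> v w = \<zero>) \<Longrightarrow> v \<in> carrier V"
  unfolding carrier_V by (simp add: coeff_functions_def free_monoid_def)

lemma n_pos: "0 < n"
  using n_ge_2 by simp

lemma V_eqI:
  assumes "u \<in> carrier V" "v \<in> carrier V" "\<And>m. u (word_of n m) = v (word_of n m)"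
  shows "u = v"
proof
  fix w show "u w = v w"
  proof (cases "w \<in> lists {..<n}")
    case True
    then obtain m where "w = word_of n m" by (rule word_of_surj)
    with assms(3) show ?thesis by simp
  qed (use assms(1,2) in \<open>simp add: V_outside\<close>)
qed

lemma V_finsum_apply:
  assumes "finite I" "\<And>i. i \<in> I \<Longrightarrow> g i \<in> carrier V"
  shows "(\<Oplus>\<^bsub>V\<^esub>i\<in>I. g i) w = (\<Oplus>i\<in>I. g i w)"
  using assms
proof (induction I)
  case (insert a I)
  then have "(\<Oplus>\<^bsub>V\<^esub>i\<in>insert a I. g i) = g a \<oplus>\<^bsub>V\<^esub> (\<Oplus>\<^bsub>V\<^esub>i\<in>I. g i)"
    by (intro V.M.finsum_insert) auto
  with insert show ?case by simp
qed simp

abbreviation unit_at :: "nat \<Rightarrow> nat list \<Rightarrow> 'a" where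
  "unit_at m \<equiv> basis_elt R (word_of n m)"

lemma unit_at_closed: "unit_at m \<in> carrier V"
  using word_of_in_lists[OF n_pos] by (intro V_memI) (auto simp: basis_elt_def)

lemma unit_at_apply: "unit_at m (word_of n m') = (if m' = m then \<one> else \<zero>)"
  by (simp add: basis_elt_def word_of_inj[OF n_pos])

text \<open>Right multiplication by the letter \<open>i\<close>. These maps are the right module
  structure that the operators have to respect at large order.\<close>

definition shift :: "nat \<Rightarrow> (nat list \<Rightarrow> 'a) \<Rightarrow> nat list \<Rightarrow> 'a" where
  "shift i v = conv R v (basis_elt R [i])"

definition unshift :: "nat \<Rightarrow> (nat list \<Rightarrow> 'a) \<Rightarrow> nat list \<Rightarrow> 'a" where
  "unshift i v w = v (w @ [i])"

lemma shift_closed: "i < n \<Longrightarrow> v \<in> carrier V \<Longrightarrow> shift i v \<in> carrier V"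
  unfolding shift_def carrier_V
  by (rule conv_in_coeff_functions) (auto simp: coeff_functions_def basis_elt_def free_monoid_def)

lemma unshift_closed: "v \<in> carrier V \<Longrightarrow> unshift i v \<in> carrier V"
  by (intro V_memI) (auto simp: unshift_def V_outside)

lemma shift_apply:
  assumes "v \<in> carrier V"
  shows "shift i v [] = \<zero>" "shift i v (w @ [j]) = (if j = i then v w else \<zero>)"
  unfolding shift_def by (simp_all add: conv_letter_right assms del: conv.simps)

lemma shift_linear: "i < n \<Longrightarrow> V.linear_endo (shift i)"
  unfolding V.linear_endo_def
  by (auto simp: shift_closed)
    (auto simp: shift_def fun_eq_iff conv_add_left conv_smult_left basis_elt_def)

lemma unshift_linear: "V.linear_endo (unshift i)"
  unfolding V.linear_endo_def by (auto simp: unshift_closed) (auto simp: unshift_def)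

lemma unshift_shift: "v \<in> carrier V \<Longrightarrow> unshift i (shift j v) = (if i = j then v else \<zero>\<^bsub>V\<^esub>)"
  by (auto simp: unshift_def shift_apply)

text \<open>Every nonempty word has exactly one last letter, so a series without constant term
  splits by last letters, with right cofactors \<open>unshift i v\<close>.\<close>

lemma shift_unshift:
  assumes v: "v \<in> carrier V" "v [] = \<zero>"
  shows "(\<Oplus>\<^bsub>V\<^esub>i\<in>{..<n}. shift i (unshift i v)) = v"
proof (rule V_eqI[OF _ v(1)])
  have c: "shift i (unshift i v) \<in> carrier V" if "i \<in> {..<n}" for i
    using that v by (simp add: shift_closed unshift_closed)
  then show "(\<Oplus>\<^bsub>V\<^esub>i\<in>{..<n}. shift i (unshift i v)) \<in> carrier V" by (intro V.M.finsum_closed) auto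
  fix m show "(\<Oplus>\<^bsub>V\<^esub>i\<in>{..<n}. shift i (unshift i v)) (word_of n m) = v (word_of n m)"
  proof (cases "m = 0")
    case True
    have "(\<Oplus>j\<in>{..<n}. shift j (unshift j v) []) = (\<Oplus>j\<in>{..<n}. \<zero>)"
      using v by (intro finsum_cong') (auto simp: shift_apply unshift_closed)
    with True show ?thesis using v V_finsum_apply[OF finite_lessThan c] by simp
  next
    case False
    then obtain u i where m: "m = Suc (n * u + i)" "i < n" by (rule pos_cases[OF n_pos])
    have "(\<Oplus>j\<in>{..<n}. shift j (unshift j v) (word_of n m))
        = (\<Oplus>j\<in>{..<n}. if i = j then v (word_of n m) else \<zero>)"
      using v m by (intro finsum_cong') (auto simp: word_of_snoc shift_apply unshift_closed unshift_def)
    also have "\<dots> = v (word_of n m)"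
      using m v by (intro add.finprod_singleton) auto
    finally show ?thesis using V_finsum_apply[OF finite_lessThan c] by simp
  qed
qed

text \<open>Finer than the filtration by order: \<open>cut p\<close> has codimension
  \<open>p\<close>, and each step drops a single dimension, as elimination by leading words
  requires.\<close>

definition cut :: "nat \<Rightarrow> (nat list \<Rightarrow> 'a) set" where
  "cut p = {v \<in> carrier V. \<forall>m<p. v (word_of n m) = \<zero>}"

lemma submoduleI_V:
  assumes "N \<subseteq> carrier V" "\<zero>\<^bsub>V\<^esub> \<in> N" "\<And>u v. u \<in> N \<Longrightarrow> v \<in> N \<Longrightarrow> u \<oplus>\<^bsub>V\<^esub> v \<in> N"
    "\<And>c v. c \<in> carrier R \<Longrightarrow> v \<in> N \<Longrightarrow> c \<odot>\<^bsub>V\<^esub> v \<in> N"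
  shows "submodule N R V"
proof (rule V.submoduleI[OF assms(1,2) _ assms(3,4)])
  fix v assume v: "v \<in> N"
  then have "\<ominus>\<^bsub>V\<^esub> v = \<ominus> \<one> \<odot>\<^bsub>V\<^esub> v" using assms(1) V.smult_l_minus[of \<one> v] by auto
  then show "\<ominus>\<^bsub>V\<^esub> v \<in> N" using assms(4)[OF _ v, of "\<ominus> \<one>"] by simp
qed auto

lemma cut_submodule: "submodule (cut p) R V"
proof (rule submoduleI_V)
  show "\<zero>\<^bsub>V\<^esub> \<in> cut p" using V.M.zero_closed by (simp add: cut_def)
  show "u \<oplus>\<^bsub>V\<^esub> v \<in> cut p" if "u \<in> cut p" "v \<in> cut p" for u v
    using V.M.a_closed[of u v] that by (simp add: cut_def)
  show "c \<odot>\<^bsub>V\<^esub> v \<in> cut p" if "c \<in> carrier R" "v \<in> cut p" for c v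
    using V.smult_closed[of c v] that by (simp add: cut_def)
qed (auto simp: cut_def)

lemma cut_closed: "v \<in> cut p \<Longrightarrow> v \<in> carrier V"
  by (simp add: cut_def)

lemma cut_mono: "p \<le> p' \<Longrightarrow> cut p' \<subseteq> cut p"
  by (auto simp: cut_def)

lemma unit_at_cut: "p \<le> m \<Longrightarrow> unit_at m \<in> cut p"
  by (auto simp: cut_def unit_at_closed unit_at_apply)

text \<open>One elimination step: subtracting the multiple of the monic \<open>g\<close> that
  cancels the coefficient at word \<open>m\<close>.\<close>

lemma cut_step:
  assumes "v \<in> cut m" "g \<in> cut m" "g (word_of n m) = \<one>"
  obtains v' where "v' \<in> cut (Suc m)" "v = v (word_of n m) \<odot>\<^bsub>V\<^esub> g \<oplus>\<^bsub>V\<^esub> v'"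
proof
  let ?a = "v (word_of n m)"
  let ?v = "\<ominus> ?a \<odot>\<^bsub>V\<^esub> g \<oplus>\<^bsub>V\<^esub> v"
  have c: "v \<in> carrier V" "g \<in> carrier V" using assms cut_closed by auto
  have "?v \<in> carrier V" using c by (intro V.M.a_closed V.smult_closed) auto
  moreover have "?v (word_of n m') = \<zero>" if "m' < Suc m" for m'
    using assms c that by (cases "m' = m") (auto simp: cut_def l_neg less_Suc_eq)
  ultimately show "?v \<in> cut (Suc m)" by (simp add: cut_def)
  show "v = ?a \<odot>\<^bsub>V\<^esub> g \<oplus>\<^bsub>V\<^esub> ?v"
    using c by (auto simp: l_minus a_assoc[symmetric] r_neg)
qed

text \<open>Word number \<open>n * p + 1\<close> is word number \<open>p\<close> followed by the
  letter 0, the first word obtained by lengthening words from number \<open>p\<close> on. Together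
  with \<open>unshift_cut\<close> this makes \<open>cut (n * p + 1)\<close> the product of
  \<open>cut p\<close> with the augmentation ideal.\<close>

lemma shift_cut:
  assumes "i < n" "v \<in> cut p"
  shows "shift i v \<in> cut (Suc (n * p))"
proof -
  have v: "v \<in> carrier V" using assms cut_closed by auto
  have "shift i v (word_of n m) = \<zero>" if "m < Suc (n * p)" for m
  proof (cases "m = 0")
    case False
    then obtain u j where m: "m = Suc (n * u + j)" "j < n" by (rule pos_cases[OF n_pos])
    have "n * u < n * p" using that unfolding m(1) by linarith
    then have "u < p" by simp
    with assms m show ?thesis by (simp add: word_of_snoc shift_apply[OF v] cut_def)
  qed (simp add: shift_apply[OF v])
  with shift_closed[OF assms(1) v] show ?thesis by (simp add: cut_def)
qed

lemma unshift_cut: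
  assumes "i < n" "v \<in> cut (Suc (n * p))"
  shows "unshift i v \<in> cut p"
proof -
  have "unshift i v (word_of n u) = \<zero>" if "u < p" for u
  proof -
    have "n * Suc u \<le> n * p" using that by (intro mult_le_mono2) simp
    with assms(1) have "Suc (n * u + i) < Suc (n * p)" by simp
    then have "v (word_of n (Suc (n * u + i))) = \<zero>" using assms(2) unfolding cut_def by blast
    then show ?thesis using assms(1) by (simp add: unshift_def word_of_snoc)
  qed
  with unshift_closed[OF cut_closed[OF assms(2)]] show ?thesis by (simp add: cut_def)
qed

text \<open>The leading word of a series is the word of least number with nonzero coefficient.
  Normalizing that coefficient to one loses nothing for a subspace over a field, see
  \<open>leadsI\<close>.\<close>

definition leads :: "(nat list \<Rightarrow> 'a) set \<Rightarrow> nat set" where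
  "leads N = {m. \<exists>v\<in>N \<inter> cut m. v (word_of n m) = \<one>}"

lemma leadsI:
  assumes "submodule N R V" "v \<in> N" "v \<in> cut m" "v (word_of n m) \<noteq> \<zero>"
  shows "m \<in> leads N"
proof -
  let ?a = "v (word_of n m)"
  have "?a \<in> Units R" using assms cut_closed[of v m] field_Units by simp
  then have "inv ?a \<in> carrier R" "inv ?a \<otimes> ?a = \<one>" by auto
  moreover from this(1) have "inv ?a \<odot>\<^bsub>V\<^esub> v \<in> N" "inv ?a \<odot>\<^bsub>V\<^esub> v \<in> cut m"
    using assms(2,3) V.submoduleE(4)[OF assms(1)] V.submoduleE(4)[OF cut_submodule] by blast+
  ultimately show ?thesis unfolding leads_def by auto
qed

lemma leads_above: "cut s \<subseteq> N \<Longrightarrow> s \<le> m \<Longrightarrow> m \<in> leads N"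
  unfolding leads_def using unit_at_cut[of m m] unit_at_cut[of s m]
  by (intro CollectI bexI[of _ "unit_at m"]) (auto simp: unit_at_apply)

end

section \<open>Dimensions counted by leading words\<close>

context word_series
begin

text \<open>An echelon basis argument: choosing a monic element of \<open>N\<close> for each leading
  word not attained in \<open>N'\<close> gives a basis of N/N', and the exchange bound compares it
  with the basis \<open>b\<close> in both directions. That \<open>cut t\<close> lies in
  \<open>N'\<close> makes this set of words finite and lets the elimination stop.\<close>

lemma card_leads_diff:
  assumes N: "submodule N R V" and N': "submodule N' R V" "N' \<subseteq> N" and t: "cut t \<subseteq> N'"
    and b: "finite I" "b \<in> I \<rightarrow> N"
    and span: "N \<subseteq> V.span_mod b I N'"
    and indep: "\<And>d i. d \<in> I \<rightarrow> carrier R \<Longrightarrow> (\<Oplus>\<^bsub>V\<^esub>i\<in>I. d i \<odot>\<^bsub>V\<^esub> b i) \<in> N' \<Longrightarrow> i \<in> I \<Longrightarrow> d i = \<zero>"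
  shows "card (leads N - leads N') = card I"
proof -
  let ?J = "leads N - leads N'"
  have "?J \<subseteq> {..<t}" using leads_above[OF t] by (meson DiffE lessThan_iff not_less subsetI)
  then have J: "finite ?J" by (rule finite_subset) simp
  note NV = V.submoduleE(1)[OF N]
  have "\<forall>m\<in>?J. \<exists>v. v \<in> N \<inter> cut m \<and> v (word_of n m) = \<one>" unfolding leads_def by auto
  then obtain e where e: "\<And>m. m \<in> ?J \<Longrightarrow> e m \<in> N \<and> e m \<in> cut m \<and> e m (word_of n m) = \<one>"
    by (metis Int_iff)
  have eV: "e \<in> ?J \<rightarrow> carrier V" and bV: "b \<in> I \<rightarrow> carrier V" using e NV b(2) by auto
  have eV': "e m \<in> carrier V" if "m \<in> ?J" for m using Pi_mem[OF eV that] .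
  \<comment> \<open>Downward induction on \<open>T\<close> from \<open>t\<close>, where
    \<open>cut t\<close> is already contained in \<open>N'\<close>.\<close>
  have down: "v \<in> V.span_mod e ?J N'" if "T \<le> t" "v \<in> N" "v \<in> cut T" for T v
    using that
  proof (induction arbitrary: v rule: inc_induct)
    case base
    then show ?case using t V.span_mod_incl[OF N'(1) J eV] by blast
  next
    case (step m)
    have vV: "v \<in> carrier V" using step.prems cut_closed by simp
    show ?case
    proof (cases "v (word_of n m) = \<zero>")
      case True
      with step.prems have "v \<in> cut (Suc m)" by (auto simp: cut_def less_Suc_eq)
      then show ?thesis using step by blast
    next
      case False
      then have "m \<in> leads N" using leadsI[OF N] step.prems by blast
      \<comment> \<open>The term at word \<open>m\<close> is cancelled by an element of
        \<open>N'\<close> if \<open>m\<close> is a lead of \<open>N'\<close>, and by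
        \<open>e m\<close> otherwise; in both cases all multiples lie in the span.\<close>
      have "\<exists>g. g \<in> N \<and> g \<in> cut m \<and> g (word_of n m) = \<one> \<and>
          (\<forall>a\<in>carrier R. a \<odot>\<^bsub>V\<^esub> g \<in> V.span_mod e ?J N')"
      proof (cases "m \<in> leads N'")
        case True
        then obtain g where g: "g \<in> N'" "g \<in> cut m" "g (word_of n m) = \<one>" unfolding leads_def by auto
        then show ?thesis using N'(2) V.span_mod_incl[OF N'(1) J eV] V.submoduleE(4)[OF N'(1)]
          by (intro exI[of _ g]) blast
      next
        case False
        with \<open>m \<in> leads N\<close> have m: "m \<in> ?J" by simp
        show ?thesis using e[OF m] V.span_mod_base[OF N'(1) J eV m] by blast
      qed
      then obtain g where g: "g \<in> N" "g \<in> cut m" "g (word_of n m) = \<one>"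
        and gs: "\<And>a. a \<in> carrier R \<Longrightarrow> a \<odot>\<^bsub>V\<^esub> g \<in> V.span_mod e ?J N'" by blast
      obtain v' where v': "v' \<in> cut (Suc m)" "v = v (word_of n m) \<odot>\<^bsub>V\<^esub> g \<oplus>\<^bsub>V\<^esub> v'"
        using cut_step[OF step.prems(2) g(2,3)] by blast
      let ?a = "v (word_of n m)"
      have a: "?a \<in> carrier R" using vV by simp
      have gV: "g \<in> carrier V" and v'V: "v' \<in> carrier V" using g(2) v'(1) cut_closed by blast+
      have "v' = \<ominus>\<^bsub>V\<^esub> (?a \<odot>\<^bsub>V\<^esub> g) \<oplus>\<^bsub>V\<^esub> v"
        by (subst v'(2), rule V.M.r_neg1[symmetric]) (use a gV v'V in blast)+
      also have "\<dots> \<in> N" using V.submoduleE(3-5)[OF N] g(1) a step.prems(1) by blast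
      finally have "v' \<in> V.span_mod e ?J N'" using step.IH v'(1) by blast
      then show ?thesis using V.span_mod_add[OF N'(1) J eV gs[OF a]] v'(2) by metis
    qed
  qed
  have "cut 0 = carrier V" by (simp add: cut_def)
  with down[of 0] NV have spanJ: "N \<subseteq> V.span_mod e ?J N'" by blast
  have indepJ: "d m = \<zero>"
    if d: "d \<in> ?J \<rightarrow> carrier R" "(\<Oplus>\<^bsub>V\<^esub>j\<in>?J. d j \<odot>\<^bsub>V\<^esub> e j) \<in> N'" "m \<in> ?J" for d m
    using d(3)
  proof (induction m rule: less_induct)
    case (less m)
    have dR: "d j \<in> carrier R" if "j \<in> ?J" for j using Pi_mem[OF d(1) that] .
    let ?z = "\<Oplus>\<^bsub>V\<^esub>j\<in>?J. d j \<odot>\<^bsub>V\<^esub> e j"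
    have ap: "?z w = (\<Oplus>j\<in>?J. d j \<otimes> e j w)" for w
      using V_finsum_apply[OF J, of "\<lambda>j. d j \<odot>\<^bsub>V\<^esub> e j" w] V.smult_closed dR eV' by simp
    \<comment> \<open>The \<open>d j\<close> with \<open>j < m\<close> vanish by induction, and the
      \<open>e j\<close> with \<open>j > m\<close> have no coefficient up to \<open>m\<close>. So a
      nonzero \<open>d m\<close> would be the leading coefficient, at \<open>m\<close>, of an
      element of \<open>N'\<close>, which is excluded.\<close>
    have z: "?z (word_of n l) = (if l = m then d m else \<zero>)" if "l \<le> m" for l
    proof -
      have "d j \<otimes> e j (word_of n l) = (if m = j then if l = m then d m else \<zero> else \<zero>)" if j: "j \<in> ?J" for j
      proof -
        consider "j < m" | "j = m" | "m < j" by linarith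
        then show ?thesis
        proof cases
          case 1
          then show ?thesis using less.IH[OF 1 j] eV'[OF j] by simp
        next
          case 2
          then show ?thesis using e[OF j] dR[OF j] \<open>l \<le> m\<close> by (auto simp: cut_def)
        next
          case 3
          then have "l < j" using \<open>l \<le> m\<close> by simp
          with e[OF j] have "e j (word_of n l) = \<zero>" unfolding cut_def by blast
          then show ?thesis using dR[OF j] 3 by simp
        qed
      qed
      then have "?z (word_of n l) = (\<Oplus>j\<in>?J. if m = j then if l = m then d m else \<zero> else \<zero>)"
        unfolding ap by (intro finsum_cong') (use dR less.prems in auto)
      also have "\<dots> = (if l = m then d m else \<zero>)"
        using less.prems J dR by (intro add.finprod_singleton) auto
      finally show ?thesis .
    qed
    have zV: "?z \<in> carrier V" using d(2) V.submoduleE(1)[OF N'(1)] by blast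
    have "?z \<in> cut m" unfolding cut_def using zV z by simp
    show "d m = \<zero>"
    proof (rule ccontr)
      assume "d m \<noteq> \<zero>"
      with z[of m] have "m \<in> leads N'" using leadsI[OF N'(1) d(2) \<open>?z \<in> cut m\<close>] by simp
      with less.prems show False by simp
    qed
  qed
  have "card ?J \<le> card I"
  proof (rule V.card_le_of_span_mod[OF N'(1) b(1) bV field_axioms J eV])
    fix j assume "j \<in> ?J"
    then show "e j \<in> V.span_mod b I N'" using span e by blast
  qed (rule indepJ)
  moreover have "card I \<le> card ?J"
  proof (rule V.card_le_of_span_mod[OF N'(1) J eV field_axioms b(1) bV])
    fix i assume "i \<in> I"
    then show "b i \<in> V.span_mod e ?J N'" using spanJ b(2) by blast
  qed (rule indep)
  ultimately show ?thesis by simp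
qed

text \<open>The image of a subspace \<open>N\<close> under right multiplication by the augmentation ideal.\<close>

definition shifts :: "(nat list \<Rightarrow> 'a) set \<Rightarrow> (nat list \<Rightarrow> 'a) set" where
  "shifts N = {v \<in> carrier V. v [] = \<zero> \<and> (\<forall>i<n. unshift i v \<in> N)}"

lemma shifts_submodule:
  assumes N: "submodule N R V"
  shows "submodule (shifts N) R V"
proof (rule submoduleI_V)
  show "\<zero>\<^bsub>V\<^esub> \<in> shifts N"
    unfolding shifts_def using V.linear_endo_zero[OF unshift_linear] V.submodule_zero[OF N] V.M.zero_closed by simp
  show "u \<oplus>\<^bsub>V\<^esub> v \<in> shifts N" if uv: "u \<in> shifts N" "v \<in> shifts N" for u v
  proof -
    have c: "u \<in> carrier V" "v \<in> carrier V" using uv by (auto simp: shifts_def)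
    have "unshift i (u \<oplus>\<^bsub>V\<^esub> v) \<in> N" if "i < n" for i
      unfolding V.linear_endoD(2)[OF unshift_linear c]
      by (rule V.submoduleE(5)[OF N]) (use that uv in \<open>auto simp: shifts_def\<close>)
    then show ?thesis using V.M.a_closed[OF c] uv by (simp add: shifts_def)
  qed
  show "c \<odot>\<^bsub>V\<^esub> v \<in> shifts N" if cv: "c \<in> carrier R" "v \<in> shifts N" for c v
  proof -
    have v: "v \<in> carrier V" using cv by (auto simp: shifts_def)
    have "unshift i (c \<odot>\<^bsub>V\<^esub> v) \<in> N" if "i < n" for i
      unfolding V.linear_endoD(3)[OF unshift_linear cv(1) v]
      by (rule V.submoduleE(4)[OF N]) (use that cv in \<open>auto simp: shifts_def\<close>)
    then show ?thesis using V.smult_closed[OF cv(1) v] cv by (simp add: shifts_def)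
  qed
qed (auto simp: shifts_def)

lemma shift_in_shifts:
  assumes N: "submodule N R V" and "i < n" "v \<in> N"
  shows "shift i v \<in> shifts N"
proof -
  have v: "v \<in> carrier V" using V.submoduleE(1)[OF N] assms(3) by blast
  then show ?thesis
    using shift_closed[OF assms(2) v] V.submodule_zero[OF N] assms(3)
    by (simp add: shifts_def shift_apply unshift_shift)
qed

text \<open>Appending a fixed letter preserves the order of word numbers, and parts ending in
  different letters do not interfere. So multiplying by the augmentation ideal appends each letter
  to each leading word.\<close>

lemma leads_shifts:
  assumes N: "submodule N R V"
  shows "leads (shifts N) = (\<lambda>(u, i). Suc (n * u + i)) ` (leads N \<times> {..<n})"
proof (intro equalityI subsetI)
  fix m assume "m \<in> leads (shifts N)"
  then obtain v where v: "v \<in> shifts N" "v \<in> cut m" "v (word_of n m) = \<one>" unfolding leads_def by auto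
  have "m \<noteq> 0"
  proof
    assume "m = 0"
    with v show False using one_not_zero by (simp add: shifts_def)
  qed
  then obtain u i where m: "m = Suc (n * u + i)" "i < n" by (rule pos_cases[OF n_pos])
  have "unshift i v (word_of n u') = \<zero>" if "u' < u" for u'
  proof -
    have "n * u' < n * u" using that n_pos by simp
    with m have "Suc (n * u' + i) < m" by simp
    with v(2) have "v (word_of n (Suc (n * u' + i))) = \<zero>" unfolding cut_def by blast
    then show ?thesis using m by (simp add: unshift_def word_of_snoc)
  qed
  moreover have "unshift i v \<in> carrier V" using unshift_closed cut_closed v(2) by blast
  ultimately have "unshift i v \<in> cut u" by (simp add: cut_def)
  moreover have "unshift i v (word_of n u) = \<one>" using v(3) m by (simp add: unshift_def word_of_snoc)
  ultimately have "u \<in> leads N" using v(1) m(2) unfolding leads_def shifts_def by auto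
  with m show "m \<in> (\<lambda>(u, i). Suc (n * u + i)) ` (leads N \<times> {..<n})" by auto
next
  fix m assume "m \<in> (\<lambda>(u, i). Suc (n * u + i)) ` (leads N \<times> {..<n})"
  then obtain u i where m: "m = Suc (n * u + i)" "i < n" "u \<in> leads N" by auto
  then obtain v where v: "v \<in> N" "v \<in> cut u" "v (word_of n u) = \<one>" unfolding leads_def by auto
  have vV: "v \<in> carrier V" using v cut_closed by blast
  have "shift i v (word_of n m') = \<zero>" if "m' < m" for m'
  proof (cases "m' = 0")
    case False
    then obtain u' i' where m': "m' = Suc (n * u' + i')" "i' < n" by (rule pos_cases[OF n_pos])
    show ?thesis
    proof (cases "i' = i")
      case True
      with that m m' have "u' < u" by simp
      with v(2) m' vV show ?thesis by (simp add: word_of_snoc shift_apply cut_def)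
    qed (use m' vV in \<open>simp add: word_of_snoc shift_apply\<close>)
  qed (simp add: shift_apply vV)
  then have "shift i v \<in> cut m" using shift_closed[OF m(2) vV] by (simp add: cut_def)
  moreover have "shift i v (word_of n m) = \<one>" using v(3) m vV by (simp add: word_of_snoc shift_apply)
  ultimately show "m \<in> leads (shifts N)" using shift_in_shifts[OF N m(2) v(1)] unfolding leads_def by auto
qed

lemma cut_subset_shifts:
  assumes "cut s \<subseteq> N"
  shows "cut (Suc (n * s)) \<subseteq> shifts N"
proof
  fix v assume v: "v \<in> cut (Suc (n * s))"
  then have "v (word_of n 0) = \<zero>" unfolding cut_def by blast
  then show "v \<in> shifts N" using v unshift_cut[OF _ v] assms cut_closed by (auto simp: shifts_def)
qed

text \<open>Schreier's index formula modulo \<open>n - 1\<close>: a right ideal of codimension \<open>c\<close> has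
  \<open>1 + (n - 1) * c\<close> free generators.\<close>

lemma card_leads_shifts:
  assumes N: "submodule N R V" and s: "cut s \<subseteq> N" and sub: "shifts N \<subseteq> N"
  shows "card (leads N - leads (shifts N)) mod (n - 1) = 1 mod (n - 1)"
proof -
  define A where "A = leads N \<inter> {..<s}"
  let ?f = "\<lambda>(u, i). Suc (n * u + i)"
  have inj: "inj_on ?f (UNIV \<times> {..<n})"
  proof (rule inj_onI, clarsimp)
    fix u i u' i' assume "i < n" "i' < n" "n * u + i = n * u' + i'"
    then have "(n * u + i) div n = (n * u' + i') div n" "(n * u + i) mod n = (n * u' + i') mod n" by simp_all
    with \<open>i < n\<close> \<open>i' < n\<close> show "u = u' \<and> i = i'" by simp
  qed
  \<comment> \<open>From \<open>?T\<close> on, both sets of leads contain every number, so the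
    comparison takes place below \<open>?T\<close>.\<close>
  let ?T = "Suc (n * s)"
  have "s \<le> n * s" using n_pos by simp
  have L: "leads N \<inter> {..<?T} = A \<union> {s..<?T}"
  proof (rule Set.set_eqI)
    fix m show "m \<in> leads N \<inter> {..<?T} \<longleftrightarrow> m \<in> A \<union> {s..<?T}"
    proof (cases "m < s")
      case True
      then have "m < ?T" using \<open>s \<le> n * s\<close> by linarith
      with True show ?thesis by (simp add: A_def)
    qed (use leads_above[OF s, of m] in \<open>auto simp: A_def\<close>)
  qed
  have L': "leads (shifts N) \<inter> {..<?T} = ?f ` (A \<times> {..<n})"
  proof -
    have "Suc (n * u + i) < ?T \<longleftrightarrow> u < s" if "i < n" for u i
    proof
      assume "Suc (n * u + i) < ?T" then have "n * u < n * s" by linarith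
      then show "u < s" by simp
    next
      assume "u < s"
      then have "n * Suc u \<le> n * s" by (intro mult_le_mono2) simp
      with that show "Suc (n * u + i) < ?T" by simp
    qed
    then show ?thesis unfolding leads_shifts[OF N] A_def by force
  qed
  have cA: "card (leads (shifts N) \<inter> {..<?T}) = n * card A"
  proof -
    have "card (?f ` (A \<times> {..<n})) = card (A \<times> {..<n})"
      by (rule card_image, rule inj_on_subset[OF inj]) auto
    then show ?thesis unfolding L' by (simp add: card_cartesian_product)
  qed
  have cL: "card (leads N \<inter> {..<?T}) = card A + (n - 1) * s + 1"
  proof -
    have "card (A \<union> {s..<?T}) = card A + card {s..<?T}"
      by (rule card_Un_disjoint) (auto simp: A_def)
    then show ?thesis unfolding L using \<open>s \<le> n * s\<close> by (simp add: diff_mult_distrib Suc_diff_le)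
  qed
  have "cut ?T \<subseteq> shifts N" by (rule cut_subset_shifts[OF s])
  then have above: "leads (shifts N) \<supseteq> {?T..}" using leads_above by auto
  have "leads (shifts N) \<subseteq> leads N" using sub unfolding leads_def by auto
  then have "leads N - leads (shifts N) = (leads N \<inter> {..<?T}) - (leads (shifts N) \<inter> {..<?T})"
    using above by (auto simp: not_less[symmetric])
  moreover have "card \<dots> = card (leads N \<inter> {..<?T}) - card (leads (shifts N) \<inter> {..<?T})"
    using \<open>leads (shifts N) \<subseteq> leads N\<close> by (intro card_Diff_subset) auto
  moreover have "card (leads (shifts N) \<inter> {..<?T}) \<le> card (leads N \<inter> {..<?T})"
    using \<open>leads (shifts N) \<subseteq> leads N\<close> by (intro card_mono) auto
  ultimately have "card (leads N - leads (shifts N)) + n * card A = card A + (n - 1) * s + 1"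
    using cA cL by simp
  moreover have "n * card A = (n - 1) * card A + card A" using n_pos by (cases n) auto
  \<comment> \<open>The codimension of \<open>N\<close> is c = \<open>s - card A\<close>, and the
    count is 1 + (n - 1) * c, written additively to avoid subtraction of natural numbers.\<close>
  ultimately have "card (leads N - leads (shifts N)) + (n - 1) * card A = 1 + (n - 1) * s" by simp
  then show ?thesis by (metis mod_mult_self2)
qed

section \<open>The rank congruence for a right linear map defined at large order\<close>

context
  fixes P Q :: "nat \<Rightarrow> (nat list \<Rightarrow> 'a) \<Rightarrow> nat list \<Rightarrow> 'a" and q p s :: nat
  assumes P_lin: "\<And>j. j < q \<Longrightarrow> V.linear_endo (P j)"
    and Q_lin: "\<And>j. j < q \<Longrightarrow> V.linear_endo (Q j)"
    and P_shift: "\<And>j i v. j < q \<Longrightarrow> i < n \<Longrightarrow> v \<in> cut p \<Longrightarrow> P j (shift i v) = shift i (P j v)"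
    and Q_cut: "\<And>j v. j < q \<Longrightarrow> v \<in> cut s \<Longrightarrow> Q j v \<in> cut p"
    and PQ: "\<And>v. v \<in> cut s \<Longrightarrow> (\<Oplus>\<^bsub>V\<^esub>j\<in>{..<q}. P j (Q j v)) = v"
    and QP: "\<And>i j v. i < q \<Longrightarrow> j < q \<Longrightarrow> v \<in> cut p \<Longrightarrow> Q i (P j v) = (if i = j then v else \<zero>\<^bsub>V\<^esub>)"
begin

text \<open>The right ideal N of the overview. The map sending (y_j) to the sum of the
  \<open>P j (y j)\<close> is right linear on q copies of \<open>cut p\<close>; \<open>QP\<close>
  makes it injective, and \<open>PQ\<close> puts \<open>cut s\<close> into its image.\<close>

definition image_sum :: "(nat list \<Rightarrow> 'a) set" where
  "image_sum = {\<Oplus>\<^bsub>V\<^esub>j\<in>{..<q}. P j (y j) | y. y \<in> {..<q} \<rightarrow> cut p}"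

lemma P_closed: "j < q \<Longrightarrow> v \<in> carrier V \<Longrightarrow> P j v \<in> carrier V"
  using V.linear_endoD(1)[OF P_lin] .

lemma image_sum_submodule: "submodule image_sum R V"
proof (rule submoduleI_V)
  have c: "P j (y j) \<in> carrier V" if "y \<in> {..<q} \<rightarrow> cut p" "j < q" for y j
    using P_closed[OF that(2)] cut_closed[of "y j" p] that by (simp add: Pi_iff)
  then show "image_sum \<subseteq> carrier V"
    unfolding image_sum_def by (auto simp del: V_simps intro!: V.M.finsum_closed)
  have "(\<Oplus>\<^bsub>V\<^esub>j\<in>{..<q}. P j \<zero>\<^bsub>V\<^esub>) = (\<Oplus>\<^bsub>V\<^esub>j\<in>{..<q}. \<zero>\<^bsub>V\<^esub>)"
    by (intro V.M.finsum_cong') (auto simp del: V_simps simp: V.linear_endo_zero[OF P_lin])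
  then show "\<zero>\<^bsub>V\<^esub> \<in> image_sum"
    unfolding image_sum_def using V.submodule_zero[OF cut_submodule]
    by (intro CollectI exI[of _ "\<lambda>_. \<zero>\<^bsub>V\<^esub>"]) (auto simp del: V_simps)
  show "u \<oplus>\<^bsub>V\<^esub> v \<in> image_sum" if uv: "u \<in> image_sum" "v \<in> image_sum" for u v
  proof -
    obtain y z where y: "y \<in> {..<q} \<rightarrow> cut p" "u = (\<Oplus>\<^bsub>V\<^esub>j\<in>{..<q}. P j (y j))"
      and z: "z \<in> {..<q} \<rightarrow> cut p" "v = (\<Oplus>\<^bsub>V\<^esub>j\<in>{..<q}. P j (z j))"
      using uv unfolding image_sum_def by blast
    have yz: "y j \<in> carrier V" "z j \<in> carrier V" if "j < q" for j
      using y(1) z(1) that cut_closed by (auto simp: Pi_iff)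
    have "(\<Oplus>\<^bsub>V\<^esub>j\<in>{..<q}. P j (y j \<oplus>\<^bsub>V\<^esub> z j)) = (\<Oplus>\<^bsub>V\<^esub>j\<in>{..<q}. P j (y j) \<oplus>\<^bsub>V\<^esub> P j (z j))"
      by (intro V.M.finsum_cong')
        (auto simp del: V_simps simp: V.linear_endoD(2)[OF P_lin] yz c y z P_closed intro!: V.M.a_closed)
    also have "\<dots> = u \<oplus>\<^bsub>V\<^esub> v" unfolding y z by (intro V.M.finsum_addf) (auto simp: yz P_closed)
    finally show ?thesis unfolding image_sum_def using y(1) z(1) V.submoduleE(5)[OF cut_submodule]
      by (intro CollectI exI[of _ "\<lambda>j. y j \<oplus>\<^bsub>V\<^esub> z j"]) (auto simp del: V_simps simp: Pi_iff)
  qed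
  show "a \<odot>\<^bsub>V\<^esub> v \<in> image_sum" if av: "a \<in> carrier R" "v \<in> image_sum" for a v
  proof -
    obtain y where y: "y \<in> {..<q} \<rightarrow> cut p" "v = (\<Oplus>\<^bsub>V\<^esub>j\<in>{..<q}. P j (y j))"
      using av unfolding image_sum_def by blast
    have yV: "y j \<in> carrier V" if "j < q" for j
      using y(1) that cut_closed by (auto simp: Pi_iff)
    have "a \<odot>\<^bsub>V\<^esub> v = (\<Oplus>\<^bsub>V\<^esub>j\<in>{..<q}. a \<odot>\<^bsub>V\<^esub> P j (y j))"
      unfolding y by (rule V.finsum_smult_ldistr) (auto simp: av yV P_closed)
    also have "\<dots> = (\<Oplus>\<^bsub>V\<^esub>j\<in>{..<q}. P j (a \<odot>\<^bsub>V\<^esub> y j))"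
      by (intro V.M.finsum_cong')
        (auto simp del: V_simps simp: V.linear_endoD(3)[OF P_lin] av yV P_closed intro!: P_closed V.smult_closed)
    finally show ?thesis unfolding image_sum_def using y(1) V.submoduleE(4)[OF cut_submodule av(1)]
      by (intro CollectI exI[of _ "\<lambda>j. a \<odot>\<^bsub>V\<^esub> y j"]) (auto simp del: V_simps simp: Pi_iff)
  qed
qed

text \<open>By \<open>QP\<close> the map \<open>Q i\<close> annihilates every summand but the one
  with index \<open>i\<close>, so the components of an element of the image are determined by
  it.\<close>

lemma Q_image_sum:
  assumes "y \<in> {..<q} \<rightarrow> cut p" "i < q"
  shows "Q i (\<Oplus>\<^bsub>V\<^esub>j\<in>{..<q}. P j (y j)) = y i"
proof -
  have y: "y j \<in> cut p" "y j \<in> carrier V" if "j < q" for j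
    using that assms(1) cut_closed by (auto simp: Pi_iff)
  have "Q i (\<Oplus>\<^bsub>V\<^esub>j\<in>{..<q}. P j (y j)) = (\<Oplus>\<^bsub>V\<^esub>j\<in>{..<q}. Q i (P j (y j)))"
    by (rule V.linear_endo_finsum[OF Q_lin[OF assms(2)]]) (auto simp: P_closed y)
  also have "\<dots> = (\<Oplus>\<^bsub>V\<^esub>j\<in>{..<q}. if i = j then y j else \<zero>\<^bsub>V\<^esub>)"
    by (intro V.M.finsum_cong') (auto simp del: V_simps simp: QP y assms(2))
  also have "\<dots> = y i" using assms(2) y by (intro V.M.add.finprod_singleton) auto
  finally show ?thesis .
qed

lemma P_in_image_sum:
  assumes "j < q" "v \<in> cut p"
  shows "P j v \<in> image_sum"
proof -
  let ?y = "\<lambda>i. if j = i then v else \<zero>\<^bsub>V\<^esub>"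
  have v: "v \<in> carrier V" using assms cut_closed by blast
  have "(\<Oplus>\<^bsub>V\<^esub>i\<in>{..<q}. P i (?y i)) = (\<Oplus>\<^bsub>V\<^esub>i\<in>{..<q}. if j = i then P i v else \<zero>\<^bsub>V\<^esub>)"
    by (intro V.M.finsum_cong') (auto simp del: V_simps simp: V.linear_endo_zero[OF P_lin] P_closed v)
  also have "\<dots> = P j v" using assms v by (intro V.M.add.finprod_singleton) (auto simp: P_closed)
  finally show ?thesis unfolding image_sum_def using assms V.submodule_zero[OF cut_submodule]
    by (intro CollectI exI[of _ ?y]) (auto simp del: V_simps simp: Pi_iff)
qed

lemma cut_image_sum: "cut s \<subseteq> image_sum"
proof
  fix v assume "v \<in> cut s"
  then show "v \<in> image_sum" unfolding image_sum_def using PQ Q_cut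
    by (intro CollectI exI[of _ "\<lambda>j. Q j v"]) auto
qed

text \<open>Right linearity of \<open>P j\<close> on \<open>cut p\<close> moves the letter onto the
  components, and this pushes them from \<open>cut p\<close> into
  \<open>cut (n * p + 1)\<close>.\<close>

lemma shift_image_sum:
  assumes "i < n" "v \<in> image_sum"
  obtains y where "y \<in> {..<q} \<rightarrow> cut (Suc (n * p))" "shift i v = (\<Oplus>\<^bsub>V\<^esub>j\<in>{..<q}. P j (y j))"
proof -
  obtain y where y: "y \<in> {..<q} \<rightarrow> cut p" "v = (\<Oplus>\<^bsub>V\<^esub>j\<in>{..<q}. P j (y j))"
    using assms unfolding image_sum_def by blast
  have yV: "y j \<in> carrier V" if "j < q" for j
    using y(1) that cut_closed by (auto simp: Pi_iff)
  have "shift i v = (\<Oplus>\<^bsub>V\<^esub>j\<in>{..<q}. shift i (P j (y j)))"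
    unfolding y by (rule V.linear_endo_finsum[OF shift_linear[OF assms(1)]]) (auto simp: P_closed yV)
  also have "\<dots> = (\<Oplus>\<^bsub>V\<^esub>j\<in>{..<q}. P j (shift i (y j)))"
    by (intro V.M.finsum_cong') (use y(1) yV assms(1) in \<open>auto simp: P_shift P_closed shift_closed Pi_iff\<close>)
  finally show ?thesis using y(1) shift_cut[OF assms(1)] that[of "\<lambda>j. shift i (y j)"] by (auto simp: Pi_iff)
qed

lemma p_le: "p \<le> Suc (n * p)"
  using n_pos by (simp add: le_SucI)

lemma shifts_image_sum_subset: "shifts image_sum \<subseteq> image_sum"
proof
  fix v assume v: "v \<in> shifts image_sum"
  have "shift i (unshift i v) \<in> image_sum" if "i < n" for i
  proof -
    have "unshift i v \<in> image_sum" using v that by (simp add: shifts_def)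
    from shift_image_sum[OF that this] obtain y where y: "y \<in> {..<q} \<rightarrow> cut (Suc (n * p))"
      "shift i (unshift i v) = (\<Oplus>\<^bsub>V\<^esub>j\<in>{..<q}. P j (y j))" .
    then have "y \<in> {..<q} \<rightarrow> cut p" using cut_mono[OF p_le] by blast
    with y(2) show ?thesis unfolding image_sum_def by blast
  qed
  then have "(\<Oplus>\<^bsub>V\<^esub>i\<in>{..<n}. shift i (unshift i v)) \<in> image_sum"
    by (intro V.submodule_finsum[OF image_sum_submodule]) auto
  with v show "v \<in> image_sum" by (simp add: shifts_def shift_unshift)
qed

text \<open>An element of N times the augmentation ideal is a sum of elements of N multiplied by
  letters, whose components lie in \<open>cut (n * p + 1)\<close>; \<open>Q l\<close> reads off a
  component. This yields the independence of the basis in \<open>rank_congruence\<close>.\<close>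

lemma Q_shifts_image_sum:
  assumes v: "v \<in> shifts image_sum" and "l < q"
  shows "Q l v \<in> cut (Suc (n * p))"
proof -
  have u: "unshift i v \<in> image_sum" "unshift i v \<in> carrier V" if "i < n" for i
    using v that unshift_closed by (auto simp: shifts_def)
  have "v = (\<Oplus>\<^bsub>V\<^esub>i\<in>{..<n}. shift i (unshift i v))" using v by (simp add: shifts_def shift_unshift)
  then have "Q l v = Q l (\<Oplus>\<^bsub>V\<^esub>i\<in>{..<n}. shift i (unshift i v))" by simp
  also have "\<dots> = (\<Oplus>\<^bsub>V\<^esub>i\<in>{..<n}. Q l (shift i (unshift i v)))"
    by (rule V.linear_endo_finsum[OF Q_lin[OF assms(2)]]) (auto simp: shift_closed u)
  also have "\<dots> \<in> cut (Suc (n * p))"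
  proof (rule V.submodule_finsum[OF cut_submodule])
    fix i assume "i \<in> {..<n}"
    then obtain y where y: "y \<in> {..<q} \<rightarrow> cut (Suc (n * p))"
      "shift i (unshift i v) = (\<Oplus>\<^bsub>V\<^esub>j\<in>{..<q}. P j (y j))" using shift_image_sum u(1) by blast
    then have "y \<in> {..<q} \<rightarrow> cut p" using cut_mono[OF p_le] by blast
    with y assms(2) show "Q l (shift i (unshift i v)) \<in> cut (Suc (n * p))" by (simp add: Q_image_sum Pi_iff)
  qed simp
  finally show ?thesis .
qed

text \<open>N is a copy of q summands \<open>cut p\<close>, and \<open>cut p\<close> modulo its
  product with the augmentation ideal, \<open>cut (n * p + 1)\<close>, has the words numbered
  \<open>p\<close> to \<open>n * p\<close> as basis. So N/Nm has dimension q(1 + (n-1)p), congruent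
  to q, while \<open>card_leads_shifts\<close> makes it congruent to 1.\<close>

lemma rank_congruence: "q mod (n - 1) = 1 mod (n - 1)"
proof -
  let ?N = image_sum and ?I = "{..<q} \<times> {p..n * p}"
  let ?b = "\<lambda>(j, t). P j (unit_at t)"
  note N = image_sum_submodule
  note N' = shifts_submodule[OF N]
  have b: "?b \<in> ?I \<rightarrow> ?N" using P_in_image_sum unit_at_cut by auto
  then have bV: "?b \<in> ?I \<rightarrow> carrier V" using V.submoduleE(1)[OF N] by blast
  have fin: "finite ?I" by simp
  note SM = V.span_mod_add[OF N' fin bV] V.span_mod_base[OF N' fin bV] V.span_mod_incl[OF N' fin bV]
  \<comment> \<open>Downward induction on \<open>T\<close> from \<open>n * p + 1\<close>, splitting
    off one word number at a time.\<close>
  have span: "P j y \<in> V.span_mod ?b ?I (shifts ?N)"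
    if "T \<le> Suc (n * p)" "p \<le> T" "j < q" "y \<in> cut T" for T j y
    using that
  proof (induction arbitrary: y rule: inc_induct)
    case base
    \<comment> \<open>For \<open>y\<close> in \<open>cut (n * p + 1)\<close> all right cofactors lie
      in \<open>cut p\<close>, where \<open>P j\<close> commutes with the shifts.\<close>
    have u: "unshift i y \<in> cut p" "unshift i y \<in> carrier V" if "i < n" for i
      using base unshift_cut[OF that] cut_closed by auto
    have "y (word_of n 0) = \<zero>" using base unfolding cut_def by blast
    with base have "y = (\<Oplus>\<^bsub>V\<^esub>i\<in>{..<n}. shift i (unshift i y))"
      using cut_closed by (simp add: shift_unshift)
    then have "P j y = P j (\<Oplus>\<^bsub>V\<^esub>i\<in>{..<n}. shift i (unshift i y))" by simp
    also have "\<dots> = (\<Oplus>\<^bsub>V\<^esub>i\<in>{..<n}. P j (shift i (unshift i y)))"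
      by (rule V.linear_endo_finsum[OF P_lin[OF base(2)]]) (auto simp: shift_closed u)
    also have "\<dots> \<in> shifts ?N"
      by (rule V.submodule_finsum[OF N'])
        (auto simp: P_shift base u intro!: shift_in_shifts[OF N] P_in_image_sum)
    finally show ?case by (rule SM(3))
  next
    case (step m)
    let ?a = "y (word_of n m)"
    have m: "(j, m) \<in> ?I" using step by auto
    have yV: "y \<in> carrier V" and a: "?a \<in> carrier R" using step cut_closed by auto
    obtain y' where y': "y' \<in> cut (Suc m)" "y = ?a \<odot>\<^bsub>V\<^esub> unit_at m \<oplus>\<^bsub>V\<^esub> y'"
      using cut_step[OF step.prems(3) unit_at_cut[OF order_refl]] by (auto simp: unit_at_apply)
    have "P j y = P j (?a \<odot>\<^bsub>V\<^esub> unit_at m \<oplus>\<^bsub>V\<^esub> y')" using y'(2) by simp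
    also have "\<dots> = P j (?a \<odot>\<^bsub>V\<^esub> unit_at m) \<oplus>\<^bsub>V\<^esub> P j y'"
      by (rule V.linear_endoD(2)[OF P_lin[OF step.prems(2)] V.smult_closed[OF a unit_at_closed] cut_closed[OF y'(1)]])
    also have "P j (?a \<odot>\<^bsub>V\<^esub> unit_at m) = ?a \<odot>\<^bsub>V\<^esub> P j (unit_at m)"
      by (rule V.linear_endoD(3)[OF P_lin[OF step.prems(2)] a unit_at_closed])
    also have "?a \<odot>\<^bsub>V\<^esub> P j (unit_at m) \<oplus>\<^bsub>V\<^esub> P j y' \<in> V.span_mod ?b ?I (shifts ?N)"
      using SM(1)[OF _ step.IH[OF _ step.prems(2) y'(1)]] SM(2)[OF m a] step.prems(1) by simp
    finally show ?case .
  qed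
  have span': "?N \<subseteq> V.span_mod ?b ?I (shifts ?N)"
  proof
    fix v assume "v \<in> ?N"
    then obtain y where y: "y \<in> {..<q} \<rightarrow> cut p" "v = (\<Oplus>\<^bsub>V\<^esub>j\<in>{..<q}. P j (y j))"
      unfolding image_sum_def by blast
    show "v \<in> V.span_mod ?b ?I (shifts ?N)" unfolding y
      by (rule V.span_mod_finsum[OF N' fin bV])
        (use y(1) p_le cut_closed in \<open>auto simp: Pi_iff intro!: span P_closed\<close>)
  qed
  have indep: "d i = \<zero>" if d: "d \<in> ?I \<rightarrow> carrier R" "(\<Oplus>\<^bsub>V\<^esub>i\<in>?I. d i \<odot>\<^bsub>V\<^esub> ?b i) \<in> shifts ?N" "i \<in> ?I" for d i
  proof -
    obtain l t where i: "i = (l, t)" "l < q" "p \<le> t" "t \<le> n * p" using d(3) by auto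
    have dR: "d (j, m) \<in> carrier R" if "j < q" "p \<le> m" "m \<le> n * p" for j m using d(1) that by auto
    let ?z = "\<Oplus>\<^bsub>V\<^esub>i\<in>?I. d i \<odot>\<^bsub>V\<^esub> ?b i"
    let ?g = "\<lambda>(j, m). if l = j then d (j, m) \<odot>\<^bsub>V\<^esub> unit_at m else \<zero>\<^bsub>V\<^esub>"
    have g: "?g i \<in> carrier V" if "i \<in> ?I" for i
      using that V.smult_closed[OF dR unit_at_closed] by (auto simp del: V_simps)
    \<comment> \<open>Applying \<open>Q l\<close> isolates the terms with first index
      \<open>l\<close>, and the coefficient at word \<open>t\<close> is then
      \<open>d (l, t)\<close>. It vanishes because \<open>Q l ?z\<close> lies in
      \<open>cut (n * p + 1)\<close> and \<open>t \<le> n * p\<close>.\<close>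
    have "Q l ?z = (\<Oplus>\<^bsub>V\<^esub>i\<in>?I. Q l (d i \<odot>\<^bsub>V\<^esub> ?b i))"
      by (rule V.linear_endo_finsum[OF Q_lin[OF i(2)] fin])
        (auto simp del: V_simps intro!: V.smult_closed dR P_closed unit_at_closed)
    also have "\<dots> = (\<Oplus>\<^bsub>V\<^esub>i\<in>?I. ?g i)"
    proof (rule V.M.finsum_cong')
      fix i' assume "i' \<in> ?I"
      then obtain j m where i': "i' = (j, m)" "j < q" "p \<le> m" "m \<le> n * p" by auto
      have "Q l (d (j, m) \<odot>\<^bsub>V\<^esub> P j (unit_at m)) = d (j, m) \<odot>\<^bsub>V\<^esub> Q l (P j (unit_at m))"
        using V.linear_endoD(3)[OF Q_lin[OF i(2)] dR[OF i'(2-4)] P_closed[OF i'(2) unit_at_closed]] .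
      then show "Q l (d i' \<odot>\<^bsub>V\<^esub> ?b i') = ?g i'"
        using QP[OF i(2) i'(2) unit_at_cut[OF i'(3)]] V.smult_r_null[OF dR[OF i'(2-4)]] i'(1)
        by (simp del: V_simps split: if_splits)
    qed (use g in blast)+
    finally have "Q l ?z (word_of n t) = (\<Oplus>i\<in>?I. ?g i (word_of n t))"
      using V_finsum_apply[OF fin g] by simp
    also have "\<dots> = (\<Oplus>i'\<in>?I. if i = i' then d i' else \<zero>)"
    proof (rule finsum_cong')
      fix i' assume "i' \<in> ?I"
      then obtain j m where i': "i' = (j, m)" "j < q" "p \<le> m" "m \<le> n * p" by auto
      show "?g i' (word_of n t) = (if i = i' then d i' else \<zero>)"
        using dR[OF i'(2-4)] by (auto simp: i(1) i'(1) unit_at_apply)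
    qed (use d(1) in auto)
    also have "\<dots> = d i" using d(1,3) fin by (intro add.finprod_singleton) (auto simp: Pi_iff)
    finally have "d i = Q l ?z (word_of n t)" ..
    also have "\<dots> = \<zero>" using Q_shifts_image_sum[OF d(2) i(2)] i(4) by (simp add: cut_def del: V_simps)
    finally show ?thesis .
  qed
  have "card (leads ?N - leads (shifts ?N)) = card ?I"
    by (rule card_leads_diff[OF N N' shifts_image_sum_subset
          cut_subset_shifts[OF cut_image_sum] fin b span'])
      (rule indep)
  moreover have "card ?I = q * ((n - 1) * p + 1)"
    using p_le n_pos by (simp add: diff_mult_distrib Suc_diff_le)
  ultimately have "(q * ((n - 1) * p + 1)) mod (n - 1) = 1 mod (n - 1)"
    using card_leads_shifts[OF N cut_image_sum shifts_image_sum_subset] by simp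
  moreover have "q * ((n - 1) * p + 1) = q + (n - 1) * (q * p)" by (simp add: algebra_simps)
  ultimately show ?thesis by (metis mod_mult_self2)
qed

end

end

section \<open>Operators that are right linear on series of large order\<close>

context word_series
begin

text \<open>The filtration by order, natural for the operators: left multiplication preserves it and
  stripping lowers it by one. It is cofinal with \<open>cut\<close>, so bounds can be passed from
  one to the other.\<close>

definition low :: "nat \<Rightarrow> (nat list \<Rightarrow> 'a) set" where
  "low r = {v \<in> carrier V. \<forall>w. length w < r \<longrightarrow> v w = \<zero>}"

lemma low_closed: "v \<in> low r \<Longrightarrow> v \<in> carrier V"
  by (simp add: low_def)

lemma low_mono: "r \<le> r' \<Longrightarrow> low r' \<subseteq> low r"
  by (auto simp: low_def)

lemma low_add: "u \<in> low r \<Longrightarrow> v \<in> low r \<Longrightarrow> u \<oplus>\<^bsub>V\<^esub> v \<in> low r"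
  using V.M.a_closed[of u v] by (simp add: low_def)

lemma low_smult: "c \<in> carrier R \<Longrightarrow> v \<in> low r \<Longrightarrow> c \<odot>\<^bsub>V\<^esub> v \<in> low r"
  using V.smult_closed[of c v] by (simp add: low_def)

lemma low_zero: "\<zero>\<^bsub>V\<^esub> \<in> low r"
  using V.M.zero_closed by (simp add: low_def)

text \<open>Word number \<open>m\<close> has at most \<open>m\<close> letters, so the same number
  can serve as a bound in both filtrations.\<close>

lemma low_subset_cut: "low s \<subseteq> cut s"
proof
  fix v assume v: "v \<in> low s"
  then have "v (word_of n m) = \<zero>" if "m < s" for m
    using le_less_trans[OF length_word_of[of n m] that] by (simp add: low_def)
  with v show "v \<in> cut s" by (simp add: low_def cut_def)
qed

lemma cut_subset_low: obtains p where "cut p \<subseteq> low r"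
proof -
  obtain p where p: "\<And>m. p \<le> m \<Longrightarrow> r \<le> length (word_of n m)"
    by (rule length_word_of_unbounded[OF n_pos, of r]) blast
  have "v w = \<zero>" if v: "v \<in> cut p" and w: "length w < r" for v w
  proof (cases "w \<in> lists {..<n}")
    case True
    then obtain m where m: "w = word_of n m" by (rule word_of_surj)
    with p[of m] w have "m < p" by (cases "p \<le> m") auto
    with v m show ?thesis by (simp add: cut_def)
  qed (rule V_outside[OF cut_closed[OF v]])
  then have "cut p \<subseteq> low r" unfolding low_def using cut_closed by blast
  then show ?thesis by (rule that)
qed

text \<open>The Leavitt localization acts only modulo operators vanishing on some \<open>low r\<close>, so right
  linearity can be required only there.\<close>

definition good :: "((nat list \<Rightarrow> 'a) \<Rightarrow> nat list \<Rightarrow> 'a) \<Rightarrow> bool" where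
  "good \<phi> \<longleftrightarrow> V.linear_endo \<phi> \<and> (\<forall>s. \<exists>r. \<forall>v\<in>low r. \<phi> v \<in> low s)
    \<and> (\<exists>r. \<forall>v\<in>low r. \<forall>i<n. \<phi> (shift i v) = shift i (\<phi> v))"

lemma goodD:
  assumes "good \<phi>"
  shows "V.linear_endo \<phi>"
    "\<exists>r. \<forall>v\<in>low r. \<phi> v \<in> low s"
    "\<exists>r. \<forall>v\<in>low r. \<forall>i<n. \<phi> (shift i v) = shift i (\<phi> v)"
  using assms by (auto simp: good_def)

lemma good_cong:
  assumes "good \<phi>" and eq: "\<And>v. v \<in> carrier V \<Longrightarrow> \<psi> v = \<phi> v"
  shows "good \<psi>"
  unfolding good_def
proof (intro conjI allI)
  show "V.linear_endo \<psi>"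
    using goodD(1)[OF assms(1)] eq unfolding V.linear_endo_def
    by (auto simp del: V_simps simp: V.M.a_closed V.smult_closed Pi_iff)
  show "\<exists>r. \<forall>v\<in>low r. \<psi> v \<in> low s" for s
    using goodD(2)[OF assms(1), of s] eq low_closed by metis
  show "\<exists>r. \<forall>v\<in>low r. \<forall>i<n. \<psi> (shift i v) = shift i (\<psi> v)"
    using goodD(3)[OF assms(1)] eq low_closed shift_closed by metis
qed

lemma good_id: "good (\<lambda>v. v)"
  unfolding good_def V.linear_endo_def by auto

lemma good_zero: "good (\<lambda>v. \<zero>\<^bsub>V\<^esub>)"
  unfolding good_def V.linear_endo_def
  by (auto simp del: V_simps intro: low_zero simp: V.linear_endo_zero[OF shift_linear])

lemma good_comp:
  assumes \<phi>: "good \<phi>" and \<psi>: "good \<psi>"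
  shows "good (\<lambda>v. \<phi> (\<psi> v))"
  unfolding good_def
proof (intro conjI allI)
  note l = goodD(1)[OF \<phi>] goodD(1)[OF \<psi>]
  show "V.linear_endo (\<lambda>v. \<phi> (\<psi> v))"
    unfolding V.linear_endo_def
    by (auto simp del: V_simps simp: V.linear_endoD[OF l(1)] V.linear_endoD[OF l(2)])
  show "\<exists>r. \<forall>v\<in>low r. \<phi> (\<psi> v) \<in> low s" for s
    using goodD(2)[OF \<phi>, of s] goodD(2)[OF \<psi>] by metis
  obtain r1 where r1: "\<And>v i. v \<in> low r1 \<Longrightarrow> i < n \<Longrightarrow> \<phi> (shift i v) = shift i (\<phi> v)"
    using goodD(3)[OF \<phi>] by blast
  obtain r2 where r2: "\<And>v i. v \<in> low r2 \<Longrightarrow> i < n \<Longrightarrow> \<psi> (shift i v) = shift i (\<psi> v)"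
    using goodD(3)[OF \<psi>] by blast
  \<comment> \<open>\<open>\<phi>\<close> commutes with the shifts only at large order, so
    \<open>\<psi> v\<close> must have large order: this is what the continuity condition in
    \<open>good\<close> provides.\<close>
  obtain r3 where r3: "\<And>v. v \<in> low r3 \<Longrightarrow> \<psi> v \<in> low r1" using goodD(2)[OF \<psi>] by blast
  have "low (max r2 r3) \<subseteq> low r2" "low (max r2 r3) \<subseteq> low r3" by (rule low_mono, simp)+
  then show "\<exists>r. \<forall>v\<in>low r. \<forall>i<n. \<phi> (\<psi> (shift i v)) = shift i (\<phi> (\<psi> v))"
    using r1 r2 r3 by (intro exI[of _ "max r2 r3"]) (simp add: subset_iff)
qed

lemma good_add:
  assumes \<phi>: "good \<phi>" and \<psi>: "good \<psi>"
  shows "good (\<lambda>v. \<phi> v \<oplus>\<^bsub>V\<^esub> \<psi> v)"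
  unfolding good_def
proof (intro conjI allI)
  note l = goodD(1)[OF \<phi>] goodD(1)[OF \<psi>]
  show "V.linear_endo (\<lambda>v. \<phi> v \<oplus>\<^bsub>V\<^esub> \<psi> v)"
  proof (rule V.linear_endoI)
    fix u v assume uv: "u \<in> carrier V" "v \<in> carrier V"
    note c = V.linear_endoD(1)[OF l(1) uv(1)] V.linear_endoD(1)[OF l(1) uv(2)]
      V.linear_endoD(1)[OF l(2) uv(1)] V.linear_endoD(1)[OF l(2) uv(2)]
    show "\<phi> (u \<oplus>\<^bsub>V\<^esub> v) \<oplus>\<^bsub>V\<^esub> \<psi> (u \<oplus>\<^bsub>V\<^esub> v) = (\<phi> u \<oplus>\<^bsub>V\<^esub> \<psi> u) \<oplus>\<^bsub>V\<^esub> (\<phi> v \<oplus>\<^bsub>V\<^esub> \<psi> v)"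
      unfolding V.linear_endoD(2)[OF l(1) uv] V.linear_endoD(2)[OF l(2) uv]
      using V_coeff[OF c(1)] V_coeff[OF c(2)] V_coeff[OF c(3)] V_coeff[OF c(4)] by (simp add: a_ac)
  next
    fix a v assume av: "a \<in> carrier R" "v \<in> carrier V"
    show "\<phi> (a \<odot>\<^bsub>V\<^esub> v) \<oplus>\<^bsub>V\<^esub> \<psi> (a \<odot>\<^bsub>V\<^esub> v) = a \<odot>\<^bsub>V\<^esub> (\<phi> v \<oplus>\<^bsub>V\<^esub> \<psi> v)"
      unfolding V.linear_endoD(3)[OF l(1) av] V.linear_endoD(3)[OF l(2) av]
      by (rule V.smult_r_distr[OF av(1) V.linear_endoD(1)[OF l(1) av(2)] V.linear_endoD(1)[OF l(2) av(2)], symmetric])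
  qed (rule V.M.a_closed[OF V.linear_endoD(1)[OF l(1)] V.linear_endoD(1)[OF l(2)]])
  show "\<exists>r. \<forall>v\<in>low r. \<phi> v \<oplus>\<^bsub>V\<^esub> \<psi> v \<in> low s" for s
  proof -
    obtain r1 r2 where "\<forall>v\<in>low r1. \<phi> v \<in> low s" "\<forall>v\<in>low r2. \<psi> v \<in> low s"
      using goodD(2)[OF \<phi>] goodD(2)[OF \<psi>] by blast
    moreover have "low (max r1 r2) \<subseteq> low r1" "low (max r1 r2) \<subseteq> low r2" by (rule low_mono, simp)+
    ultimately show ?thesis
      by (intro exI[of _ "max r1 r2"] ballI low_add) (simp_all add: subset_iff)
  qed
  obtain r1 r2 where r: "\<forall>v\<in>low r1. \<forall>i<n. \<phi> (shift i v) = shift i (\<phi> v)"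
      "\<forall>v\<in>low r2. \<forall>i<n. \<psi> (shift i v) = shift i (\<psi> v)"
    using goodD(3)[OF \<phi>] goodD(3)[OF \<psi>] by blast
  have s: "low (max r1 r2) \<subseteq> low r1" "low (max r1 r2) \<subseteq> low r2" by (rule low_mono, simp)+
  have "\<phi> (shift i v) \<oplus>\<^bsub>V\<^esub> \<psi> (shift i v) = shift i (\<phi> v \<oplus>\<^bsub>V\<^esub> \<psi> v)"
    if v: "v \<in> low (max r1 r2)" and i: "i < n" for i v
  proof -
    have "v \<in> carrier V" using v low_closed by blast
    then have "shift i (\<phi> v \<oplus>\<^bsub>V\<^esub> \<psi> v) = shift i (\<phi> v) \<oplus>\<^bsub>V\<^esub> shift i (\<psi> v)"
      using V.linear_endoD(2)[OF shift_linear[OF i]] V.linear_endoD(1)[OF l(1)] V.linear_endoD(1)[OF l(2)] by blast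
    moreover have "\<phi> (shift i v) = shift i (\<phi> v)" "\<psi> (shift i v) = shift i (\<psi> v)" using r s v i by blast+
    ultimately show ?thesis by simp
  qed
  then show "\<exists>r. \<forall>v\<in>low r. \<forall>i<n. \<phi> (shift i v) \<oplus>\<^bsub>V\<^esub> \<psi> (shift i v) = shift i (\<phi> v \<oplus>\<^bsub>V\<^esub> \<psi> v)"
    by (intro exI[of _ "max r1 r2"] ballI allI impI)
qed

lemma good_smult:
  assumes c: "c \<in> carrier R" and \<phi>: "good \<phi>"
  shows "good (\<lambda>v. c \<odot>\<^bsub>V\<^esub> \<phi> v)"
  unfolding good_def
proof (intro conjI allI)
  note l = goodD(1)[OF \<phi>]
  have "c \<odot>\<^bsub>V\<^esub> (a \<odot>\<^bsub>V\<^esub> v) = a \<odot>\<^bsub>V\<^esub> (c \<odot>\<^bsub>V\<^esub> v)" if "a \<in> carrier R" "v \<in> carrier V" for a v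
    using that c V_coeff[OF that(2)] by (simp add: m_lcomm)
  note comm = this
  show "V.linear_endo (\<lambda>v. c \<odot>\<^bsub>V\<^esub> \<phi> v)"
  proof (rule V.linear_endoI)
    fix u v assume uv: "u \<in> carrier V" "v \<in> carrier V"
    show "c \<odot>\<^bsub>V\<^esub> \<phi> (u \<oplus>\<^bsub>V\<^esub> v) = c \<odot>\<^bsub>V\<^esub> \<phi> u \<oplus>\<^bsub>V\<^esub> c \<odot>\<^bsub>V\<^esub> \<phi> v"
      unfolding V.linear_endoD(2)[OF l uv]
      by (rule V.smult_r_distr[OF c V.linear_endoD(1)[OF l uv(1)] V.linear_endoD(1)[OF l uv(2)]])
  next
    fix a v assume av: "a \<in> carrier R" "v \<in> carrier V"
    show "c \<odot>\<^bsub>V\<^esub> \<phi> (a \<odot>\<^bsub>V\<^esub> v) = a \<odot>\<^bsub>V\<^esub> (c \<odot>\<^bsub>V\<^esub> \<phi> v)"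
      unfolding V.linear_endoD(3)[OF l av] by (rule comm[OF av(1) V.linear_endoD(1)[OF l av(2)]])
  qed (rule V.smult_closed[OF c V.linear_endoD(1)[OF l]])
  show "\<exists>r. \<forall>v\<in>low r. c \<odot>\<^bsub>V\<^esub> \<phi> v \<in> low s" for s
    using goodD(2)[OF \<phi>, of s] low_smult[OF c] by (auto simp del: V_simps)
  obtain r where r: "\<forall>v\<in>low r. \<forall>i<n. \<phi> (shift i v) = shift i (\<phi> v)" using goodD(3)[OF \<phi>] by blast
  have "c \<odot>\<^bsub>V\<^esub> \<phi> (shift i v) = shift i (c \<odot>\<^bsub>V\<^esub> \<phi> v)" if v: "v \<in> low r" and i: "i < n" for i v
    using r v i V.linear_endoD(3)[OF shift_linear[OF i] c V.linear_endoD(1)[OF l low_closed[OF v]]] by simp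
  then show "\<exists>r. \<forall>v\<in>low r. \<forall>i<n. c \<odot>\<^bsub>V\<^esub> \<phi> (shift i v) = shift i (c \<odot>\<^bsub>V\<^esub> \<phi> v)"
    by (intro exI[of _ r] ballI allI impI)
qed

lemma good_closed: "good \<phi> \<Longrightarrow> v \<in> carrier V \<Longrightarrow> \<phi> v \<in> carrier V"
  using V.linear_endoD(1) goodD(1) by blast

lemma good_finsum:
  assumes "finite S" "\<And>w. w \<in> S \<Longrightarrow> good (\<phi> w)"
  shows "good (\<lambda>v. \<Oplus>\<^bsub>V\<^esub>w\<in>S. \<phi> w v)"
  using assms
proof (induction S)
  case empty
  then show ?case using good_zero by simp
next
  case (insert a S)
  have "good (\<lambda>v. \<phi> a v \<oplus>\<^bsub>V\<^esub> (\<Oplus>\<^bsub>V\<^esub>w\<in>S. \<phi> w v))" using insert by (intro good_add) auto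
  then show ?case
    by (rule good_cong) (use insert in \<open>auto simp del: V_simps simp: good_closed intro!: V.M.finsum_insert\<close>)
qed

lemma good_foldr:
  assumes "\<And>a. a \<in> set w \<Longrightarrow> good (op a)"
  shows "good (foldr op w)"
  using assms
proof (induction w)
  case Nil
  show ?case using good_id by (rule good_cong) simp
next
  case (Cons a w)
  have "good (\<lambda>v. op a (foldr op w v))" using Cons good_comp[of "op a" "foldr op w"] by simp
  then show ?case by (simp add: comp_def)
qed

end

section \<open>Representations of monoid algebras\<close>

text \<open>Only the operators live over the field \<open>R\<close>; the algebras and their
  localizations keep coefficients in \<open>K\<close>, which acts on \<open>V\<close> through
  \<open>\<pi>\<close>.\<close>

locale base_change = word_series R n + K: cring K for R (structure) and n and K +
  fixes \<pi>
  assumes \<pi>: "\<pi> \<in> ring_hom K R"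
begin

lemma \<pi>_hom: "ring_hom_cring K R \<pi>"
  by (intro ring_hom_cringI ring_hom_ringI2 K.ring_axioms ring_axioms K.is_cring is_cring \<pi>)

sublocale \<pi>: ring_hom_cring K R \<pi> by (rule \<pi>_hom)

text \<open>The linear extension of the monoid action \<open>\<mu>\<close> to finitely supported
  functions. The sum runs over the support in \<open>K\<close>, although \<open>\<pi>\<close> may
  send some of these coefficients to zero.\<close>

definition act :: "('m, 'q) monoid_scheme \<Rightarrow> ('m \<Rightarrow> (nat list \<Rightarrow> 'a) \<Rightarrow> nat list \<Rightarrow> 'a)
    \<Rightarrow> ('m \<Rightarrow> 'c) \<Rightarrow> (nat list \<Rightarrow> 'a) \<Rightarrow> nat list \<Rightarrow> 'a" where
  "act M \<mu> f v = (\<Oplus>\<^bsub>V\<^esub>w\<in>{w. f w \<noteq> \<zero>\<^bsub>K\<^esub>}. \<pi> (f w) \<odot>\<^bsub>V\<^esub> \<mu> w v)"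

end

locale monoid_action = base_change +
  fixes M :: "('m, 'q) monoid_scheme" and \<mu>
  assumes M_closed: "\<And>u w. u \<in> carrier M \<Longrightarrow> w \<in> carrier M \<Longrightarrow> u \<otimes>\<^bsub>M\<^esub> w \<in> carrier M"
    and M_one: "\<one>\<^bsub>M\<^esub> \<in> carrier M"
    and \<mu>_good: "\<And>w. w \<in> carrier M \<Longrightarrow> good (\<mu> w)"
    and \<mu>_mult: "\<And>u w v. u \<in> carrier M \<Longrightarrow> w \<in> carrier M \<Longrightarrow> v \<in> carrier V \<Longrightarrow> \<mu> (u \<otimes>\<^bsub>M\<^esub> w) v = \<mu> u (\<mu> w v)"
    and \<mu>_one: "\<And>v. v \<in> carrier V \<Longrightarrow> \<mu> \<one>\<^bsub>M\<^esub> v = v"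
begin

abbreviation (input) "KM \<equiv> monoid_algebra K M"

lemma KM_closed: "f \<in> carrier KM \<Longrightarrow> f w \<in> carrier K"
  using K.coeff_functions_closed[of f M w] by (simp add: carrier_monoid_algebra)

lemma KM_finite: "f \<in> carrier KM \<Longrightarrow> finite {w. f w \<noteq> \<zero>\<^bsub>K\<^esub>}"
  by (simp add: carrier_monoid_algebra)

lemma KM_supp: "f \<in> carrier KM \<Longrightarrow> {w. f w \<noteq> \<zero>\<^bsub>K\<^esub>} \<subseteq> carrier M"
  by (auto simp: carrier_monoid_algebra coeff_functions_def)

lemma \<mu>_closed: "w \<in> carrier M \<Longrightarrow> v \<in> carrier V \<Longrightarrow> \<mu> w v \<in> carrier V"
  using good_closed[OF \<mu>_good] .

lemma term_closed:
  "f \<in> carrier KM \<Longrightarrow> w \<in> carrier M \<Longrightarrow> v \<in> carrier V \<Longrightarrow> \<pi> (f w) \<odot>\<^bsub>V\<^esub> \<mu> w v \<in> carrier V"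
  by (intro V.smult_closed \<pi>.hom_closed KM_closed \<mu>_closed)

text \<open>Terms outside the support vanish, so sums belonging to different supports can be brought
  over one common finite set.\<close>

lemma act_eq:
  assumes f: "f \<in> carrier KM" and v: "v \<in> carrier V"
    and S: "finite S" "S \<subseteq> carrier M" "{w. f w \<noteq> \<zero>\<^bsub>K\<^esub>} \<subseteq> S"
  shows "act M \<mu> f v = (\<Oplus>\<^bsub>V\<^esub>w\<in>S. \<pi> (f w) \<odot>\<^bsub>V\<^esub> \<mu> w v)"
  unfolding act_def
proof (rule V.M.add.finprod_mono_neutral_cong_left[OF S(1,3)])
  fix w assume w: "w \<in> S - {w. f w \<noteq> \<zero>\<^bsub>K\<^esub>}"
  then have "f w = \<zero>\<^bsub>K\<^esub>" by simp
  then show "\<pi> (f w) \<odot>\<^bsub>V\<^esub> \<mu> w v = \<zero>\<^bsub>V\<^esub>"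
    using w S(2) v V.smult_l_null[OF \<mu>_closed[of w v]] by (auto simp del: V_simps)
qed (use S(2) term_closed[OF f _ v] in \<open>auto simp del: V_simps\<close>)

lemma act_good: "f \<in> carrier KM \<Longrightarrow> good (act M \<mu> f)"
proof -
  assume f: "f \<in> carrier KM"
  have "good (\<lambda>v. \<Oplus>\<^bsub>V\<^esub>w\<in>{w. f w \<noteq> \<zero>\<^bsub>K\<^esub>}. \<pi> (f w) \<odot>\<^bsub>V\<^esub> \<mu> w v)"
    using KM_finite[OF f] KM_supp[OF f] KM_closed[OF f] \<mu>_good
    by (intro good_finsum good_smult) auto
  then show "good (act M \<mu> f)" by (rule good_cong) (simp only: act_def)
qed

lemma act_closed: "f \<in> carrier KM \<Longrightarrow> v \<in> carrier V \<Longrightarrow> act M \<mu> f v \<in> carrier V"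
  using good_closed[OF act_good] .

lemma act_add:
  assumes f: "f \<in> carrier KM" and g: "g \<in> carrier KM" and v: "v \<in> carrier V"
  shows "act M \<mu> (f \<oplus>\<^bsub>KM\<^esub> g) v = act M \<mu> f v \<oplus>\<^bsub>V\<^esub> act M \<mu> g v"
proof -
  interpret A: Module.module K KM by (rule K.monoid_algebra_module)
  have add: "f \<oplus>\<^bsub>KM\<^esub> g = (\<lambda>w. f w \<oplus>\<^bsub>K\<^esub> g w)" by (simp add: monoid_algebra_def)
  let ?S = "{w. f w \<noteq> \<zero>\<^bsub>K\<^esub>} \<union> {w. g w \<noteq> \<zero>\<^bsub>K\<^esub>}"
  have S: "finite ?S" "?S \<subseteq> carrier M" using KM_finite KM_supp f g by auto
  have "act M \<mu> (f \<oplus>\<^bsub>KM\<^esub> g) v = (\<Oplus>\<^bsub>V\<^esub>w\<in>?S. \<pi> ((f \<oplus>\<^bsub>KM\<^esub> g) w) \<odot>\<^bsub>V\<^esub> \<mu> w v)"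
    by (rule act_eq[OF A.M.a_closed[OF f g] v S]) (auto simp: add)
  also have "\<dots> = (\<Oplus>\<^bsub>V\<^esub>w\<in>?S. \<pi> (f w) \<odot>\<^bsub>V\<^esub> \<mu> w v \<oplus>\<^bsub>V\<^esub> \<pi> (g w) \<odot>\<^bsub>V\<^esub> \<mu> w v)"
  proof (rule V.M.finsum_cong')
    fix w assume "w \<in> ?S"
    then have w: "w \<in> carrier M" using S by blast
    show "\<pi> ((f \<oplus>\<^bsub>KM\<^esub> g) w) \<odot>\<^bsub>V\<^esub> \<mu> w v = \<pi> (f w) \<odot>\<^bsub>V\<^esub> \<mu> w v \<oplus>\<^bsub>V\<^esub> \<pi> (g w) \<odot>\<^bsub>V\<^esub> \<mu> w v"
      using V.smult_l_distr[OF \<pi>.hom_closed[OF KM_closed[OF f]] \<pi>.hom_closed[OF KM_closed[OF g]] \<mu>_closed[OF w v]]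
        \<pi>.hom_add[OF KM_closed[OF f] KM_closed[OF g]] by (simp add: add del: V_simps)
  qed (use S term_closed[OF f _ v] term_closed[OF g _ v] in \<open>auto simp del: V_simps\<close>)
  also have "\<dots> = act M \<mu> f v \<oplus>\<^bsub>V\<^esub> act M \<mu> g v"
    unfolding act_eq[OF f v S Un_upper1] act_eq[OF g v S Un_upper2]
    using S term_closed[OF f _ v] term_closed[OF g _ v]
    by (intro V.M.finsum_addf) (auto simp del: V_simps)
  finally show ?thesis .
qed

lemma act_smult:
  assumes c: "c \<in> carrier K" and f: "f \<in> carrier KM" and v: "v \<in> carrier V"
  shows "act M \<mu> (c \<odot>\<^bsub>KM\<^esub> f) v = \<pi> c \<odot>\<^bsub>V\<^esub> act M \<mu> f v"
proof -
  interpret A: Module.module K KM by (rule K.monoid_algebra_module)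
  have sm: "c \<odot>\<^bsub>KM\<^esub> f = (\<lambda>w. c \<otimes>\<^bsub>K\<^esub> f w)" by (simp add: monoid_algebra_def)
  let ?S = "{w. f w \<noteq> \<zero>\<^bsub>K\<^esub>}"
  note S = KM_finite[OF f] KM_supp[OF f]
  have "act M \<mu> (c \<odot>\<^bsub>KM\<^esub> f) v = (\<Oplus>\<^bsub>V\<^esub>w\<in>?S. \<pi> ((c \<odot>\<^bsub>KM\<^esub> f) w) \<odot>\<^bsub>V\<^esub> \<mu> w v)"
    by (rule act_eq[OF A.smult_closed[OF c f] v S]) (auto simp: sm c)
  also have "\<dots> = (\<Oplus>\<^bsub>V\<^esub>w\<in>?S. \<pi> c \<odot>\<^bsub>V\<^esub> (\<pi> (f w) \<odot>\<^bsub>V\<^esub> \<mu> w v))"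
  proof (rule V.M.finsum_cong')
    fix w assume "w \<in> ?S"
    then have w: "w \<in> carrier M" using S by blast
    show "\<pi> ((c \<odot>\<^bsub>KM\<^esub> f) w) \<odot>\<^bsub>V\<^esub> \<mu> w v = \<pi> c \<odot>\<^bsub>V\<^esub> (\<pi> (f w) \<odot>\<^bsub>V\<^esub> \<mu> w v)"
      using V.smult_assoc1[OF \<pi>.hom_closed[OF c] \<pi>.hom_closed[OF KM_closed[OF f]] \<mu>_closed[OF w v]]
        \<pi>.hom_mult[OF c KM_closed[OF f]] by (simp add: sm del: V_simps)
  qed (use S c term_closed[OF f _ v] in \<open>auto simp del: V_simps\<close>)
  also have "\<dots> = \<pi> c \<odot>\<^bsub>V\<^esub> act M \<mu> f v"
    unfolding act_def using S c term_closed[OF f _ v]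
    by (intro V.finsum_smult_ldistr[symmetric]) (auto simp del: V_simps)
  finally show ?thesis .
qed

lemma act_basis_elt:
  assumes w: "w \<in> carrier M" and v: "v \<in> carrier V"
  shows "act M \<mu> (basis_elt K w) v = \<mu> w v"
proof -
  have b: "basis_elt K w \<in> carrier KM" using K.basis_elt_closed[OF w] .
  have "act M \<mu> (basis_elt K w) v = (\<Oplus>\<^bsub>V\<^esub>u\<in>{w}. \<pi> (basis_elt K w u) \<odot>\<^bsub>V\<^esub> \<mu> u v)"
    by (rule act_eq[OF b v]) (auto simp: basis_elt_def w split: if_splits)
  also have "\<dots> = \<pi> (basis_elt K w w) \<odot>\<^bsub>V\<^esub> \<mu> w v"
    by (subst V.M.finsum_insert) (use term_closed[OF b w v] in \<open>auto simp del: V_simps\<close>)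
  also have "\<dots> = \<mu> w v" using V.smult_one[OF \<mu>_closed[OF w v]] by (simp add: basis_elt_def del: V_simps)
  finally show ?thesis .
qed

lemma act_one: "v \<in> carrier V \<Longrightarrow> act M \<mu> \<one>\<^bsub>KM\<^esub> v = v"
  using act_basis_elt[OF M_one] \<mu>_one by (simp add: basis_elt_def monoid_algebra_def)

text \<open>The coefficients of the product group the pairs of support elements by their product in
  \<open>M\<close>. The resulting double sum over all pairs factors because the
  \<open>\<mu> a\<close> are linear and \<open>\<mu>\<close> is multiplicative.\<close>

lemma act_mult:
  assumes f: "f \<in> carrier KM" and g: "g \<in> carrier KM" and v: "v \<in> carrier V"
  shows "act M \<mu> (f \<otimes>\<^bsub>KM\<^esub> g) v = act M \<mu> f (act M \<mu> g v)"
proof -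
  let ?A = "{w. f w \<noteq> \<zero>\<^bsub>K\<^esub>}" and ?B = "{w. g w \<noteq> \<zero>\<^bsub>K\<^esub>}"
  let ?m = "\<lambda>(a, b). a \<otimes>\<^bsub>M\<^esub> b"
  let ?S = "?m ` (?A \<times> ?B)"
  let ?F = "\<lambda>w. {(a, b). a \<in> carrier M \<and> b \<in> carrier M \<and> a \<otimes>\<^bsub>M\<^esub> b = w \<and> f a \<noteq> \<zero>\<^bsub>K\<^esub> \<and> g b \<noteq> \<zero>\<^bsub>K\<^esub>}"
  let ?t = "\<lambda>(a, b). (\<pi> (f a) \<otimes> \<pi> (g b)) \<odot>\<^bsub>V\<^esub> \<mu> a (\<mu> b v)"
  note A = KM_finite[OF f] KM_supp[OF f] and B = KM_finite[OF g] KM_supp[OF g]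
  note fc = KM_closed[OF f] and gc = KM_closed[OF g]
  have fg: "f \<otimes>\<^bsub>KM\<^esub> g \<in> carrier KM" by (rule K.monoid_algebra_mult_closed[OF M_closed f g])
  have F: "?F w \<subseteq> ?A \<times> ?B" for w by auto
  have finF: "finite (?F w)" for w by (rule finite_subset[OF F]) (use A B in auto)
  have S: "finite ?S" "?S \<subseteq> carrier M" using A B M_closed by auto
  have fgw: "(f \<otimes>\<^bsub>KM\<^esub> g) w = finsum K (\<lambda>(a, b). f a \<otimes>\<^bsub>K\<^esub> g b) (?F w)" for w
    by (simp only: monoid_algebra_def mult_convolution_algebra)
  have supp: "{w. (f \<otimes>\<^bsub>KM\<^esub> g) w \<noteq> \<zero>\<^bsub>K\<^esub>} \<subseteq> ?S"
  proof (rule subsetI, rule ccontr)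
    fix w assume w: "w \<in> {w. (f \<otimes>\<^bsub>KM\<^esub> g) w \<noteq> \<zero>\<^bsub>K\<^esub>}" "w \<notin> ?S"
    then have "?F w = {}" by force
    then have "(f \<otimes>\<^bsub>KM\<^esub> g) w = \<zero>\<^bsub>K\<^esub>" unfolding fgw by (simp del: Collect_empty_eq)
    with w show False by simp
  qed
  have tc: "?t x \<in> carrier V" if xAB: "x \<in> ?A \<times> ?B" for x
  proof -
    obtain a b where x: "x = (a, b)" "a \<in> carrier M" "b \<in> carrier M" using xAB A(2) B(2) by (cases x) auto
    have "(\<pi> (f a) \<otimes> \<pi> (g b)) \<odot>\<^bsub>V\<^esub> \<mu> a (\<mu> b v) \<in> carrier V"
      by (intro V.smult_closed m_closed \<pi>.hom_closed fc gc \<mu>_closed x v)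
    then show ?thesis unfolding x by simp
  qed
  have "act M \<mu> (f \<otimes>\<^bsub>KM\<^esub> g) v = (\<Oplus>\<^bsub>V\<^esub>w\<in>?S. \<pi> ((f \<otimes>\<^bsub>KM\<^esub> g) w) \<odot>\<^bsub>V\<^esub> \<mu> w v)"
    by (rule act_eq[OF fg v S supp])
  also have "\<dots> = (\<Oplus>\<^bsub>V\<^esub>w\<in>?S. finsum V ?t (?F w))"
  proof (rule V.M.finsum_cong')
    fix w assume "w \<in> ?S"
    then have w: "w \<in> carrier M" using S by blast
    let ?h = "\<lambda>x. \<pi> (case x of (a, b) \<Rightarrow> f a \<otimes>\<^bsub>K\<^esub> g b)"
    have "\<pi> ((f \<otimes>\<^bsub>KM\<^esub> g) w) = finsum R (\<pi> \<circ> (\<lambda>(a, b). f a \<otimes>\<^bsub>K\<^esub> g b)) (?F w)"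
      unfolding fgw by (rule \<pi>.hom_finsum) (use fc gc in auto)
    also have "\<dots> = finsum R ?h (?F w)" by (simp only: comp_def)
    finally have "\<pi> ((f \<otimes>\<^bsub>KM\<^esub> g) w) \<odot>\<^bsub>V\<^esub> \<mu> w v = finsum R ?h (?F w) \<odot>\<^bsub>V\<^esub> \<mu> w v" by (rule arg_cong)
    also have "\<dots> = finsum V (\<lambda>x. ?h x \<odot>\<^bsub>V\<^esub> \<mu> w v) (?F w)"
      by (rule V.finsum_smult_rdistr[OF finF _ \<mu>_closed[OF w v]]) (use fc gc in auto)
    also have "\<dots> = finsum V ?t (?F w)"
      by (rule V.M.finsum_cong') (use tc[OF subsetD[OF F]] in \<open>auto simp del: V_simps simp: fc gc \<mu>_mult v\<close>)
    finally show "\<pi> ((f \<otimes>\<^bsub>KM\<^esub> g) w) \<odot>\<^bsub>V\<^esub> \<mu> w v = finsum V ?t (?F w)" .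
  next
    show "(\<lambda>w. finsum V ?t (?F w)) \<in> ?S \<rightarrow> carrier V"
      by (intro funcsetI V.M.finsum_closed) (rule tc[OF subsetD[OF F]])
  qed simp
  \<comment> \<open>The fibres of the multiplication of \<open>M\<close> partition the product of
    the two supports.\<close>
  also have "\<dots> = finsum V ?t (\<Union>w\<in>?S. ?F w)"
    by (rule V.M.add.finprod_UN_disjoint[symmetric, OF S(1) finF])
      (use tc[OF subsetD[OF F]] in \<open>auto simp: pairwise_def disjnt_def\<close>)
  also have "(\<Union>w\<in>?S. ?F w) = ?A \<times> ?B" using A(2) B(2) by force
  also have "finsum V ?t (?A \<times> ?B) = (\<Oplus>\<^bsub>V\<^esub>a\<in>?A. \<Oplus>\<^bsub>V\<^esub>b\<in>?B. (\<pi> (f a) \<otimes> \<pi> (g b)) \<odot>\<^bsub>V\<^esub> \<mu> a (\<mu> b v))"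
    by (rule V.M.finsum_cartesian_product[symmetric, OF A(1) B(1)]) (use tc in auto)
  also have "\<dots> = (\<Oplus>\<^bsub>V\<^esub>a\<in>?A. \<pi> (f a) \<odot>\<^bsub>V\<^esub> \<mu> a (act M \<mu> g v))"
  proof (rule V.M.finsum_cong')
    fix a assume "a \<in> ?A"
    then have a: "a \<in> carrier M" using A by blast
    have b: "b \<in> carrier M" if "b \<in> ?B" for b using that B by blast
    note l = goodD(1)[OF \<mu>_good[OF a]]
    have "\<mu> a (act M \<mu> g v) = (\<Oplus>\<^bsub>V\<^esub>b\<in>?B. \<mu> a (\<pi> (g b) \<odot>\<^bsub>V\<^esub> \<mu> b v))"
      unfolding act_def by (rule V.linear_endo_finsum[OF l B(1)]) (rule term_closed[OF g b v])
    then have "\<pi> (f a) \<odot>\<^bsub>V\<^esub> \<mu> a (act M \<mu> g v) = (\<Oplus>\<^bsub>V\<^esub>b\<in>?B. \<pi> (f a) \<odot>\<^bsub>V\<^esub> \<mu> a (\<pi> (g b) \<odot>\<^bsub>V\<^esub> \<mu> b v))"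
      using V.finsum_smult_ldistr[OF B(1) \<pi>.hom_closed[OF fc], of "\<lambda>b. \<mu> a (\<pi> (g b) \<odot>\<^bsub>V\<^esub> \<mu> b v)" a]
        \<mu>_closed[OF a term_closed[OF g b v]] by (simp del: V_simps add: Pi_iff)
    also have "\<dots> = (\<Oplus>\<^bsub>V\<^esub>b\<in>?B. (\<pi> (f a) \<otimes> \<pi> (g b)) \<odot>\<^bsub>V\<^esub> \<mu> a (\<mu> b v))"
    proof (rule V.M.finsum_cong')
      fix c assume "c \<in> ?B"
      then have c: "c \<in> carrier M" by (rule b)
      show "\<pi> (f a) \<odot>\<^bsub>V\<^esub> \<mu> a (\<pi> (g c) \<odot>\<^bsub>V\<^esub> \<mu> c v) = (\<pi> (f a) \<otimes> \<pi> (g c)) \<odot>\<^bsub>V\<^esub> \<mu> a (\<mu> c v)"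
        unfolding V.linear_endoD(3)[OF l \<pi>.hom_closed[OF gc] \<mu>_closed[OF c v]]
        by (rule V.smult_assoc1[symmetric]) (intro \<pi>.hom_closed fc gc \<mu>_closed a c v)+
    next
      show "(\<lambda>c. (\<pi> (f a) \<otimes> \<pi> (g c)) \<odot>\<^bsub>V\<^esub> \<mu> a (\<mu> c v)) \<in> ?B \<rightarrow> carrier V"
        by (intro funcsetI V.smult_closed m_closed \<pi>.hom_closed fc gc \<mu>_closed a b v)
    qed simp
    finally show "(\<Oplus>\<^bsub>V\<^esub>b\<in>?B. (\<pi> (f a) \<otimes> \<pi> (g b)) \<odot>\<^bsub>V\<^esub> \<mu> a (\<mu> b v)) = \<pi> (f a) \<odot>\<^bsub>V\<^esub> \<mu> a (act M \<mu> g v)"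
      by (rule sym)
  next
    show "(\<lambda>a. \<pi> (f a) \<odot>\<^bsub>V\<^esub> \<mu> a (act M \<mu> g v)) \<in> ?A \<rightarrow> carrier V"
      using A(2) term_closed[OF f _ act_closed[OF g v]] by blast
  qed simp
  also have "\<dots> = act M \<mu> f (act M \<mu> g v)" by (simp only: act_def)
  finally show ?thesis .
qed

end

section \<open>The Leavitt localization\<close>

text \<open>A left linear map out of T is right multiplication by the row \<open>a\<close>, the
  image of 1, and \<open>b\<close> collects the preimages of the standard basis vectors. So an
  isomorphism amounts to an invertible 1 by q matrix.\<close>

lemma free_modules_iso_1_iff:
  assumes "ring T"
  shows "free_modules_iso T 1 q \<longleftrightarrow> (\<exists>a b. a \<in> {..<q} \<rightarrow> carrier T \<and> b \<in> {..<q} \<rightarrow> carrier T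
    \<and> (\<forall>i<q. \<forall>j<q. b i \<otimes>\<^bsub>T\<^esub> a j = (if i = j then \<one>\<^bsub>T\<^esub> else \<zero>\<^bsub>T\<^esub>))
    \<and> (\<Oplus>\<^bsub>T\<^esub>i\<in>{..<q}. a i \<otimes>\<^bsub>T\<^esub> b i) = \<one>\<^bsub>T\<^esub>)"
proof -
  interpret T: ring T by fact
  let ?M = "free_module T 1" and ?N = "free_module T q"
  let ?u = "\<lambda>t. \<lambda>i\<in>{..<1::nat}. t"
  have u: "?u t \<in> carrier ?M" if "t \<in> carrier T" for t
    using that by (simp add: free_module_def)
  have uc: "f = ?u (f 0)" "f 0 \<in> carrier T" if "f \<in> carrier ?M" for f
    using that by (auto simp: free_module_def PiE_iff extensional_def fun_eq_iff)
  show ?thesis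
  proof
    assume "free_modules_iso T 1 q"
    then obtain h where bij: "bij_betw h (carrier ?M) (carrier ?N)"
      and smult: "\<And>t f. t \<in> carrier T \<Longrightarrow> f \<in> carrier ?M \<Longrightarrow> h (t \<odot>\<^bsub>?M\<^esub> f) = t \<odot>\<^bsub>?N\<^esub> h f"
      unfolding free_modules_iso_def module_iso_def by blast
    define a where "a = h (?u \<one>\<^bsub>T\<^esub>)"
    have aN: "a \<in> carrier ?N" unfolding a_def by (rule bij_betwE[OF bij, rule_format, OF u]) simp
    then have a: "a i \<in> carrier T" if "i < q" for i using that by (auto simp: free_module_def)
    have hu: "h (?u t) = (\<lambda>i\<in>{..<q}. t \<otimes>\<^bsub>T\<^esub> a i)" if t: "t \<in> carrier T" for t
    proof -
      have "?u t = t \<odot>\<^bsub>?M\<^esub> ?u \<one>\<^bsub>T\<^esub>" using t by (auto simp: free_module_def)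
      then have "h (?u t) = t \<odot>\<^bsub>?N\<^esub> a" unfolding a_def using smult[OF t u] by simp
      then show ?thesis by (simp add: free_module_def)
    qed
    have "\<exists>t\<in>carrier T. h (?u t) = e" if e: "e \<in> carrier ?N" for e
    proof -
      have "e \<in> h ` carrier ?M" using e by (simp only: bij_betw_imp_surj_on[OF bij])
      then obtain f where f: "f \<in> carrier ?M" "h f = e" by (elim imageE) simp
      have "h (?u (f 0)) = e" unfolding uc(1)[OF f(1), symmetric] by (rule f(2))
      with uc(2)[OF f(1)] show ?thesis by blast
    qed
    moreover have "(\<lambda>j\<in>{..<q}. if i = j then \<one>\<^bsub>T\<^esub> else \<zero>\<^bsub>T\<^esub>) \<in> carrier ?N" for i
      by (auto simp: free_module_def)
    ultimately have "\<exists>b. \<forall>i. b i \<in> carrier T \<and> h (?u (b i)) = (\<lambda>j\<in>{..<q}. if i = j then \<one>\<^bsub>T\<^esub> else \<zero>\<^bsub>T\<^esub>)"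
      by (intro choice allI) blast
    then obtain b where b: "\<And>i. b i \<in> carrier T"
      and hb: "\<And>i. h (?u (b i)) = (\<lambda>j\<in>{..<q}. if i = j then \<one>\<^bsub>T\<^esub> else \<zero>\<^bsub>T\<^esub>)" by blast
    have ba: "b i \<otimes>\<^bsub>T\<^esub> a j = (if i = j then \<one>\<^bsub>T\<^esub> else \<zero>\<^bsub>T\<^esub>)" if "j < q" for i j
      using fun_cong[OF trans[OF hu[OF b[of i], symmetric] hb[of i]], of j] that by simp
    let ?s = "\<Oplus>\<^bsub>T\<^esub>i\<in>{..<q}. a i \<otimes>\<^bsub>T\<^esub> b i"
    have s: "?s \<in> carrier T" using a b by (intro T.finsum_closed) auto
    \<comment> \<open>These equations say that \<open>?s\<close> and 1 have the same image under
      \<open>h\<close>; injectivity then gives the second matrix relation.\<close>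
    have "?s \<otimes>\<^bsub>T\<^esub> a j = a j" if j: "j < q" for j
    proof -
      have "?s \<otimes>\<^bsub>T\<^esub> a j = (\<Oplus>\<^bsub>T\<^esub>i\<in>{..<q}. a i \<otimes>\<^bsub>T\<^esub> b i \<otimes>\<^bsub>T\<^esub> a j)"
        using a b j by (intro T.finsum_ldistr) auto
      also have "\<dots> = (\<Oplus>\<^bsub>T\<^esub>i\<in>{..<q}. if j = i then a i else \<zero>\<^bsub>T\<^esub>)"
        using a b j by (intro T.finsum_cong') (auto simp: T.m_assoc ba)
      also have "\<dots> = a j" using a j by (intro T.add.finprod_singleton) auto
      finally show ?thesis .
    qed
    then have "h (?u ?s) = h (?u \<one>\<^bsub>T\<^esub>)"
      unfolding hu[OF s] hu[OF T.one_closed] using a by (auto simp: restrict_def)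
    then have "?u ?s = ?u \<one>\<^bsub>T\<^esub>"
      by (rule inj_onD[OF bij_betw_imp_inj_on[OF bij] _ u[OF s] u[OF T.one_closed]])
    from fun_cong[OF this, of 0] have "?s = \<one>\<^bsub>T\<^esub>" by simp
    with ba show "\<exists>a b. a \<in> {..<q} \<rightarrow> carrier T \<and> b \<in> {..<q} \<rightarrow> carrier T
      \<and> (\<forall>i<q. \<forall>j<q. b i \<otimes>\<^bsub>T\<^esub> a j = (if i = j then \<one>\<^bsub>T\<^esub> else \<zero>\<^bsub>T\<^esub>))
      \<and> (\<Oplus>\<^bsub>T\<^esub>i\<in>{..<q}. a i \<otimes>\<^bsub>T\<^esub> b i) = \<one>\<^bsub>T\<^esub>"
      using a b by (intro exI[of _ a] exI[of _ b] conjI) simp_all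
  next
    assume "\<exists>a b. a \<in> {..<q} \<rightarrow> carrier T \<and> b \<in> {..<q} \<rightarrow> carrier T
      \<and> (\<forall>i<q. \<forall>j<q. b i \<otimes>\<^bsub>T\<^esub> a j = (if i = j then \<one>\<^bsub>T\<^esub> else \<zero>\<^bsub>T\<^esub>))
      \<and> (\<Oplus>\<^bsub>T\<^esub>i\<in>{..<q}. a i \<otimes>\<^bsub>T\<^esub> b i) = \<one>\<^bsub>T\<^esub>"
    then obtain a b where "a \<in> {..<q} \<rightarrow> carrier T" "b \<in> {..<q} \<rightarrow> carrier T"
      and ba: "\<And>i j. i < q \<Longrightarrow> j < q \<Longrightarrow> b i \<otimes>\<^bsub>T\<^esub> a j = (if i = j then \<one>\<^bsub>T\<^esub> else \<zero>\<^bsub>T\<^esub>)"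
      and s: "(\<Oplus>\<^bsub>T\<^esub>i\<in>{..<q}. a i \<otimes>\<^bsub>T\<^esub> b i) = \<one>\<^bsub>T\<^esub>" by blast
    then have a: "a i \<in> carrier T" and b: "b i \<in> carrier T" if "i < q" for i
      using that by auto
    \<comment> \<open>Right multiplication by the row and, in \<open>k\<close>, by the column; the
      two matrix relations make them mutually inverse.\<close>
    define h where "h f = (\<lambda>i\<in>{..<q}. f 0 \<otimes>\<^bsub>T\<^esub> a i)" for f :: "nat \<Rightarrow> 'a"
    define k where "k g = ?u (\<Oplus>\<^bsub>T\<^esub>i\<in>{..<q}. g i \<otimes>\<^bsub>T\<^esub> b i)" for g
    have "bij_betw h (carrier ?M) (carrier ?N)"
    proof (rule bij_betw_byWitness[of _ k])
      show "\<forall>f\<in>carrier ?M. k (h f) = f"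
      proof
        fix f assume f: "f \<in> carrier ?M"
        have "(\<Oplus>\<^bsub>T\<^esub>i\<in>{..<q}. h f i \<otimes>\<^bsub>T\<^esub> b i) = (\<Oplus>\<^bsub>T\<^esub>i\<in>{..<q}. f 0 \<otimes>\<^bsub>T\<^esub> (a i \<otimes>\<^bsub>T\<^esub> b i))"
          using uc(2)[OF f] a b by (intro T.finsum_cong') (auto simp: h_def T.m_assoc)
        also have "\<dots> = f 0 \<otimes>\<^bsub>T\<^esub> (\<Oplus>\<^bsub>T\<^esub>i\<in>{..<q}. a i \<otimes>\<^bsub>T\<^esub> b i)"
          using uc(2)[OF f] a b by (intro T.finsum_rdistr[symmetric]) auto
        finally show "k (h f) = f" unfolding k_def s using uc[OF f] by simp
      qed
      show "\<forall>g\<in>carrier ?N. h (k g) = g"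
      proof
        fix g assume gN: "g \<in> carrier ?N"
        then have g: "g i \<in> carrier T" if "i < q" for i using that by (auto simp: free_module_def)
        let ?s = "\<Oplus>\<^bsub>T\<^esub>i\<in>{..<q}. g i \<otimes>\<^bsub>T\<^esub> b i"
        have "?s \<otimes>\<^bsub>T\<^esub> a j = g j" if j: "j < q" for j
        proof -
          have "?s \<otimes>\<^bsub>T\<^esub> a j = (\<Oplus>\<^bsub>T\<^esub>i\<in>{..<q}. g i \<otimes>\<^bsub>T\<^esub> b i \<otimes>\<^bsub>T\<^esub> a j)"
            using a b j g by (intro T.finsum_ldistr) auto
          also have "\<dots> = (\<Oplus>\<^bsub>T\<^esub>i\<in>{..<q}. if j = i then g i else \<zero>\<^bsub>T\<^esub>)"
            using a b j g by (intro T.finsum_cong') (auto simp: T.m_assoc ba)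
          also have "\<dots> = g j" using g j by (intro T.add.finprod_singleton) auto
          finally show ?thesis .
        qed
        then show "h (k g) = g"
          using gN by (auto simp: h_def k_def free_module_def PiE_iff extensional_def fun_eq_iff)
      qed
      show "h ` carrier ?M \<subseteq> carrier ?N" using uc(2) a by (auto simp: h_def free_module_def)
      show "k ` carrier ?N \<subseteq> carrier ?M"
        unfolding k_def using b by (intro image_subsetI u T.finsum_closed) (auto simp: free_module_def)
    qed
    moreover have "h (f \<oplus>\<^bsub>?M\<^esub> g) = h f \<oplus>\<^bsub>?N\<^esub> h g" if "f \<in> carrier ?M" "g \<in> carrier ?M" for f g
      using uc(2)[OF that(1)] uc(2)[OF that(2)] a by (auto simp: h_def free_module_def T.l_distr)
    moreover have "h (t \<odot>\<^bsub>?M\<^esub> f) = t \<odot>\<^bsub>?N\<^esub> h f" if "t \<in> carrier T" "f \<in> carrier ?M" for t f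
      using uc(2)[OF that(2)] that(1) a by (auto simp: h_def free_module_def T.m_assoc)
    ultimately show "free_modules_iso T 1 q"
      unfolding free_modules_iso_def module_iso_def by (intro notI, drule_tac equals0D[of _ h]) simp
  qed
qed

section \<open>Left multiplication and the stars as operators on series\<close>

context word_series
begin

lemma lmul_closed:
  "\<gamma> \<in> carrier V \<Longrightarrow> v \<in> carrier V \<Longrightarrow> conv R \<gamma> v \<in> carrier V"
  unfolding carrier_V by (rule conv_in_coeff_functions)

lemma conv_shift:
  assumes "\<gamma> \<in> carrier V" "v \<in> carrier V" "i < n"
  shows "conv R \<gamma> (shift i v) = shift i (conv R \<gamma> v)"
  unfolding shift_def using assms by (auto simp: fun_eq_iff conv_assoc basis_elt_def)

lemma conv_low:
  assumes "\<gamma> \<in> carrier V" "v \<in> low s"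
  shows "conv R \<gamma> v \<in> low s"
proof -
  have "conv R \<gamma> v w = \<zero>" if "\<And>w. \<gamma> w \<in> carrier R" "\<And>w. length w < s \<Longrightarrow> v w = \<zero>" "length w < s" for w \<gamma>
    using that by (induction w arbitrary: \<gamma>) auto
  moreover have "v \<in> carrier V" using assms low_closed by blast
  ultimately show ?thesis using assms lmul_closed by (simp add: low_def)
qed

lemma good_conv:
  assumes \<gamma>: "\<gamma> \<in> carrier V"
  shows "good (conv R \<gamma>)"
  unfolding good_def
proof (intro conjI allI)
  show "V.linear_endo (conv R \<gamma>)"
  proof (rule V.linear_endoI)
    fix u v assume "u \<in> carrier V" "v \<in> carrier V"
    then show "conv R \<gamma> (u \<oplus>\<^bsub>V\<^esub> v) = conv R \<gamma> u \<oplus>\<^bsub>V\<^esub> conv R \<gamma> v"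
      using \<gamma> by (simp add: fun_eq_iff conv_add_right)
  next
    fix c v assume "c \<in> carrier R" "v \<in> carrier V"
    then show "conv R \<gamma> (c \<odot>\<^bsub>V\<^esub> v) = c \<odot>\<^bsub>V\<^esub> conv R \<gamma> v"
      using \<gamma> by (simp add: fun_eq_iff conv_smult_right)
  qed (rule lmul_closed[OF \<gamma>])
  show "\<exists>r. \<forall>v\<in>low r. conv R \<gamma> v \<in> low s" for s
    using conv_low[OF \<gamma>] by blast
  show "\<exists>r. \<forall>v\<in>low r. \<forall>i<n. conv R \<gamma> (shift i v) = shift i (conv R \<gamma> v)"
    using conv_shift[OF \<gamma> low_closed] by (intro exI[of _ 0]) blast
qed

text \<open>The left derivative by the letter \<open>i\<close>, which is how the star with index
  \<open>i\<close> acts.\<close>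

definition strip :: "nat \<Rightarrow> (nat list \<Rightarrow> 'a) \<Rightarrow> nat list \<Rightarrow> 'a" where
  "strip i v w = v (i # w)"

lemma strip_closed: "v \<in> carrier V \<Longrightarrow> strip i v \<in> carrier V"
  by (rule V_memI) (auto simp: strip_def V_outside)

text \<open>Deleting the first letter and appending a last one interfere only on the empty word,
  where the appended letter itself gets deleted; \<open>low 1\<close> excludes the constant
  term.\<close>

lemma strip_shift:
  assumes "v \<in> low 1"
  shows "strip i (shift j v) = shift j (strip i v)"
proof
  fix w
  note v = low_closed[OF assms]
  show "strip i (shift j v) w = shift j (strip i v) w"
  proof (cases w rule: rev_cases)
    case Nil
    then show ?thesis using shift_apply(2)[OF v, of j "[]" i] assms
      by (simp add: strip_def shift_apply strip_closed v low_def)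
  next
    case (snoc u l)
    then show ?thesis using shift_apply(2)[OF v, of j "i # u" l]
      by (simp add: strip_def shift_apply strip_closed v)
  qed
qed

lemma good_strip: "good (strip i)"
  unfolding good_def
proof (intro conjI allI)
  show "V.linear_endo (strip i)"
    by (rule V.linear_endoI) (simp_all add: strip_closed del: V_simps, simp_all add: strip_def fun_eq_iff)
  have "strip i v \<in> low s" if "v \<in> low (Suc s)" for s v
    using that strip_closed[OF low_closed[OF that]] by (simp add: low_def strip_def)
  then show "\<exists>r. \<forall>v\<in>low r. strip i v \<in> low s" for s by blast
  show "\<exists>r. \<forall>v\<in>low r. \<forall>j<n. strip i (shift j v) = shift j (strip i v)"
    using strip_shift by blast
qed

lemma strip_letter:
  "v \<in> carrier V \<Longrightarrow> strip i (conv R (basis_elt R [j]) v) = (if i = j then v else \<zero>\<^bsub>V\<^esub>)"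
  by (auto simp: fun_eq_iff strip_def conv_letter_left simp del: conv.simps)

lemma letter_closed: "i < n \<Longrightarrow> basis_elt R [i] \<in> carrier V"
  by (rule V_memI) (auto simp: basis_elt_def)

text \<open>Every nonempty word is restored by putting its first letter back; only a constant term
  would be lost.\<close>

lemma letter_strip:
  assumes "v \<in> low 1"
  shows "(\<Oplus>\<^bsub>V\<^esub>i\<in>{..<n}. conv R (basis_elt R [i]) (strip i v)) = v"
proof
  fix w
  note v = low_closed[OF assms]
  have c: "conv R (basis_elt R [i]) (strip i v) \<in> carrier V" if "i \<in> {..<n}" for i
    using that lmul_closed[OF letter_closed strip_closed[OF v]] by simp
  show "(\<Oplus>\<^bsub>V\<^esub>i\<in>{..<n}. conv R (basis_elt R [i]) (strip i v)) w = v w"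
  proof (cases w)
    case Nil
    have "(\<Oplus>i\<in>{..<n}. conv R (basis_elt R [i]) (strip i v) w) = (\<Oplus>i\<in>{..<n}. \<zero>)"
      using Nil by (intro finsum_cong') (auto simp: conv_letter_left strip_closed v simp del: conv.simps)
    with assms Nil show ?thesis using V_finsum_apply[OF finite_lessThan c, where w = w] by (simp add: low_def)
  next
    case (Cons a u)
    have *: "(\<Oplus>i\<in>{..<n}. conv R (basis_elt R [i]) (strip i v) w) = (\<Oplus>i\<in>{..<n}. if a = i then v w else \<zero>)"
      using Cons v by (intro finsum_cong')
        (auto simp: conv_letter_left strip_closed strip_def[abs_def] simp del: conv.simps)
    have "\<dots> = v w"
    proof (cases "a < n")
      case True
      then show ?thesis using v by (intro add.finprod_singleton) auto
    next
      case False
      with Cons have "w \<notin> lists {..<n}" by simp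
      then have "v w = \<zero>" using v by (rule V_outside[rotated])
      then have "(\<Oplus>i\<in>{..<n}. if a = i then v w else \<zero>) = (\<Oplus>i\<in>{..<n}. \<zero>)"
        by (intro finsum_cong') auto
      with \<open>v w = \<zero>\<close> show ?thesis by simp
    qed
    with * show ?thesis using V_finsum_apply[OF finite_lessThan c, where w = w] by simp
  qed
qed

end

text \<open>\<open>A\<close> is the algebra to be localized and \<open>\<alpha>\<close> its action
  on \<open>V\<close>. The assumptions ask for a unital action by good operators in which
  \<open>x i\<close> acts as left multiplication by a letter, so the argument is carried out once
  for all three algebras.\<close>

locale leavitt_action = base_change +
  fixes A :: "('c, 'r, 'e) module_scheme" and x :: "nat \<Rightarrow> 'r" and \<alpha>
  assumes A_add: "\<And>r s. r \<in> carrier A \<Longrightarrow> s \<in> carrier A \<Longrightarrow> r \<oplus>\<^bsub>A\<^esub> s \<in> carrier A"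
    and A_mult: "\<And>r s. r \<in> carrier A \<Longrightarrow> s \<in> carrier A \<Longrightarrow> r \<otimes>\<^bsub>A\<^esub> s \<in> carrier A"
    and A_smult: "\<And>c r. c \<in> carrier K \<Longrightarrow> r \<in> carrier A \<Longrightarrow> c \<odot>\<^bsub>A\<^esub> r \<in> carrier A"
    and A_one: "\<one>\<^bsub>A\<^esub> \<in> carrier A"
    and A_x: "\<And>i. i < n \<Longrightarrow> x i \<in> carrier A"
    and \<alpha>_good: "\<And>r. r \<in> carrier A \<Longrightarrow> good (\<alpha> r)"
    and \<alpha>_add: "\<And>r s v. r \<in> carrier A \<Longrightarrow> s \<in> carrier A \<Longrightarrow> v \<in> carrier V \<Longrightarrow> \<alpha> (r \<oplus>\<^bsub>A\<^esub> s) v = \<alpha> r v \<oplus>\<^bsub>V\<^esub> \<alpha> s v"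
    and \<alpha>_mult: "\<And>r s v. r \<in> carrier A \<Longrightarrow> s \<in> carrier A \<Longrightarrow> v \<in> carrier V \<Longrightarrow> \<alpha> (r \<otimes>\<^bsub>A\<^esub> s) v = \<alpha> r (\<alpha> s v)"
    and \<alpha>_smult: "\<And>c r v. c \<in> carrier K \<Longrightarrow> r \<in> carrier A \<Longrightarrow> v \<in> carrier V \<Longrightarrow> \<alpha> (c \<odot>\<^bsub>A\<^esub> r) v = \<pi> c \<odot>\<^bsub>V\<^esub> \<alpha> r v"
    and \<alpha>_one: "\<And>v. v \<in> carrier V \<Longrightarrow> \<alpha> \<one>\<^bsub>A\<^esub> v = v"
    and \<alpha>_x: "\<And>i v. i < n \<Longrightarrow> v \<in> carrier V \<Longrightarrow> \<alpha> (x i) v = conv R (basis_elt R [i]) v"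
begin

abbreviation "gens \<equiv> leavitt_generators A n"
abbreviation "F \<equiv> free_algebra K gens"

definition gen_op :: "'r + nat \<Rightarrow> (nat list \<Rightarrow> 'a) \<Rightarrow> nat list \<Rightarrow> 'a" where
  "gen_op = case_sum \<alpha> strip"

lemma gen_op_good: "a \<in> gens \<Longrightarrow> good (gen_op a)"
  by (auto simp: leavitt_generators_def gen_op_def \<alpha>_good good_strip)

sublocale W: monoid_action R n K \<pi> "free_monoid gens" "foldr gen_op"
  by unfold_locales (auto simp: free_monoid_def intro!: good_foldr gen_op_good)

definition \<rho> :: "(('r + nat) list \<Rightarrow> 'c) \<Rightarrow> (nat list \<Rightarrow> 'a) \<Rightarrow> nat list \<Rightarrow> 'a" where
  "\<rho> = act (free_monoid gens) (foldr gen_op)"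

sublocale F: ring F by (rule K.free_algebra_ring)

lemmas \<rho>_good = W.act_good[folded free_algebra_def \<rho>_def]
  and \<rho>_closed = W.act_closed[folded free_algebra_def \<rho>_def]
  and \<rho>_add = W.act_add[folded free_algebra_def \<rho>_def]
  and \<rho>_smult = W.act_smult[folded free_algebra_def \<rho>_def]
  and \<rho>_mult = W.act_mult[folded free_algebra_def \<rho>_def]
  and \<rho>_one = W.act_one[folded free_algebra_def \<rho>_def]

lemma F_smult: "c \<in> carrier K \<Longrightarrow> f \<in> carrier F \<Longrightarrow> c \<odot>\<^bsub>F\<^esub> f \<in> carrier F"
  unfolding free_algebra_def by (rule Module.module.smult_closed[OF K.monoid_algebra_module])

lemma over_closed: "r \<in> carrier A \<Longrightarrow> basis_elt K [Inl r] \<in> carrier F"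
  unfolding free_algebra_def
  by (rule K.basis_elt_closed) (auto simp: free_monoid_def leavitt_generators_def)

lemma star_closed: "i < n \<Longrightarrow> basis_elt K [Inr i] \<in> carrier F"
  unfolding free_algebra_def
  by (rule K.basis_elt_closed) (auto simp: free_monoid_def leavitt_generators_def)

lemma \<rho>_over: "r \<in> carrier A \<Longrightarrow> v \<in> carrier V \<Longrightarrow> \<rho> (basis_elt K [Inl r]) v = \<alpha> r v"
  unfolding \<rho>_def by (subst W.act_basis_elt) (auto simp: free_monoid_def leavitt_generators_def gen_op_def)

lemma \<rho>_star: "i < n \<Longrightarrow> v \<in> carrier V \<Longrightarrow> \<rho> (basis_elt K [Inr i]) v = strip i v"
  unfolding \<rho>_def by (subst W.act_basis_elt) (auto simp: free_monoid_def leavitt_generators_def gen_op_def)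

lemma \<rho>_zero: "\<rho> \<zero>\<^bsub>F\<^esub> v = \<zero>\<^bsub>V\<^esub>"
  unfolding \<rho>_def act_def by (simp add: free_algebra_def monoid_algebra_def)

lemma \<rho>_minus_add:
  assumes "f \<in> carrier F" "g \<in> carrier F" "v \<in> carrier V"
  shows "\<rho> f v = \<rho> (f \<ominus>\<^bsub>F\<^esub> g) v \<oplus>\<^bsub>V\<^esub> \<rho> g v"
proof -
  have "f = (f \<ominus>\<^bsub>F\<^esub> g) \<oplus>\<^bsub>F\<^esub> g" using assms by (simp add: F.minus_eq F.a_assoc F.l_neg)
  then show ?thesis using \<rho>_add[of "f \<ominus>\<^bsub>F\<^esub> g" g v] assms by simp
qed

lemma \<rho>_minus:
  assumes "f \<in> carrier F" "g \<in> carrier F" "v \<in> carrier V"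
  shows "\<rho> (f \<ominus>\<^bsub>F\<^esub> g) v = \<rho> f v \<ominus>\<^bsub>V\<^esub> \<rho> g v"
proof -
  have "\<rho> (f \<ominus>\<^bsub>F\<^esub> g) v \<in> carrier V" "\<rho> g v \<in> carrier V" using assms \<rho>_closed by auto
  then show ?thesis unfolding \<rho>_minus_add[OF assms]
    by (simp only: V.M.minus_eq V.M.a_assoc V.M.r_neg V.M.r_zero V.M.a_inv_closed)
qed

lemma \<rho>_finsum:
  assumes "finite I" "\<And>i. i \<in> I \<Longrightarrow> g i \<in> carrier F" "v \<in> carrier V"
  shows "\<rho> (\<Oplus>\<^bsub>F\<^esub>i\<in>I. g i) v = (\<Oplus>\<^bsub>V\<^esub>i\<in>I. \<rho> (g i) v)"
  using assms(1,2)
proof (induction I)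
  case empty
  then show ?case using \<rho>_zero by simp
next
  case (insert a I)
  have "(\<Oplus>\<^bsub>F\<^esub>i\<in>insert a I. g i) = g a \<oplus>\<^bsub>F\<^esub> (\<Oplus>\<^bsub>F\<^esub>i\<in>I. g i)" using insert by (intro F.finsum_insert) auto
  moreover have "(\<Oplus>\<^bsub>F\<^esub>i\<in>I. g i) \<in> carrier F" using insert by (intro F.finsum_closed) auto
  moreover have "(\<Oplus>\<^bsub>V\<^esub>i\<in>insert a I. \<rho> (g i) v) = \<rho> (g a) v \<oplus>\<^bsub>V\<^esub> (\<Oplus>\<^bsub>V\<^esub>i\<in>I. \<rho> (g i) v)"
    using insert assms(3) \<rho>_closed by (intro V.M.finsum_insert) auto
  ultimately show ?case using insert assms(3) \<rho>_add by simp
qed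

text \<open>Takes the place of the kernel of a representation of the localization:
  \<open>\<rho>\<close> represents the free algebra \<open>F\<close>, but relators are only required
  to act as zero on series of large order.\<close>

definition J :: "(('r + nat) list \<Rightarrow> 'c) set" where
  "J = {f \<in> carrier F. \<exists>r. \<forall>v\<in>low r. \<rho> f v = \<zero>\<^bsub>V\<^esub>}"

text \<open>For left multiples, operators send zero to zero. For right multiples, continuity of
  \<open>\<rho> g\<close> maps a deep enough \<open>low s\<close> into the \<open>low r\<close>
  killed by \<open>f\<close>.\<close>

lemma J_ideal: "ideal J F"
proof (rule idealI[OF F.ring_axioms])
  show "subgroup J (add_monoid F)"
  proof (rule F.add.subgroupI)
    show "J \<noteq> {}" using \<rho>_zero unfolding J_def by blast
    fix f assume f: "f \<in> J"
    then obtain r where r: "\<forall>v\<in>low r. \<rho> f v = \<zero>\<^bsub>V\<^esub>" unfolding J_def by blast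
    have fF: "f \<in> carrier F" using f unfolding J_def by blast
    have "\<rho> (\<ominus>\<^bsub>F\<^esub> f) v = \<zero>\<^bsub>V\<^esub>" if v: "v \<in> low r" for v
      using \<rho>_minus[of "\<zero>\<^bsub>F\<^esub>" f v] \<rho>_zero r v fF low_closed by (simp add: F.minus_eq V.M.minus_eq del: V_simps)
    then show "\<ominus>\<^bsub>F\<^esub> f \<in> J" using fF unfolding J_def by blast
    fix g assume g: "g \<in> J"
    then obtain s where s: "\<forall>v\<in>low s. \<rho> g v = \<zero>\<^bsub>V\<^esub>" unfolding J_def by blast
    have gF: "g \<in> carrier F" using g unfolding J_def by blast
    have "low (max r s) \<subseteq> low r" "low (max r s) \<subseteq> low s" by (rule low_mono, simp)+
    then have "\<rho> (f \<oplus>\<^bsub>F\<^esub> g) v = \<zero>\<^bsub>V\<^esub>" if v: "v \<in> low (max r s)" for v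
      using \<rho>_add[OF fF gF low_closed[OF v]] r s v by (simp add: subset_iff)
    then show "f \<oplus>\<^bsub>F\<^esub> g \<in> J" using fF gF unfolding J_def by blast
  qed (auto simp: J_def)
next
  fix f g assume f: "f \<in> J" and g: "g \<in> carrier F"
  then obtain r where r: "\<forall>v\<in>low r. \<rho> f v = \<zero>\<^bsub>V\<^esub>" unfolding J_def by blast
  have fF: "f \<in> carrier F" using f unfolding J_def by blast
  have "\<rho> (g \<otimes>\<^bsub>F\<^esub> f) v = \<zero>\<^bsub>V\<^esub>" if v: "v \<in> low r" for v
    using \<rho>_mult[OF g fF low_closed[OF v]] r v V.linear_endo_zero[OF goodD(1)[OF \<rho>_good[OF g]]]
    by (simp del: V_simps)
  then show "g \<otimes>\<^bsub>F\<^esub> f \<in> J" using fF g unfolding J_def by blast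
  obtain s where s: "\<forall>v\<in>low s. \<rho> g v \<in> low r" using goodD(2)[OF \<rho>_good[OF g]] by blast
  have "\<rho> (f \<otimes>\<^bsub>F\<^esub> g) v = \<zero>\<^bsub>V\<^esub>" if v: "v \<in> low s" for v
    using \<rho>_mult[OF fF g low_closed[OF v]] r s v by (simp del: V_simps)
  then show "f \<otimes>\<^bsub>F\<^esub> g \<in> J" using fF g unfolding J_def by blast
qed

lemma minus_in_J:
  assumes "f \<in> carrier F" "g \<in> carrier F" "\<And>v. v \<in> low r \<Longrightarrow> \<rho> f v = \<rho> g v"
  shows "f \<ominus>\<^bsub>F\<^esub> g \<in> J"
proof -
  have "\<rho> (f \<ominus>\<^bsub>F\<^esub> g) v = \<zero>\<^bsub>V\<^esub>" if v: "v \<in> low r" for v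
    using \<rho>_minus[OF assms(1,2) low_closed[OF v]] assms(3)[OF v] \<rho>_closed[OF assms(2) low_closed[OF v]]
    by (simp add: V.M.minus_eq V.M.r_neg del: V_simps)
  then show ?thesis using assms(1,2) unfolding J_def by blast
qed

lemma J_minusD:
  assumes "f \<ominus>\<^bsub>F\<^esub> g \<in> J" "f \<in> carrier F" "g \<in> carrier F"
  obtains r where "\<And>v. v \<in> low r \<Longrightarrow> \<rho> f v = \<rho> g v"
proof -
  obtain r where r: "\<And>v. v \<in> low r \<Longrightarrow> \<rho> (f \<ominus>\<^bsub>F\<^esub> g) v = \<zero>\<^bsub>V\<^esub>" using assms(1) unfolding J_def by blast
  have "\<rho> f v = \<rho> g v" if v: "v \<in> low r" for v
    using \<rho>_minus_add[OF assms(2,3) low_closed[OF v]] r[OF v] \<rho>_closed[OF assms(3) low_closed[OF v]]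
    by (simp del: V_simps)
  then show ?thesis by (rule that)
qed

abbreviation "rels \<equiv> leavitt_relators K A n x"

lemma rels_subset_J: "rels \<subseteq> J"
proof -
  let ?o = "\<lambda>r. basis_elt K [Inl r]" and ?s = "\<lambda>i. basis_elt K [Inr i]"
  have 1: "?o (r \<oplus>\<^bsub>A\<^esub> s) \<ominus>\<^bsub>F\<^esub> (?o r \<oplus>\<^bsub>F\<^esub> ?o s) \<in> J" if rs: "r \<in> carrier A" "s \<in> carrier A" for r s
  proof (rule minus_in_J)
    fix v assume "v \<in> low 0"
    from low_closed[OF this] show "\<rho> (?o (r \<oplus>\<^bsub>A\<^esub> s)) v = \<rho> (?o r \<oplus>\<^bsub>F\<^esub> ?o s) v"
      using rs by (simp add: \<rho>_over \<rho>_add over_closed A_add \<alpha>_add del: V_simps)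
  qed (use rs in \<open>simp_all add: over_closed A_add\<close>)
  have 2: "?o (r \<otimes>\<^bsub>A\<^esub> s) \<ominus>\<^bsub>F\<^esub> ?o r \<otimes>\<^bsub>F\<^esub> ?o s \<in> J" if rs: "r \<in> carrier A" "s \<in> carrier A" for r s
  proof (rule minus_in_J)
    fix v assume "v \<in> low 0"
    from low_closed[OF this] show "\<rho> (?o (r \<otimes>\<^bsub>A\<^esub> s)) v = \<rho> (?o r \<otimes>\<^bsub>F\<^esub> ?o s) v"
      using rs by (simp add: \<rho>_over \<rho>_mult over_closed A_mult \<alpha>_mult good_closed[OF \<alpha>_good])
  qed (use rs in \<open>simp_all add: over_closed A_mult\<close>)
  have 3: "?o (c \<odot>\<^bsub>A\<^esub> r) \<ominus>\<^bsub>F\<^esub> c \<odot>\<^bsub>F\<^esub> ?o r \<in> J" if cr: "c \<in> carrier K" "r \<in> carrier A" for c r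
  proof (rule minus_in_J)
    fix v assume "v \<in> low 0"
    from low_closed[OF this] show "\<rho> (?o (c \<odot>\<^bsub>A\<^esub> r)) v = \<rho> (c \<odot>\<^bsub>F\<^esub> ?o r) v"
      using cr by (simp add: \<rho>_over \<rho>_smult over_closed A_smult \<alpha>_smult del: V_simps)
  qed (use cr in \<open>simp_all add: over_closed A_smult F_smult\<close>)
  have 4: "?o \<one>\<^bsub>A\<^esub> \<ominus>\<^bsub>F\<^esub> \<one>\<^bsub>F\<^esub> \<in> J"
  proof (rule minus_in_J)
    fix v assume "v \<in> low 0"
    from low_closed[OF this] show "\<rho> (?o \<one>\<^bsub>A\<^esub>) v = \<rho> \<one>\<^bsub>F\<^esub> v"
      by (simp add: \<rho>_over \<rho>_one A_one \<alpha>_one)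
  qed (simp_all add: over_closed A_one)
  have 5: "?s i \<otimes>\<^bsub>F\<^esub> ?o (x j) \<ominus>\<^bsub>F\<^esub> (if i = j then \<one>\<^bsub>F\<^esub> else \<zero>\<^bsub>F\<^esub>) \<in> J" if ij: "i < n" "j < n" for i j
  proof (rule minus_in_J)
    fix v assume "v \<in> low 0"
    from low_closed[OF this] show "\<rho> (?s i \<otimes>\<^bsub>F\<^esub> ?o (x j)) v = \<rho> (if i = j then \<one>\<^bsub>F\<^esub> else \<zero>\<^bsub>F\<^esub>) v"
      using ij by (simp add: \<rho>_over \<rho>_mult \<rho>_star over_closed star_closed A_x \<alpha>_x lmul_closed letter_closed
          strip_letter \<rho>_one \<rho>_zero)
  qed (use ij in \<open>simp_all add: over_closed star_closed A_x\<close>)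
  \<comment> \<open>The one family that needs \<open>low 1\<close> instead of \<open>low 0\<close>:
    on a constant the sum acts as zero, not as the identity.\<close>
  have 6: "(\<Oplus>\<^bsub>F\<^esub>i\<in>{..<n}. ?o (x i) \<otimes>\<^bsub>F\<^esub> ?s i) \<ominus>\<^bsub>F\<^esub> \<one>\<^bsub>F\<^esub> \<in> J"
  proof (rule minus_in_J)
    fix v assume v1: "v \<in> low 1"
    note v = low_closed[OF v1]
    have "\<rho> (\<Oplus>\<^bsub>F\<^esub>i\<in>{..<n}. ?o (x i) \<otimes>\<^bsub>F\<^esub> ?s i) v = (\<Oplus>\<^bsub>V\<^esub>i\<in>{..<n}. \<rho> (?o (x i) \<otimes>\<^bsub>F\<^esub> ?s i) v)"
      by (rule \<rho>_finsum) (simp_all add: over_closed star_closed A_x v)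
    also have "\<dots> = (\<Oplus>\<^bsub>V\<^esub>i\<in>{..<n}. conv R (basis_elt R [i]) (strip i v))"
      by (rule V.M.finsum_cong')
        (auto simp: \<rho>_over \<rho>_mult \<rho>_star over_closed star_closed A_x \<alpha>_x strip_closed v lmul_closed letter_closed)
    also have "\<dots> = \<rho> \<one>\<^bsub>F\<^esub> v" using letter_strip[OF v1] \<rho>_one[OF v] by simp
    finally show "\<rho> (\<Oplus>\<^bsub>F\<^esub>i\<in>{..<n}. ?o (x i) \<otimes>\<^bsub>F\<^esub> ?s i) v = \<rho> \<one>\<^bsub>F\<^esub> v" .
  qed (auto simp: over_closed star_closed A_x intro!: F.finsum_closed)
  show ?thesis unfolding leavitt_relators_def Let_def
    using 1 2 3 4 5 6 by (intro Un_least subsetI) blast+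
qed

lemma rels_closed: "rels \<subseteq> carrier F"
  using rels_subset_J unfolding J_def by blast

sublocale I: ideal "Idl\<^bsub>F\<^esub> rels" F by (rule F.genideal_ideal[OF rels_closed])

abbreviation "L \<equiv> leavitt_localization K A n x"

lemma L_eq: "L = F Quot (Idl\<^bsub>F\<^esub> rels)"
  by (simp add: leavitt_localization_def Let_def)

abbreviation "cls \<equiv> (+>\<^bsub>F\<^esub>) (Idl\<^bsub>F\<^esub> rels)"

lemma cls_hom: "ring_hom_ring F L cls"
  unfolding L_eq by (rule I.rcos_ring_hom_ring)

sublocale cls: ring_hom_ring F L cls by (rule cls_hom)

lemma cls_surj:
  assumes "X \<in> carrier L"
  obtains f where "f \<in> carrier F" "X = cls f"
  using assms unfolding L_eq FactRing_def A_RCOSETS_def' by auto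

lemma cls_eqI: "f \<in> carrier F \<Longrightarrow> g \<in> carrier F \<Longrightarrow> f \<ominus>\<^bsub>F\<^esub> g \<in> rels \<Longrightarrow> cls f = cls g"
  using F.quotient_eq_iff_same_a_r_cos[OF I.ideal_axioms] F.genideal_self[OF rels_closed] by blast

text \<open>The ideal generated by the relators lies in \<open>J\<close>. With
  \<open>J_minusD\<close>, an equation in the localization thus becomes an equation of operators on
  some \<open>low r\<close>.\<close>

lemma cls_eqD: "f \<in> carrier F \<Longrightarrow> g \<in> carrier F \<Longrightarrow> cls f = cls g \<Longrightarrow> f \<ominus>\<^bsub>F\<^esub> g \<in> J"
  using F.quotient_eq_iff_same_a_r_cos[OF I.ideal_axioms] F.genideal_minimal[OF J_ideal rels_subset_J] by blast

lemma iso_1_n: "free_modules_iso L 1 n"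
  unfolding free_modules_iso_1_iff[OF cls.S.ring_axioms]
proof (intro exI conjI allI impI)
  let ?o = "\<lambda>i. basis_elt K [Inl (x i)]" and ?s = "\<lambda>i. basis_elt K [Inr i]"
  let ?a = "\<lambda>i. cls (?o i)" and ?b = "\<lambda>i. cls (?s i)"
  have o: "?o i \<in> carrier F" and s: "?s i \<in> carrier F" if "i < n" for i
    using that by (simp_all add: over_closed star_closed A_x)
  show "?a \<in> {..<n} \<rightarrow> carrier L" "?b \<in> {..<n} \<rightarrow> carrier L"
    using o s cls.hom_closed by blast+
  show "?b i \<otimes>\<^bsub>L\<^esub> ?a j = (if i = j then \<one>\<^bsub>L\<^esub> else \<zero>\<^bsub>L\<^esub>)" if ij: "i < n" "j < n" for i j
  proof -
    have "?s i \<otimes>\<^bsub>F\<^esub> ?o j \<ominus>\<^bsub>F\<^esub> (if i = j then \<one>\<^bsub>F\<^esub> else \<zero>\<^bsub>F\<^esub>) \<in> rels"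
      unfolding leavitt_relators_def Let_def using ij by blast
    then have "cls (?s i \<otimes>\<^bsub>F\<^esub> ?o j) = cls (if i = j then \<one>\<^bsub>F\<^esub> else \<zero>\<^bsub>F\<^esub>)"
      using o s ij by (intro cls_eqI) auto
    then show ?thesis using cls.hom_mult[OF s[OF ij(1)] o[OF ij(2)]] by (simp split: if_splits)
  qed
  have "(\<Oplus>\<^bsub>F\<^esub>i\<in>{..<n}. ?o i \<otimes>\<^bsub>F\<^esub> ?s i) \<ominus>\<^bsub>F\<^esub> \<one>\<^bsub>F\<^esub> \<in> rels"
    unfolding leavitt_relators_def Let_def by blast
  then have "cls (\<Oplus>\<^bsub>F\<^esub>i\<in>{..<n}. ?o i \<otimes>\<^bsub>F\<^esub> ?s i) = cls \<one>\<^bsub>F\<^esub>"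
    using o s by (intro cls_eqI F.finsum_closed) auto
  moreover have "cls (\<Oplus>\<^bsub>F\<^esub>i\<in>{..<n}. ?o i \<otimes>\<^bsub>F\<^esub> ?s i) = (\<Oplus>\<^bsub>L\<^esub>i\<in>{..<n}. cls (?o i \<otimes>\<^bsub>F\<^esub> ?s i))"
    using cls.hom_finsum[of "\<lambda>i. ?o i \<otimes>\<^bsub>F\<^esub> ?s i" "{..<n}"] o s by (simp add: comp_def Pi_iff)
  moreover have "\<dots> = (\<Oplus>\<^bsub>L\<^esub>i\<in>{..<n}. ?a i \<otimes>\<^bsub>L\<^esub> ?b i)"
    using o s by (intro cls.S.finsum_cong') auto
  ultimately show "(\<Oplus>\<^bsub>L\<^esub>i\<in>{..<n}. ?a i \<otimes>\<^bsub>L\<^esub> ?b i) = \<one>\<^bsub>L\<^esub>" by simp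
qed

end

lemma (in word_series) low_finite:
  assumes "finite S" "\<And>s. s \<in> S \<Longrightarrow> \<exists>r. \<forall>v\<in>low r. X s v"
  shows "\<exists>r. \<forall>s\<in>S. \<forall>v\<in>low r. X s v"
  using assms
proof (induction S)
  case (insert a S)
  have "\<exists>r. \<forall>s\<in>S. \<forall>v\<in>low r. X s v" by (rule insert.IH) (simp add: insert.prems)
  then obtain r1 where r1: "\<forall>s\<in>S. \<forall>v\<in>low r1. X s v" ..
  have "\<exists>r. \<forall>v\<in>low r. X a v" by (rule insert.prems) simp
  then obtain r2 where r2: "\<forall>v\<in>low r2. X a v" ..
  have "low (max r1 r2) \<subseteq> low r1" "low (max r1 r2) \<subseteq> low r2" by (rule low_mono, simp)+
  with r1 r2 show ?case by (intro exI[of _ "max r1 r2"]) blast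
qed simp

section \<open>From an isomorphism of free modules to the congruence\<close>

context leavitt_action
begin

text \<open>The entries of the row and the column are lifted to \<open>F\<close>, and the finitely
  many matrix relations hold for the operators beyond some order. The lifts of the row then serve as
  \<open>P\<close> and those of the column as \<open>Q\<close> in
  \<open>rank_congruence\<close>.\<close>

lemma iso_1_congruence:
  assumes "free_modules_iso L 1 q"
  shows "q mod (n - 1) = 1 mod (n - 1)"
proof -
  obtain a b where ab: "a \<in> {..<q} \<rightarrow> carrier L" "b \<in> {..<q} \<rightarrow> carrier L"
    and ba: "\<And>i j. i < q \<Longrightarrow> j < q \<Longrightarrow> b i \<otimes>\<^bsub>L\<^esub> a j = (if i = j then \<one>\<^bsub>L\<^esub> else \<zero>\<^bsub>L\<^esub>)"
    and sum: "(\<Oplus>\<^bsub>L\<^esub>i\<in>{..<q}. a i \<otimes>\<^bsub>L\<^esub> b i) = \<one>\<^bsub>L\<^esub>"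
    using assms unfolding free_modules_iso_1_iff[OF cls.S.ring_axioms] by blast
  have "\<forall>i\<in>{..<q}. \<exists>f. f \<in> carrier F \<and> cls f = a i" "\<forall>i\<in>{..<q}. \<exists>f. f \<in> carrier F \<and> cls f = b i"
    using ab by (metis cls_surj Pi_iff)+
  then obtain f g where "\<forall>i\<in>{..<q}. f i \<in> carrier F \<and> cls (f i) = a i"
    "\<forall>i\<in>{..<q}. g i \<in> carrier F \<and> cls (g i) = b i" by metis
  then have f: "f i \<in> carrier F" "cls (f i) = a i" and g: "g i \<in> carrier F" "cls (g i) = b i"
    if "i < q" for i using that by auto
  have "\<exists>r. \<forall>v\<in>low r. \<rho> (g i) (\<rho> (f j) v) = (if i = j then v else \<zero>\<^bsub>V\<^esub>)"
    if ij: "i < q" "j < q" for i j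
  proof -
    let ?d = "if i = j then \<one>\<^bsub>F\<^esub> else \<zero>\<^bsub>F\<^esub>"
    have d: "?d \<in> carrier F" "g i \<otimes>\<^bsub>F\<^esub> f j \<in> carrier F" using f g ij by auto
    have "cls (g i \<otimes>\<^bsub>F\<^esub> f j) = cls ?d"
      using cls.hom_mult[OF g(1)[OF ij(1)] f(1)[OF ij(2)]] ba[OF ij] f(2)[OF ij(2)] g(2)[OF ij(1)]
      by (simp split: if_splits)
    from J_minusD[OF cls_eqD[OF d(2,1) this] d(2,1)] obtain r
      where r: "\<And>v. v \<in> low r \<Longrightarrow> \<rho> (g i \<otimes>\<^bsub>F\<^esub> f j) v = \<rho> ?d v" by blast
    have "\<rho> (g i) (\<rho> (f j) v) = (if i = j then v else \<zero>\<^bsub>V\<^esub>)" if v: "v \<in> low r" for v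
      using r[OF v] \<rho>_mult[OF g(1)[OF ij(1)] f(1)[OF ij(2)] low_closed[OF v]] \<rho>_one[OF low_closed[OF v]] \<rho>_zero[of v]
      by (simp split: if_splits)
    then show ?thesis by blast
  qed
  note gf = this
  have "\<exists>r. \<forall>s\<in>{..<q} \<times> {..<q}. \<forall>v\<in>low r.
      \<rho> (g (fst s)) (\<rho> (f (snd s)) v) = (if fst s = snd s then v else \<zero>\<^bsub>V\<^esub>)"
  proof (rule low_finite)
    fix s assume "s \<in> {..<q} \<times> {..<q}"
    then have "fst s < q" "snd s < q" by auto
    then show "\<exists>r. \<forall>v\<in>low r. \<rho> (g (fst s)) (\<rho> (f (snd s)) v) = (if fst s = snd s then v else \<zero>\<^bsub>V\<^esub>)"
      by (rule gf)
  qed simp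
  then obtain r1 where r1': "\<forall>s\<in>{..<q} \<times> {..<q}. \<forall>v\<in>low r1.
      \<rho> (g (fst s)) (\<rho> (f (snd s)) v) = (if fst s = snd s then v else \<zero>\<^bsub>V\<^esub>)" ..
  have r1: "\<rho> (g i) (\<rho> (f j) v) = (if i = j then v else \<zero>\<^bsub>V\<^esub>)"
    if "i < q" "j < q" "v \<in> low r1" for i j v
    using r1'[rule_format, of "(i, j)" v] that by simp
  have "\<exists>r. \<forall>j\<in>{..<q}. \<forall>v\<in>low r. \<forall>i<n. \<rho> (f j) (shift i v) = shift i (\<rho> (f j) v)"
    by (rule low_finite) (use f goodD(3)[OF \<rho>_good] in simp_all)
  then obtain r2 where r2: "\<And>j i v. j < q \<Longrightarrow> v \<in> low r2 \<Longrightarrow> i < n \<Longrightarrow>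
      \<rho> (f j) (shift i v) = shift i (\<rho> (f j) v)" by blast
  \<comment> \<open>On \<open>cut p\<close> the operators of the \<open>g i\<close> and
    \<open>f j\<close> compose as prescribed, and those of the \<open>f j\<close> commute with the
    shifts.\<close>
  obtain p where p: "cut p \<subseteq> low (max r1 r2)" by (rule cut_subset_low)
  have max: "low (max r1 r2) \<subseteq> low r1" "low (max r1 r2) \<subseteq> low r2" by (rule low_mono, simp)+
  \<comment> \<open>The word number \<open>p\<close> is used as an order bound here, which works
    because \<open>low p\<close> is contained in \<open>cut p\<close>.\<close>
  have "\<exists>r. \<forall>j\<in>{..<q}. \<forall>v\<in>low r. \<rho> (g j) v \<in> low p"
    by (rule low_finite) (use g goodD(2)[OF \<rho>_good] in simp_all)
  then obtain r3 where r3: "\<And>j v. j < q \<Longrightarrow> v \<in> low r3 \<Longrightarrow> \<rho> (g j) v \<in> low p" by blast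
  let ?S = "\<Oplus>\<^bsub>F\<^esub>i\<in>{..<q}. f i \<otimes>\<^bsub>F\<^esub> g i"
  have S: "?S \<in> carrier F" using f g by (intro F.finsum_closed) auto
  have "cls ?S = (\<Oplus>\<^bsub>L\<^esub>i\<in>{..<q}. cls (f i \<otimes>\<^bsub>F\<^esub> g i))"
    using cls.hom_finsum[of "\<lambda>i. f i \<otimes>\<^bsub>F\<^esub> g i" "{..<q}"] f g by (simp add: comp_def Pi_iff)
  also have "\<dots> = (\<Oplus>\<^bsub>L\<^esub>i\<in>{..<q}. a i \<otimes>\<^bsub>L\<^esub> b i)"
    using f g ab by (intro cls.S.finsum_cong') auto
  also have "\<dots> = cls \<one>\<^bsub>F\<^esub>" using sum by simp
  finally have "cls ?S = cls \<one>\<^bsub>F\<^esub>" .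
  from J_minusD[OF cls_eqD[OF S F.one_closed this] S F.one_closed] obtain r4
    where r4: "\<And>v. v \<in> low r4 \<Longrightarrow> \<rho> ?S v = \<rho> \<one>\<^bsub>F\<^esub> v" by blast
  \<comment> \<open>Chosen after \<open>p\<close>: on \<open>cut s\<close> the operators of the
    \<open>g j\<close> take values in \<open>cut p\<close>, and the products of \<open>f i\<close>
    and \<open>g i\<close> sum to the identity.\<close>
  obtain s where s: "cut s \<subseteq> low (max r3 r4)" by (rule cut_subset_low)
  have max': "low (max r3 r4) \<subseteq> low r3" "low (max r3 r4) \<subseteq> low r4" by (rule low_mono, simp)+
  show ?thesis
  proof (rule rank_congruence)
    show "V.linear_endo (\<rho> (f j))" "V.linear_endo (\<rho> (g j))" if "j < q" for j
      using goodD(1)[OF \<rho>_good] f g that by blast+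
    show "\<rho> (f j) (shift i v) = shift i (\<rho> (f j) v)" if "j < q" "i < n" "v \<in> cut p" for j i v
      using r2[OF that(1) _ that(2)] that(3) p max by blast
    show "\<rho> (g j) v \<in> cut p" if "j < q" "v \<in> cut s" for j v
      using r3[OF that(1)] that(2) s max' low_subset_cut by blast
    show "\<rho> (g i) (\<rho> (f j) v) = (if i = j then v else \<zero>\<^bsub>V\<^esub>)" if "i < q" "j < q" "v \<in> cut p" for i j v
      using that p max by (intro r1) auto
    show "(\<Oplus>\<^bsub>V\<^esub>j\<in>{..<q}. \<rho> (f j) (\<rho> (g j) v)) = v" if v: "v \<in> cut s" for v
    proof -
      note vV = cut_closed[OF v]
      have "(\<Oplus>\<^bsub>V\<^esub>j\<in>{..<q}. \<rho> (f j) (\<rho> (g j) v)) = (\<Oplus>\<^bsub>V\<^esub>j\<in>{..<q}. \<rho> (f j \<otimes>\<^bsub>F\<^esub> g j) v)"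
        using f g vV by (intro V.M.finsum_cong') (auto simp: \<rho>_mult \<rho>_closed simp del: V_simps)
      also have "\<dots> = \<rho> ?S v" using f g vV by (intro \<rho>_finsum[symmetric]) auto
      also have "\<dots> = \<rho> \<one>\<^bsub>F\<^esub> v" using r4 v s max' by blast
      also have "\<dots> = v" by (rule \<rho>_one[OF vV])
      finally show ?thesis .
    qed
  qed
qed

lemma L_module_type: "has_module_type L 1 n"
  unfolding has_module_type_1_iff
proof (intro conjI allI impI iso_1_n)
  show "1 < n" using n_ge_2 by simp
  fix q assume q: "1 < q \<and> q < n"
  show "\<not> free_modules_iso L 1 q"
  proof
    assume "free_modules_iso L 1 q"
    then have "q mod (n - 1) = 1 mod (n - 1)" by (rule iso_1_congruence)
    \<comment> \<open>Such a \<open>q\<close> exists only for \<open>n \<ge> 3\<close>, so 1 is its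
      own residue; then \<open>q = n - 1\<close> has residue 0, and every other \<open>q\<close> in
      range is its own residue.\<close>
    moreover have "1 mod (n - 1) = 1" using q by (intro mod_less) linarith
    moreover have "q mod (n - 1) = q" if "q \<noteq> n - 1" using q that by (intro mod_less) linarith
    ultimately show False using q by (cases "q = n - 1") simp_all
  qed
qed

end

section \<open>The free algebra and the power series algebra\<close>

context base_change
begin

lemma base_change_V:
  assumes "f \<in> coeff_functions K (free_monoid {..<n})"
  shows "\<pi> \<circ> f \<in> carrier V"
  using assms K.coeff_functions_closed[OF assms]
  by (intro V_memI) (auto simp: coeff_functions_def free_monoid_def)

lemma base_change_conv:
  assumes "\<And>w. f w \<in> carrier K" "\<And>w. g w \<in> carrier K"
  shows "\<pi> (conv K f g w) = conv R (\<lambda>w. \<pi> (f w)) (\<lambda>w. \<pi> (g w)) w"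
  using assms by (induction w arbitrary: f) (auto simp: K.conv_closed)

text \<open>Any algebra of series that contains the words acts by left multiplication once its
  coefficients are reduced to the field. Polynomials and power series are treated alike, since
  \<open>conv\<close> involves no sum over the support.\<close>

lemma word_algebra_module_type:
  assumes C: "C \<subseteq> coeff_functions K (free_monoid {..<n})"
    and add: "\<And>f g. f \<in> C \<Longrightarrow> g \<in> C \<Longrightarrow> (\<lambda>w. f w \<oplus>\<^bsub>K\<^esub> g w) \<in> C"
    and mult: "\<And>f g. f \<in> C \<Longrightarrow> g \<in> C \<Longrightarrow> conv K f g \<in> C"
    and smult: "\<And>c f. c \<in> carrier K \<Longrightarrow> f \<in> C \<Longrightarrow> (\<lambda>w. c \<otimes>\<^bsub>K\<^esub> f w) \<in> C"
    and basis: "\<And>w. w \<in> lists {..<n} \<Longrightarrow> basis_elt K w \<in> C"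
  shows "has_module_type (leavitt_localization K (convolution_algebra K (free_monoid {..<n}) C) n
    (\<lambda>i. basis_elt K [i])) 1 n"
proof -
  let ?A = "convolution_algebra K (free_monoid {..<n}) C"
  have c: "f w \<in> carrier K" if "f \<in> C" for f w
    using K.coeff_functions_closed[OF subsetD[OF C that]] .
  have V: "\<pi> \<circ> f \<in> carrier V" if "f \<in> C" for f
    using base_change_V C that by blast
  have mul: "f \<otimes>\<^bsub>?A\<^esub> g = conv K f g" if "f \<in> C" "g \<in> C" for f g
    using K.mult_free_monoid C that by blast
  have one: "\<one>\<^bsub>?A\<^esub> = basis_elt K []" by (simp add: basis_elt_def free_monoid_def)
  interpret leavitt_action R n K \<pi> ?A "\<lambda>i. basis_elt K [i]" "\<lambda>f. conv R (\<pi> \<circ> f)"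
  proof
    fix r s v assume "r \<in> carrier ?A" "s \<in> carrier ?A" and v: "v \<in> carrier V"
    then have rs: "r \<in> C" "s \<in> C" by auto
    show "conv R (\<pi> \<circ> (r \<oplus>\<^bsub>?A\<^esub> s)) v = conv R (\<pi> \<circ> r) v \<oplus>\<^bsub>V\<^esub> conv R (\<pi> \<circ> s) v"
      using c[OF rs(1)] c[OF rs(2)] v by (simp add: fun_eq_iff comp_def conv_add_left)
    show "conv R (\<pi> \<circ> (r \<otimes>\<^bsub>?A\<^esub> s)) v = conv R (\<pi> \<circ> r) (conv R (\<pi> \<circ> s) v)"
    proof -
      have eq: "\<pi> \<circ> conv K r s = conv R (\<pi> \<circ> r) (\<pi> \<circ> s)"
        using base_change_conv[of r s, OF c[OF rs(1)] c[OF rs(2)]] by (simp add: fun_eq_iff comp_def)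
      show ?thesis unfolding mul[OF rs] eq
        by (rule ext) (rule conv_assoc[OF V_coeff[OF V[OF rs(1)]] V_coeff[OF V[OF rs(2)]] V_coeff[OF v]])
    qed
  next
    fix a r v assume a: "a \<in> carrier K" and "r \<in> carrier ?A" and v: "v \<in> carrier V"
    then have r: "r \<in> C" by simp
    show "conv R (\<pi> \<circ> (a \<odot>\<^bsub>?A\<^esub> r)) v = \<pi> a \<odot>\<^bsub>V\<^esub> conv R (\<pi> \<circ> r) v"
      using a c[OF r] v by (simp add: fun_eq_iff comp_def conv_smult_left)
  next
    fix v assume v: "v \<in> carrier V"
    have one': "\<pi> \<circ> \<one>\<^bsub>?A\<^esub> = (\<lambda>w. if w = [] then \<one> else \<zero>)" by (auto simp: free_monoid_def)
    show "conv R (\<pi> \<circ> \<one>\<^bsub>?A\<^esub>) v = v"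
      unfolding one' using conv_one_left[OF V_coeff[OF v]] by (rule ext)
    fix i :: nat
    have "\<pi> \<circ> basis_elt K [i] = basis_elt R [i]" by (auto simp: basis_elt_def)
    then show "conv R (\<pi> \<circ> basis_elt K [i]) v = conv R (basis_elt R [i]) v" by simp
  next
    fix r s assume "r \<in> carrier ?A" "s \<in> carrier ?A"
    then have rs: "r \<in> C" "s \<in> C" by auto
    show "r \<oplus>\<^bsub>?A\<^esub> s \<in> carrier ?A" using add[OF rs] by simp
    show "r \<otimes>\<^bsub>?A\<^esub> s \<in> carrier ?A" using mult[OF rs] by (simp add: mul[OF rs])
  next
    fix a r assume "a \<in> carrier K" "r \<in> carrier ?A"
    then show "a \<odot>\<^bsub>?A\<^esub> r \<in> carrier ?A" using smult[of a r] by simp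
  next
    show "\<one>\<^bsub>?A\<^esub> \<in> carrier ?A" unfolding one using basis[of "[]"] by simp
  next
    fix i assume "i < n"
    then show "basis_elt K [i] \<in> carrier ?A" using basis[of "[i]"] by simp
  next
    fix r assume "r \<in> carrier ?A"
    then show "good (conv R (\<pi> \<circ> r))" using good_conv[OF V[of r]] by simp
  qed
  show ?thesis by (rule L_module_type)
qed

lemma free_algebra_module_type:
  "has_module_type (leavitt_localization K (free_algebra K {..<n}) n (\<lambda>i. basis_elt K [i])) 1 n"
proof -
  let ?A = "monoid_algebra K (free_monoid {..<n})"
  interpret A: Module.module K ?A by (rule K.monoid_algebra_module)
  interpret F: ring ?A using K.free_algebra_ring[of "{..<n}"] by (simp add: free_algebra_def)
  let ?C = "{f \<in> coeff_functions K (free_monoid {..<n}). finite {w. f w \<noteq> \<zero>\<^bsub>K\<^esub>}}"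
  have C: "carrier ?A = ?C" by (rule carrier_monoid_algebra)
  have "has_module_type (leavitt_localization K (convolution_algebra K (free_monoid {..<n}) ?C) n
    (\<lambda>i. basis_elt K [i])) 1 n"
  proof (rule word_algebra_module_type)
    fix f g assume fg: "f \<in> ?C" "g \<in> ?C"
    show "(\<lambda>w. f w \<oplus>\<^bsub>K\<^esub> g w) \<in> ?C"
      using A.M.a_closed[of f g] fg unfolding C by (simp add: monoid_algebra_def)
    have "f \<otimes>\<^bsub>?A\<^esub> g \<in> ?C" using F.m_closed[of f g] fg unfolding C by simp
    then show "conv K f g \<in> ?C"
      using K.mult_free_algebra[of f "{..<n}" g] fg C by (simp add: free_algebra_def)
  next
    fix c f assume "c \<in> carrier K" "f \<in> ?C"
    then show "(\<lambda>w. c \<otimes>\<^bsub>K\<^esub> f w) \<in> ?C"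
      using A.smult_closed[of c f] unfolding C by (simp add: monoid_algebra_def)
  next
    fix w assume "w \<in> lists {..<n}"
    then show "basis_elt K w \<in> ?C" using K.basis_elt_closed[of w "free_monoid {..<n}"] unfolding C
      by (simp add: free_monoid_def)
  qed blast
  then show ?thesis by (simp add: free_algebra_def monoid_algebra_def)
qed

lemma power_series_algebra_module_type:
  "has_module_type (leavitt_localization K (power_series_algebra K {..<n}) n (\<lambda>i. basis_elt K [i])) 1 n"
  unfolding power_series_algebra_def
proof (rule word_algebra_module_type)
  fix w assume "w \<in> lists {..<n}"
  then show "basis_elt K w \<in> coeff_functions K (free_monoid {..<n})"
    by (auto simp: coeff_functions_def free_monoid_def basis_elt_def)
next
  fix f g assume "f \<in> coeff_functions K (free_monoid {..<n})" "g \<in> coeff_functions K (free_monoid {..<n})"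
  then show "conv K f g \<in> coeff_functions K (free_monoid {..<n})"
    by (rule K.conv_in_coeff_functions)
next
  fix f g assume "f \<in> coeff_functions K (free_monoid {..<n})" "g \<in> coeff_functions K (free_monoid {..<n})"
  then show "(\<lambda>w. f w \<oplus>\<^bsub>K\<^esub> g w) \<in> coeff_functions K (free_monoid {..<n})"
    by (auto simp: coeff_functions_def Pi_iff)
next
  fix c f assume "c \<in> carrier K" "f \<in> coeff_functions K (free_monoid {..<n})"
  then show "(\<lambda>w. c \<otimes>\<^bsub>K\<^esub> f w) \<in> coeff_functions K (free_monoid {..<n})"
    by (auto simp: coeff_functions_def Pi_iff)
qed simp

end

section \<open>The group algebra of the free group\<close>

lemma cancel_cons_reduced: "reduced w \<Longrightarrow> reduced (cancel_cons a w)"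
  by (cases "(a, w)" rule: cancel_cons.cases) (auto elim: reduced.elims)

lemma foldr_cancel_cons_reduced: "reduced w \<Longrightarrow> reduced (foldr cancel_cons u w)"
  by (induction u) (auto intro: cancel_cons_reduced)

lemma cancel_cons_lists: "a \<in> S \<Longrightarrow> w \<in> lists S \<Longrightarrow> cancel_cons a w \<in> lists S"
  by (cases w) auto

lemma foldr_cancel_cons_lists: "u \<in> lists S \<Longrightarrow> w \<in> lists S \<Longrightarrow> foldr cancel_cons u w \<in> lists S"
  by (induction u) (simp_all add: cancel_cons_lists del: in_lists_conv_set)

context word_series
begin

text \<open>The power series \<open>1 + x\<^sub>i\<close> and its inverse, the image of \<open>t\<^sub>i\<close> and of its inverse.\<close>

definition unit_series :: "nat \<Rightarrow> nat list \<Rightarrow> 'a" where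
  "unit_series i w = basis_elt R [] w \<oplus> basis_elt R [i] w"

primrec geometric_series :: "nat \<Rightarrow> nat list \<Rightarrow> 'a" where
  "geometric_series i [] = \<one>"
| "geometric_series i (a # w) = (if a = i then \<ominus> geometric_series i w else \<zero>)"

lemma unit_series_V: "i < n \<Longrightarrow> unit_series i \<in> carrier V"
  by (rule V_memI) (auto simp: unit_series_def basis_elt_def)

lemma geometric_series_closed [simp]: "geometric_series i w \<in> carrier R"
  by (induction w) auto

lemma geometric_series_V: "i < n \<Longrightarrow> geometric_series i \<in> carrier V"
proof (rule V_memI)
  fix w show "i < n \<Longrightarrow> w \<notin> lists {..<n} \<Longrightarrow> geometric_series i w = \<zero>"
    by (induction w) auto
qed simp

lemma geometric_series_snoc:
  "geometric_series i (w @ [a]) = (if a = i then \<ominus> geometric_series i w else \<zero>)"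
  by (induction w) auto

lemma basis_elt_Nil: "basis_elt R [] = (\<lambda>w. if w = [] then \<one> else \<zero>)"
  by (simp add: basis_elt_def)

lemma unit_series_conv:
  assumes "v \<in> carrier V"
  shows "conv R (unit_series i) v w = v w \<oplus> conv R (basis_elt R [i]) v w"
proof -
  have "conv R (unit_series i) v w = conv R (basis_elt R []) v w \<oplus> conv R (basis_elt R [i]) v w"
    unfolding unit_series_def[abs_def] using assms by (intro conv_add_left) (auto simp: basis_elt_def)
  then show ?thesis unfolding basis_elt_Nil using assms by (simp add: conv_one_left)
qed

lemma unit_geometric:
  assumes "i < n"
  shows "conv R (unit_series i) (geometric_series i) = (\<lambda>w. if w = [] then \<one> else \<zero>)"
proof
  fix w show "conv R (unit_series i) (geometric_series i) w = (if w = [] then \<one> else \<zero>)"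
    unfolding unit_series_conv[OF geometric_series_V[OF assms]]
    by (cases w) (auto simp: conv_letter_left l_neg simp del: conv.simps)
qed

lemma geometric_unit:
  assumes "i < n"
  shows "conv R (geometric_series i) (unit_series i) = (\<lambda>w. if w = [] then \<one> else \<zero>)"
proof
  fix w
  have "conv R (geometric_series i) (unit_series i) w
      = conv R (geometric_series i) (basis_elt R []) w \<oplus> conv R (geometric_series i) (basis_elt R [i]) w"
    unfolding unit_series_def[abs_def] by (intro conv_add_right) (auto simp: basis_elt_def)
  also have "conv R (geometric_series i) (basis_elt R []) w = geometric_series i w"
    unfolding basis_elt_Nil by (rule conv_one_right) simp
  also have "geometric_series i w \<oplus> conv R (geometric_series i) (basis_elt R [i]) w
      = (if w = [] then \<one> else \<zero>)"
    by (cases w rule: rev_cases)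
      (auto simp: conv_letter_right geometric_series_snoc l_neg simp del: conv.simps)
  finally show "conv R (geometric_series i) (unit_series i) w = (if w = [] then \<one> else \<zero>)" .
qed

text \<open>The Magnus representation of the free group: a generator acts as left multiplication by
  \<open>1 + x_i\<close>, its inverse as left multiplication by the geometric series.\<close>

definition letter_op :: "nat \<times> bool \<Rightarrow> (nat list \<Rightarrow> 'a) \<Rightarrow> nat list \<Rightarrow> 'a" where
  "letter_op a = conv R (if snd a then unit_series (fst a) else geometric_series (fst a))"

lemma letter_op_good: "a \<in> {..<n} \<times> UNIV \<Longrightarrow> good (letter_op a)"
  unfolding letter_op_def by (auto intro!: good_conv unit_series_V geometric_series_V)

lemma letter_op_cancel:
  assumes "a \<in> {..<n} \<times> UNIV" "fst a = fst b" "snd a \<noteq> snd b" "v \<in> carrier V"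
  shows "letter_op a (letter_op b v) = v"
proof -
  let ?c = "\<lambda>a. if snd a then unit_series (fst a) else geometric_series (fst a)"
  have i: "fst a < n" using assms(1) by auto
  have "letter_op a (letter_op b v) = conv R (conv R (?c a) (?c b)) v"
    unfolding letter_op_def
  proof (rule ext, rule conv_assoc[symmetric])
    show "?c a w \<in> carrier R" "?c b w \<in> carrier R" "v w \<in> carrier R" for w
      using V_coeff[OF unit_series_V[OF i]] assms(2,4) by auto
  qed
  also have "conv R (?c a) (?c b) = (\<lambda>w. if w = [] then \<one> else \<zero>)"
    using unit_geometric[OF i] geometric_unit[OF i] assms(2,3) by auto
  also have "conv R \<dots> v = v" using assms(4) by (intro ext conv_one_left) simp
  finally show ?thesis .
qed

text \<open>\<open>cancel_cons\<close> either prepends the letter or removes an adjacent inverse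
  pair, and such a pair acts as the identity. Hence multiplication of reduced words will become
  composition of operators.\<close>

lemma foldr_letter_op_cancel_cons:
  assumes "a \<in> {..<n} \<times> UNIV" "w \<in> lists ({..<n} \<times> UNIV)" "v \<in> carrier V"
  shows "foldr letter_op (cancel_cons a w) v = letter_op a (foldr letter_op w v)"
proof (cases w)
  case (Cons b u)
  have "foldr letter_op u v \<in> carrier V"
    by (rule good_closed[OF good_foldr assms(3)], rule letter_op_good) (use assms(2) Cons in auto)
  with Cons letter_op_cancel[OF assms(1), of b] show ?thesis by simp
qed simp

lemma foldr_letter_op_mult:
  assumes "u \<in> lists ({..<n} \<times> UNIV)" "w \<in> lists ({..<n} \<times> UNIV)" "v \<in> carrier V"
  shows "foldr letter_op (foldr cancel_cons u w) v = foldr letter_op u (foldr letter_op w v)"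
  using assms(1)
proof (induction rule: lists.induct)
  case (Cons a u)
  then have a: "a \<in> {..<n} \<times> UNIV" and u: "u \<in> lists ({..<n} \<times> UNIV)" by auto
  show ?case using foldr_letter_op_cancel_cons[OF a foldr_cancel_cons_lists[OF u assms(2)] assms(3)]
      Cons.IH by simp
qed simp

end

context base_change
begin

text \<open>The Magnus representation extends linearly to the group algebra, and there
  \<open>t_i - 1\<close> acts as left multiplication by the letter \<open>x_i\<close>, as
  \<open>leavitt_action\<close> demands.\<close>

lemma free_group_algebra_module_type:
  "has_module_type (leavitt_localization K (free_group_algebra K {..<n}) n
    (\<lambda>i. basis_elt K [(i, True)] \<ominus>\<^bsub>free_group_algebra K {..<n}\<^esub> \<one>\<^bsub>free_group_algebra K {..<n}\<^esub>)) 1 n"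
proof -
  let ?G = "free_group {..<n}" and ?A = "free_group_algebra K {..<n}"
  have A: "?A = monoid_algebra K ?G" by (simp add: free_group_algebra_def)
  interpret G: monoid_action R n K \<pi> ?G "foldr letter_op"
  proof
    fix u w assume "u \<in> carrier ?G" "w \<in> carrier ?G"
    then have uw: "u \<in> lists ({..<n} \<times> UNIV)" "w \<in> lists ({..<n} \<times> UNIV)" "reduced w"
      by (simp_all add: free_group_def)
    show "u \<otimes>\<^bsub>?G\<^esub> w \<in> carrier ?G"
      using foldr_cancel_cons_lists[OF uw(1,2)] foldr_cancel_cons_reduced[OF uw(3)]
      by (simp add: free_group_def)
    fix v assume "v \<in> carrier V"
    then show "foldr letter_op (u \<otimes>\<^bsub>?G\<^esub> w) v = foldr letter_op u (foldr letter_op w v)"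
      using foldr_letter_op_mult[OF uw(1,2)] by (simp add: free_group_def)
  next
    fix w assume "w \<in> carrier ?G"
    then have w: "w \<in> lists ({..<n} \<times> UNIV)" by (simp add: free_group_def)
    show "good (foldr letter_op w)" by (rule good_foldr, rule letter_op_good) (use w in auto)
  qed (simp_all add: free_group_def)
  interpret A: Module.module K ?A unfolding A by (rule K.monoid_algebra_module)
  have b: "basis_elt K w \<in> carrier ?A" if "w \<in> carrier ?G" for w
    unfolding A using that by (rule K.basis_elt_closed)
  have t: "[(i, True)] \<in> carrier ?G" if "i < n" for i using that by (simp add: free_group_def)
  have one: "\<one>\<^bsub>?A\<^esub> \<in> carrier ?A"
    using b[OF G.M_one] by (simp add: A monoid_algebra_def basis_elt_def)
  let ?x = "\<lambda>i. basis_elt K [(i, True)] \<ominus>\<^bsub>?A\<^esub> \<one>\<^bsub>?A\<^esub>"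
  let ?\<alpha> = "act ?G (foldr letter_op)"
  have x: "?x i \<in> carrier ?A" if "i < n" for i
    using b[OF t[OF that]] one by (simp add: A.M.minus_eq)
  interpret leavitt_action R n K \<pi> ?A ?x ?\<alpha>
  proof
    fix i v assume i: "i < n" and v: "v \<in> carrier V"
    \<comment> \<open>Adding the unit back reduces the claim about \<open>t_i - 1\<close> to the
      known action of \<open>t_i\<close>; the summand \<open>v\<close> cancels at the end.\<close>
    have "basis_elt K [(i, True)] = ?x i \<oplus>\<^bsub>?A\<^esub> \<one>\<^bsub>?A\<^esub>"
      using b[OF t[OF i]] one by (simp add: A.M.minus_eq A.M.a_assoc A.M.l_neg)
    then have "?\<alpha> (basis_elt K [(i, True)]) v = ?\<alpha> (?x i) v \<oplus>\<^bsub>V\<^esub> ?\<alpha> \<one>\<^bsub>?A\<^esub> v"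
      using G.act_add[folded A, OF x[OF i] one v] by simp
    moreover have "?\<alpha> (basis_elt K [(i, True)]) v = conv R (unit_series i) v"
      unfolding G.act_basis_elt[OF t[OF i] v] by (simp add: letter_op_def)
    moreover have "?\<alpha> \<one>\<^bsub>?A\<^esub> v = v" by (rule G.act_one[folded A, OF v])
    ultimately have "conv R (unit_series i) v = ?\<alpha> (?x i) v \<oplus>\<^bsub>V\<^esub> v" by simp
    then have eq: "v \<oplus>\<^bsub>V\<^esub> ?\<alpha> (?x i) v = v \<oplus>\<^bsub>V\<^esub> conv R (basis_elt R [i]) v"
      using V.M.a_comm[OF G.act_closed[folded A, OF x[OF i] v] v] by (simp add: unit_series_conv[OF v, abs_def])
    show "?\<alpha> (?x i) v = conv R (basis_elt R [i]) v"
      by (rule V.M.add.l_cancel[OF eq G.act_closed[folded A, OF x[OF i] v] lmul_closed[OF letter_closed[OF i] v] v])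
  next
    fix r s assume "r \<in> carrier ?A" "s \<in> carrier ?A"
    then show "r \<otimes>\<^bsub>?A\<^esub> s \<in> carrier ?A"
      unfolding A using G.M_closed by (intro K.monoid_algebra_mult_closed) blast+
  qed (simp_all only: A.M.a_closed A.smult_closed one x G.act_good[folded A] G.act_add[folded A]
      G.act_mult[folded A] G.act_smult[folded A] G.act_one[folded A])
  show ?thesis by (rule L_module_type)
qed

end

theorem proposition5p2:
  fixes K :: "('k, 'b) ring_scheme" and n :: nat
  assumes "cring K" and "\<one>\<^bsub>K\<^esub> \<noteq> \<zero>\<^bsub>K\<^esub>" and "2 \<le> n"
  shows
    "has_module_type
       (leavitt_localization K (free_algebra K {..<n}) n (\<lambda>i. basis_elt K [i])) 1 n
     \<and> has_module_type
       (leavitt_localization K (free_group_algebra K {..<n}) n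
         (\<lambda>i. basis_elt K [(i, True)]
            \<ominus>\<^bsub>free_group_algebra K {..<n}\<^esub> \<one>\<^bsub>free_group_algebra K {..<n}\<^esub>)) 1 n
     \<and> has_module_type
       (leavitt_localization K (power_series_algebra K {..<n}) n (\<lambda>i. basis_elt K [i])) 1 n"
proof -
  interpret K: cring K by fact
  \<comment> \<open>Nontriviality of \<open>K\<close> provides a maximal ideal; its residue field
    supplies the scalars of \<open>V\<close>, over which dimensions are counted.\<close>
  obtain M where "maximalideal M K" using K.exists_maximalideal[OF assms(2)] .
  then interpret M: maximalideal M K .
  interpret field "K Quot M" by (rule M.quotient_is_field[OF assms(1)])
  interpret base_change "K Quot M" n K "(+>\<^bsub>K\<^esub>) M"
    by unfold_locales (rule assms(3), rule M.rcos_ring_hom)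
  show ?thesis
    using free_algebra_module_type free_group_algebra_module_type power_series_algebra_module_type by blast
qed

end
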